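(* For every $w\in\pi_1=\pi_1(\mathbb{C}\setminus\{-1,1\},0)$ the following inequalities hold: $$\frac{1}{2\pi}\mathcal{L}(w)\le\Lambda({}_{tr}(w)_{pb})\le 300\cdot\mathcal{L}(w),\qquad \frac{1}{2\pi}\mathcal{L}(w)\le\Lambda({}_{pb}(w)_{tr})\le 300\cdot\mathcal{L}(w).$$
   Context: $\pi_1=\pi_1(\mathbb{C}\setminus\{-1,1\},0)$ is free on $a_1$, the class of a loop based at $0$ surrounding $-1$ once in the positive direction, and $a_2$, the class of a loop based at $0$ surrounding $1$ once in the positive direction. Since $(-1,1)$ and $i\mathbb{R}$ are connected, simply connected and contain $0$, each $w\in\pi_1$ determines canonically a homotopy class ${}_{tr}(w)_{pb}$ of curves in $\mathbb{C}\setminus\{-1,1\}$ with initial point in $(-1,1)$ and terminating point in $i\mathbb{R}$ (homotopies keep the endpoints in these sets), and likewise ${}_{pb}(w)_{tr}$ (initial point in $i\mathbb{R}$, terminating point in $(-1,1)$). For a homotopy class $\mathsf h$ of curves with initial point in $E_1$ and terminating point in $E_2$, a map $f$ from an open rectangle $R$ (sides parallel to the axes) continuous on $\bar R$ represents $\mathsf h$ if it maps the open lower side into $E_1$, the open upper side into $E_2$, and its restriction to the closure of every maximal vertical segment of $R$ represents $\mathsf h$. $\Lambda(\mathsf h)$ is the infimum of $\lambda(R)=\mathsf a/\mathsf b$ (vertical side length over horizontal side length) over all rectangles admitting a holomorphic map into $\mathbb{C}\setminus\{-1,1\}$ representing $\mathsf h$. Syllables of a nontrivial reduced word $w=w_1^{n_1}w_2^{n_2}\cdots$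 ($n_j\ne0$, $w_j$ alternately $a_1,a_2$; the $w_j^{n_j}$ are the terms): (1) every term with $|n_j|\ge2$ is a syllable; (2) every maximal sequence of at least two consecutive terms all having the same exponent, equal to $+1$ or to $-1$, is a syllable; (3) every remaining term is a syllable (a singleton). The degree $d_j$ of a syllable is the sum of the absolute values of the exponents of its terms. $\mathcal{L}(w)=\sum_j\log(4d_j-1)$ over all syllables; $\mathcal{L}(\text{identity})=0$. *)

theory Defs
  imports "HOL-Complex_Analysis.Complex_Analysis"
begin

definition Xpunct :: "complex set" where
  "Xpunct = - {-1, 1}"

definition E_tr :: "complex set" where
  "E_tr = {complex_of_real x | x. -1 < x \<and> x < 1}"

definition E_pb :: "complex set" where
  "E_pb = {z. Re z = 0}"

datatype gen = A1 | A2

fun gen_loop :: "gen \<Rightarrow> real \<Rightarrow> complex" where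
  "gen_loop A1 = (\<lambda>t. -1 + exp (2 * pi * \<i> * complex_of_real t))"
| "gen_loop A2 = (\<lambda>t. 1 - exp (2 * pi * \<i> * complex_of_real t))"

fun nat_pow_path :: "(real \<Rightarrow> complex) \<Rightarrow> nat \<Rightarrow> real \<Rightarrow> complex" where
  "nat_pow_path p 0 = (\<lambda>t. 0)"
| "nat_pow_path p (Suc n) = p +++ nat_pow_path p n"

definition int_pow_path :: "(real \<Rightarrow> complex) \<Rightarrow> int \<Rightarrow> real \<Rightarrow> complex" where
  "int_pow_path p n =
     (if 0 \<le> n then nat_pow_path p (nat n) else nat_pow_path (reversepath p) (nat (- n)))"

(* elements of pi_1 as reduced words: lists of terms (generator, exponent),
   exponents nonzero, consecutive generators distinct (hence alternating) *)
definition reduced_word :: "(gen \<times> int) list \<Rightarrow> bool" where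
  "reduced_word ws \<longleftrightarrow>
     (\<forall>i < length ws. snd (ws ! i) \<noteq> 0) \<and>
     (\<forall>i. Suc i < length ws \<longrightarrow> fst (ws ! i) \<noteq> fst (ws ! Suc i))"

fun word_loop :: "(gen \<times> int) list \<Rightarrow> real \<Rightarrow> complex" where
  "word_loop [] = (\<lambda>t. 0)"
| "word_loop ((g, n) # ws) = int_pow_path (gen_loop g) n +++ word_loop ws"

definition curve_class ::
  "complex set \<Rightarrow> complex set \<Rightarrow> complex set \<Rightarrow> (real \<Rightarrow> complex) \<Rightarrow> (real \<Rightarrow> complex) set" where
  "curve_class X E1 E2 \<gamma> =
     {\<delta>. homotopic_with_canon (\<lambda>h. h 0 \<in> E1 \<and> h 1 \<in> E2) {0..1} X \<gamma> \<delta>}"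

definition tr_pb :: "(gen \<times> int) list \<Rightarrow> (real \<Rightarrow> complex) set" where
  "tr_pb w = curve_class Xpunct E_tr E_pb (word_loop w)"

definition pb_tr :: "(gen \<times> int) list \<Rightarrow> (real \<Rightarrow> complex) set" where
  "pb_tr w = curve_class Xpunct E_pb E_tr (word_loop w)"

definition represents ::
  "complex set \<Rightarrow> complex set \<Rightarrow> (real \<Rightarrow> complex) set \<Rightarrow> complex \<Rightarrow> complex \<Rightarrow> (complex \<Rightarrow> complex) \<Rightarrow> bool" where
  "represents E1 E2 H a b f \<longleftrightarrow>
     continuous_on (cbox a b) f \<and>
     (\<forall>x. Re a < x \<and> x < Re b \<longrightarrow>
        f (Complex x (Im a)) \<in> E1 \<and> f (Complex x (Im b)) \<in> E2 \<and>
        (\<lambda>t. f (Complex x (Im a + t * (Im b - Im a)))) \<in> H)"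

(* extremal length Lambda(H): infimum of (vertical side)/(horizontal side) over rectangles
   admitting a holomorphic map into C \ {-1,1} representing H (infimum of empty set = \<infinity>) *)
definition Lambda :: "complex set \<Rightarrow> complex set \<Rightarrow> (real \<Rightarrow> complex) set \<Rightarrow> ereal" where
  "Lambda E1 E2 H =
     Inf {ereal ((Im b - Im a) / (Re b - Re a)) | a b.
            Re a < Re b \<and> Im a < Im b \<and>
            (\<exists>f. f holomorphic_on box a b \<and> f ` box a b \<subseteq> Xpunct \<and> represents E1 E2 H a b f)}"

function syl_degs :: "int list \<Rightarrow> nat list" where
  "syl_degs [] = []"
| "syl_degs (n # ns) =
     (if 2 \<le> \<bar>n\<bar> then nat \<bar>n\<bar> # syl_degs ns
      else Suc (length (takeWhile (\<lambda>m. m = n) ns)) # syl_degs (dropWhile (\<lambda>m. m = n) ns))"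
  by pat_completeness auto
termination
  by (relation "Wellfounded.measure length") (auto simp: le_imp_less_Suc length_dropWhile_le)

definition Lw :: "(gen \<times> int) list \<Rightarrow> real" where
  "Lw w = (\<Sum>d \<leftarrow> syl_degs (map snd w). ln (4 * real d - 1))"

end

theory Submission
  imports Defs "HOL-Probability.Distributions"
begin

text \<open>
  The modular function \<open>lam = (theta2 / theta3) ^ 4\<close> is the universal covering of the plane punctured at
  0 and 1. Its inverse branch \<open>tau z = i M(1, sqrt (1 - z)) / M(1, sqrt z)\<close>, with \<open>M\<close> the
  arithmetic-geometric mean, follows from the duplication formulas of the theta functions, which run the
  mean in both directions, and from a Gaussian Riemann sum, which fixes the constant. After the change of
  variable \<open>2 lam - 1\<close> the loops about -1 and 1 act as \<open>t \<mapsto> t + 2\<close> and \<open>t \<mapsto> t / (1 - 2 t)\<close>, the interval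
  (-1, 1) lifts to the imaginary axis and the imaginary axis lifts to the unit circle. A holomorphic
  rectangle representing the class of \<open>w\<close> therefore lifts to one that joins two geodesics of the upper half
  plane at some distance \<open>d\<close>; mapping the half plane to a strip of width \<open>pi\<close>, Cauchy's theorem on the
  rectangle gives modulus at least \<open>d / pi\<close>, and the strip itself provides rectangles of modulus \<open>d\<close>.
  Finally \<open>cosh d\<close> is the middle entry of an integral quadratic form that is acted on by the terms of \<open>w\<close>,
  and each syllable of degree \<open>k\<close> multiplies it at least by the square root of \<open>4 k - 1\<close> and the size of the
  form at most by the square of \<open>4 k - 1\<close>.
\<close>

text \<open>The main obstacle is to see that \<open>cover\<close> is a covering and to know its deck
  maps. An explicit inverse of \<open>lam\<close> on a cut plane avoids describing a fundamental
  domain: \<open>tau\<close>, moved by the symmetries of \<open>lam\<close>, gives branches over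
  three cut planes, and comparing them on half planes gives both the sheets and the monodromy. The
  law \<open>lam (- 1 / t) = 1 - lam t\<close>, often derived from Poisson summation, comes from the
  symmetry of \<open>tau\<close> under exchanging \<open>z\<close> and \<open>1 - z\<close>.
  Syllables appear because one generator is the other conjugated by the inversion
  \<open>- 1 / t\<close>. Up to a last inversion, a reduced word is a product of maps
  \<open>- 1 / (t + 2 n)\<close>, one for each term, parabolic for n = 1 or -1 and hyperbolic
  otherwise. A run of equal exponents 1 or -1 is a power of one parabolic map; it grows polynomially
  in its length and so contributes one logarithm, like a single large exponent. Constants:
  \<open>cosh d\<close> is at least \<open>exp (Lw w / 2)\<close>, which after division by
  \<open>pi\<close> gives the factor 1 / (2 pi). Upwards, d is at most
  \<open>ln 2 + 2 * Lw w\<close>, hence at most \<open>3 * Lw w\<close>.\<close>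

section \<open>Theta functions\<close>

lemma summable_exp_abs_int:
  assumes "0 < (c::real)"
  shows "(\<lambda>n::int. exp (- c * \<bar>of_int n\<bar>)) summable_on UNIV"
proof -
  have eq: "(\<lambda>n. exp (- c * real n)) = (\<lambda>n. exp (- c) ^ n)"
    by (simp add: exp_of_nat_mult[symmetric] mult.commute)
  have s: "(\<lambda>n::nat. exp (- c * real n)) summable_on UNIV"
    unfolding eq using assms
    by (intro norm_summable_imp_summable_on) (simp add: norm_power summable_geometric)
  have "(\<lambda>n::int. exp (- c * \<bar>of_int n\<bar>)) summable_on range int"
    using s by (subst summable_on_reindex) (auto simp: o_def)
  moreover have "(\<lambda>n::int. exp (- c * \<bar>of_int n\<bar>)) summable_on range (\<lambda>n. - int n)"
    using s by (subst summable_on_reindex) (auto simp: o_def inj_on_def)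
  ultimately have "(\<lambda>n::int. exp (- c * \<bar>of_int n\<bar>)) summable_on (range int \<union> range (\<lambda>n. - int n))"
    by (rule summable_on_union)
  moreover have "range int \<union> range (\<lambda>n. - int n) = UNIV"
    by (auto intro: int_cases2)
  ultimately show ?thesis by simp
qed

definition uhp :: "complex set" where "uhp = {t. 0 < Im t}"

lemma open_uhp: "open uhp" and convex_uhp: "convex uhp"
  by (auto simp: uhp_def open_halfspace_Im_gt convex_halfspace_Im_gt)

section \<open>Theta series: convergence and holomorphy\<close>

definition theta_term :: "real \<Rightarrow> int \<Rightarrow> complex \<Rightarrow> complex" where
  "theta_term s n t = exp (\<i> * of_real (pi * (of_int n + s)\<^sup>2) * t)"

definition theta2 :: "complex \<Rightarrow> complex" where
  "theta2 t = (\<Sum>\<^sub>\<infinity>n. theta_term (1/2) n t)"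

definition theta3 :: "complex \<Rightarrow> complex" where
  "theta3 t = (\<Sum>\<^sub>\<infinity>n. theta_term 0 n t)"

definition theta4 :: "complex \<Rightarrow> complex" where
  "theta4 t = (\<Sum>\<^sub>\<infinity>n. (-1) powi n * theta_term 0 n t)"

lemma norm_theta_term: "norm (theta_term s n t) = exp (- pi * (of_int n + s)\<^sup>2 * Im t)"
  by (simp add: theta_term_def)

lemma norm_theta_term_le:
  assumes "s = 0 \<or> s = 1/2" "0 < c" "c \<le> Im t"
  shows "norm (theta_term s n t) \<le> exp (pi * c) * exp (- (pi * c) * \<bar>of_int n\<bar>)"
proof -
  \<comment> \<open>A linear minorant of the quadratic exponent, valid for both shifts
    \<open>s\<close>, so that one geometric series dominates every theta series on
    \<open>c \<le> Im t\<close>.\<close>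
  have "\<bar>real_of_int n\<bar> - 1 \<le> (of_int n + s)\<^sup>2"
  proof -
    have "0 \<le> (\<bar>real_of_int n\<bar> - 1)\<^sup>2" by simp
    then have "2 * \<bar>real_of_int n\<bar> - 1 \<le> (real_of_int n)\<^sup>2"
      by (simp add: power2_eq_square algebra_simps abs_mult_self_eq)
    moreover have "(real_of_int n + 1/2)\<^sup>2 = (real_of_int n)\<^sup>2 + real_of_int n + 1/4"
      by (simp add: power2_eq_square field_simps)
    moreover have "- \<bar>real_of_int n\<bar> \<le> real_of_int n" "0 \<le> \<bar>real_of_int n\<bar>" by linarith+
    ultimately have "\<bar>real_of_int n\<bar> - 1 \<le> (real_of_int n)\<^sup>2"
        "\<bar>real_of_int n\<bar> - 1 \<le> (real_of_int n + 1/2)\<^sup>2" by linarith+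
    then show ?thesis using assms(1) by (metis add.right_neutral)
  qed
  moreover have "pi * c * (of_int n + s)\<^sup>2 \<le> pi * Im t * (of_int n + s)\<^sup>2"
    using assms by (intro mult_right_mono mult_left_mono) auto
  ultimately have "pi * c * (\<bar>real_of_int n\<bar> - 1) \<le> pi * Im t * (of_int n + s)\<^sup>2"
    using assms(2) mult_left_mono[of "\<bar>real_of_int n\<bar> - 1" "(of_int n + s)\<^sup>2" "pi * c"]
    by (meson less_imp_le mult_pos_pos order_trans pi_gt_zero)
  then show ?thesis
    unfolding norm_theta_term by (simp add: exp_add[symmetric] algebra_simps)
qed

lemma theta_term_abs_summable:
  assumes "s = 0 \<or> s = 1/2" "t \<in> uhp" "\<And>n. norm (g n) = 1"
  shows "(\<lambda>n. norm (g n * theta_term s n t)) summable_on UNIV"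
proof (rule Infinite_Sum.abs_summable_on_comparison_test')
  have "0 < pi * Im t" using assms(2) by (simp add: uhp_def)
  then show "(\<lambda>n. exp (pi * Im t) * exp (- (pi * Im t) * \<bar>of_int n\<bar>)) summable_on (UNIV :: int set)"
    by (intro summable_on_cmult_right summable_exp_abs_int)
  show "norm (g n * theta_term s n t) \<le> exp (pi * Im t) * exp (- (pi * Im t) * \<bar>of_int n\<bar>)" for n
    using norm_theta_term_le[of s "Im t" t n] assms by (simp add: norm_mult uhp_def)
qed


lemma holomorphic_theta_series:
  assumes "s = 0 \<or> s = 1/2" "\<And>n. norm (g n) = 1"
  shows "(\<lambda>t. \<Sum>\<^sub>\<infinity>n. g n * theta_term s n t) holomorphic_on uhp"
proof -
  have "\<exists>r>0. (\<lambda>t. \<Sum>\<^sub>\<infinity>n. g n * theta_term s n t) holomorphic_on ball x r" if x: "x \<in> uhp" for x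
  proof -
    define r where "r = Im x / 2"
    have r: "0 < r" using x by (simp add: r_def uhp_def)
    have im: "r \<le> Im z" if "z \<in> cball x r" for z
      using that abs_Im_le_cmod[of "x - z"] by (auto simp: dist_norm r_def)
    have "uniform_limit (cball x r) (\<lambda>X t. \<Sum>n\<in>X. g n * theta_term s n t)
       (\<lambda>t. \<Sum>\<^sub>\<infinity>n. g n * theta_term s n t) (finite_subsets_at_top UNIV)"
    proof (rule Weierstrass_m_test_general)
      show "(\<lambda>n. exp (pi * r) * exp (- (pi * r) * \<bar>of_int n\<bar>)) summable_on (UNIV :: int set)"
        using r by (intro summable_on_cmult_right summable_exp_abs_int) auto
      show "norm (g n * theta_term s n y) \<le> exp (pi * r) * exp (- (pi * r) * \<bar>of_int n\<bar>)"
        if "y \<in> cball x r" for n y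
        using norm_theta_term_le[OF assms(1) r im[OF that]] assms(2) by (simp add: norm_mult)
    qed
    then have "(\<lambda>t. \<Sum>\<^sub>\<infinity>n. g n * theta_term s n t) holomorphic_on ball x r"
      by (rule holomorphic_uniform_limit[rotated])
         (auto intro!: always_eventually continuous_intros holomorphic_intros simp: theta_term_def)
    with r show ?thesis by blast
  qed
  then show ?thesis
    by (metis (no_types, lifting) at_within_open centre_in_ball field_differentiable_at_within
        holomorphic_on_def open_ball)
qed

lemma holomorphic_theta:
  "theta2 holomorphic_on uhp" "theta3 holomorphic_on uhp" "theta4 holomorphic_on uhp"
  using holomorphic_theta_series[of "1/2" "\<lambda>_. 1"] holomorphic_theta_series[of 0 "\<lambda>_. 1"]
    holomorphic_theta_series[of 0 "\<lambda>n. (-1) powi n"]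
  by (auto simp: theta2_def[abs_def] theta3_def[abs_def] theta4_def[abs_def] norm_power_int)

section \<open>Products of theta series and the duplication formulas\<close>

lemma infsum_mult_Times:
  fixes f g :: "'a \<Rightarrow> complex"
  assumes "(\<lambda>x. norm (f x)) summable_on UNIV" "(\<lambda>x. norm (g x)) summable_on UNIV"
  shows "(\<lambda>(m, n). f m * g n) summable_on UNIV"
    "infsum f UNIV * infsum g UNIV = (\<Sum>\<^sub>\<infinity>(m, n). f m * g n)"
proof -
  have "(\<lambda>x. norm (case x of (m, n) \<Rightarrow> f m * g n)) summable_on (UNIV \<times> UNIV)"
    unfolding Infinite_Sum.abs_summable_on_Sigma_iff
    using assms by (auto simp: norm_mult intro!: summable_on_cmult_right summable_on_cmult_left
      simp: infsum_cmult_right' infsum_nonneg)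
  then show s: "(\<lambda>(m, n). f m * g n) summable_on UNIV" using abs_summable_summable by fastforce
  have "(\<Sum>\<^sub>\<infinity>m. \<Sum>\<^sub>\<infinity>n. f m * g n) = infsum (\<lambda>(m, n). f m * g n) (UNIV \<times> UNIV)"
    using s infsum_Sigma'_banach[of "\<lambda>m n. f m * g n" UNIV "\<lambda>_. UNIV"] by simp
  then show "infsum f UNIV * infsum g UNIV = (\<Sum>\<^sub>\<infinity>(m, n). f m * g n)"
    by (simp add: infsum_cmult_right' infsum_cmult_left')
qed

text \<open>The parity of the sum splits the index pairs into the two cosets of the lattice of pairs
  \<open>(a + b, a - b)\<close>. On each coset the parallelogram law turns a product of theta terms
  at \<open>t\<close> into one at \<open>2 * t\<close>; all duplication formulas rest on
  this.\<close>

lemma infsum_parity_split: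
  fixes F :: "int \<times> int \<Rightarrow> complex"
  assumes "F summable_on UNIV"
  shows "infsum F UNIV = (\<Sum>\<^sub>\<infinity>(a, b). F (a + b, a - b)) + (\<Sum>\<^sub>\<infinity>(a, b). F (a + b + 1, a - b))"
proof -
  let ?h = "\<lambda>(a, b). (a + b, a - b) :: int \<times> int"
  let ?k = "\<lambda>(a, b). (a + b + 1, a - b) :: int \<times> int"
  have inj: "inj ?h" "inj ?k" by (auto simp: inj_on_def)
  have h: "range ?h = {(m, n). even (m + n)}"
  proof (safe, goal_cases)
    case (2 m n)
    then obtain k where "m + n = 2 * k" by (meson evenE)
    then have "(m, n) = ?h (k, k - n)" by simp
    then show ?case by blast
  qed auto
  have k: "range ?k = {(m, n). odd (m + n)}"
  proof (safe, goal_cases)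
    case (2 m n)
    then obtain k where "m + n = 2 * k + 1" by (meson oddE)
    then have "(m, n) = ?k (k, k - n)" by simp
    then show ?case by blast
  qed auto
  have "range ?h \<union> range ?k = UNIV" "range ?h \<inter> range ?k = {}" unfolding h k by auto
  then have "infsum F UNIV = infsum F (range ?h) + infsum F (range ?k)"
    using infsum_Un_disjoint[of F "range ?h" "range ?k"] summable_on_subset_banach[OF assms] by auto
  also have "infsum F (range ?h) = (\<Sum>\<^sub>\<infinity>(a, b). F (a + b, a - b))"
    by (subst infsum_reindex[OF inj(1)]) (auto simp: o_def case_prod_unfold)
  also have "infsum F (range ?k) = (\<Sum>\<^sub>\<infinity>(a, b). F (a + b + 1, a - b))"
    by (subst infsum_reindex[OF inj(2)]) (auto simp: o_def case_prod_unfold)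
  finally show ?thesis .
qed

lemma theta_term_mult:
  assumes "(of_int m + s)\<^sup>2 + (of_int n + s')\<^sup>2 = 2 * ((of_int a + r)\<^sup>2 + (of_int b + r')\<^sup>2)"
  shows "theta_term s m t * theta_term s' n t = theta_term r a (2 * t) * theta_term r' b (2 * t)"
proof -
  have "theta_term s m t * theta_term s' n t
      = exp (\<i> * of_real (pi * ((of_int m + s)\<^sup>2 + (of_int n + s')\<^sup>2)) * t)"
    unfolding theta_term_def exp_add[symmetric] by (simp add: algebra_simps)
  also have "\<dots> = theta_term r a (2 * t) * theta_term r' b (2 * t)"
    unfolding assms theta_term_def exp_add[symmetric] by (simp add: algebra_simps)
  finally show ?thesis .
qed

context
  fixes t :: complex
  assumes t: "t \<in> uhp"
begin

lemma uhp_double: "2 * t \<in> uhp" using t by (simp add: uhp_def)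

lemma theta_sum_abs:
  "(\<lambda>n. norm (theta_term 0 n t)) summable_on UNIV"
  "(\<lambda>n. norm (theta_term (1/2) n t)) summable_on UNIV"
  "(\<lambda>n. norm ((-1) powi n * theta_term 0 n t)) summable_on UNIV"
  "(\<lambda>n. norm ((-1) powi n * theta_term (1/2) n t)) summable_on UNIV"
  using theta_term_abs_summable[of 0 t "\<lambda>_. 1"] theta_term_abs_summable[of "1/2" t "\<lambda>_. 1"]
    theta_term_abs_summable[of 0 t "\<lambda>n. (-1) powi n"] theta_term_abs_summable[of "1/2" t "\<lambda>n. (-1) powi n"] t
  by (auto simp: norm_power_int)

text \<open>The reflection of \<open>n\<close> to \<open>- n - 1\<close> preserves
  \<open>(n + 1/2)^2\<close> and flips the sign. This is the null value of the odd theta function;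
  it removes the odd coset from \<open>theta3 t * theta4 t\<close>.\<close>

lemma theta1_zero: "(\<Sum>\<^sub>\<infinity>n. (-1) powi n * theta_term (1/2) n t) = 0"
proof -
  have "bij_betw (\<lambda>n::int. - n - 1) UNIV UNIV"
    by (rule bij_betw_byWitness[where f' = "\<lambda>n. - n - 1"]) auto
  then have "(\<Sum>\<^sub>\<infinity>n. (-1) powi n * theta_term (1/2) n t)
     = (\<Sum>\<^sub>\<infinity>n. (-1) powi (- n - 1) * theta_term (1/2) (- n - 1) t)"
    by (rule infsum_reindex_bij_betw[symmetric])
  also have "\<dots> = (\<Sum>\<^sub>\<infinity>n. - ((-1) powi n * theta_term (1/2) n t))"
  proof (rule infsum_cong)
    fix n :: int
    have "(of_int (- n - 1) + 1/2)\<^sup>2 = (of_int n + 1/2 :: real)\<^sup>2" by (simp add: power2_eq_square algebra_simps)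
    then show "(-1) powi (- n - 1) * theta_term (1/2) (- n - 1) t = - ((-1) powi n * theta_term (1/2) n t)"
      by (cases "even n") (auto simp: theta_term_def power_int_minus_left)
  qed
  also have "\<dots> = - (\<Sum>\<^sub>\<infinity>n. (-1) powi n * theta_term (1/2) n t)" by (rule infsum_uminus)
  finally show ?thesis by simp
qed

end

text \<open>The first three formulas say that the pair of squares of \<open>theta3\<close> and
  \<open>theta4\<close> makes one step of the arithmetic-geometric mean when \<open>t\<close> is
  doubled. The first and the last say the same, up to a factor 2, for the squares of
  \<open>theta3\<close> and \<open>theta2\<close> when \<open>2 * t\<close> is halved.\<close>

lemma theta_double:
  assumes t: "t \<in> uhp"
  shows "(theta3 t)\<^sup>2 = (theta3 (2 * t))\<^sup>2 + (theta2 (2 * t))\<^sup>2"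
    and "(theta4 t)\<^sup>2 = (theta3 (2 * t))\<^sup>2 - (theta2 (2 * t))\<^sup>2"
    and "theta3 t * theta4 t = (theta4 (2 * t))\<^sup>2"
    and "(theta2 t)\<^sup>2 = 2 * theta2 (2 * t) * theta3 (2 * t)"
proof -
  note s1 = theta_sum_abs[OF t] and s2 = theta_sum_abs[OF uhp_double[OF t]]
  have sgE: "(-1::complex) powi (a + b) * (-1) powi (a - b) = 1" for a b :: int
    by (cases "even a"; cases "even b") (auto simp: power_int_minus_left)
  have sgO: "(-1::complex) powi (a + b + 1) * (-1) powi (a - b) = -1" for a b :: int
    by (cases "even a"; cases "even b") (auto simp: power_int_minus_left)
  have sgD: "(-1::complex) powi (a - b) = (-1) powi a * (-1) powi b" for a b :: int
    by (cases "even a"; cases "even b") (auto simp: power_int_minus_left)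
  have sgn_rearr: "u * x * (v * y) = (u * v) * (x * y)" for u v x y :: complex by simp
  have infsum_uminus': "(\<Sum>\<^sub>\<infinity>p. - G p) = - (\<Sum>\<^sub>\<infinity>p. G p)" for G :: "int \<times> int \<Rightarrow> complex"
    by (rule infsum_uminus)
  have T1: "theta_term 0 (a + b) t * theta_term 0 (a - b) t = theta_term 0 a (2 * t) * theta_term 0 b (2 * t)"
    for a b by (rule theta_term_mult) (simp add: power2_eq_square algebra_simps)
  have T2: "theta_term 0 (a + b + 1) t * theta_term 0 (a - b) t = theta_term (1/2) a (2 * t) * theta_term (1/2) b (2 * t)"
    for a b by (rule theta_term_mult) (simp add: power2_eq_square algebra_simps)
  have T3: "theta_term (1/2) (a + b) t * theta_term (1/2) (a - b) t = theta_term (1/2) a (2 * t) * theta_term 0 b (2 * t)"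
    for a b by (rule theta_term_mult) (simp add: power2_eq_square algebra_simps)
  have T4: "theta_term (1/2) (a + b + 1) t * theta_term (1/2) (a - b) t = theta_term 0 (a + 1) (2 * t) * theta_term (1/2) b (2 * t)"
    for a b by (rule theta_term_mult) (simp add: power2_eq_square algebra_simps)
  have T34: "theta_term 0 (a + b) t * ((-1) powi (a - b) * theta_term 0 (a - b) t)
      = ((-1) powi a * theta_term 0 a (2 * t)) * ((-1) powi b * theta_term 0 b (2 * t))" for a b
    by (simp only: sgD mult.assoc mult.left_commute[of "theta_term 0 (a + b) t"] T1)
       (simp only: mult.assoc mult.left_commute[of "theta_term 0 a (2 * t)"])
  have T34': "theta_term 0 (a + b + 1) t * ((-1) powi (a - b) * theta_term 0 (a - b) t)
      = ((-1) powi a * theta_term (1/2) a (2 * t)) * ((-1) powi b * theta_term (1/2) b (2 * t))" for a b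
    by (simp only: sgD mult.assoc mult.left_commute[of "theta_term 0 (a + b + 1) t"] T2)
       (simp only: mult.assoc mult.left_commute[of "theta_term (1/2) a (2 * t)"])
  have shift: "(\<Sum>\<^sub>\<infinity>n. theta_term 0 (n + 1) (2 * t)) = theta3 (2 * t)"
    unfolding theta3_def by (rule infsum_reindex_bij_betw) (rule bij_betw_byWitness[where f' = "\<lambda>n. n - 1"], auto)
  have s3: "(\<lambda>n. norm (theta_term 0 (n + 1) (2 * t))) summable_on UNIV"
  proof -
    have "bij_betw (\<lambda>n::int. n + 1) UNIV UNIV" by (rule bij_betw_byWitness[where f' = "\<lambda>n. n - 1"], auto)
    then show ?thesis using s2(1) summable_on_reindex_bij_betw[of "\<lambda>n::int. n + 1" UNIV UNIV "\<lambda>n. norm (theta_term 0 n (2 * t))"]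
      by simp
  qed
  show "(theta3 t)\<^sup>2 = (theta3 (2 * t))\<^sup>2 + (theta2 (2 * t))\<^sup>2"
    unfolding power2_eq_square theta3_def theta2_def infsum_mult_Times(2)[OF s1(1) s1(1)]
      infsum_mult_Times(2)[OF s2(1) s2(1)] infsum_mult_Times(2)[OF s2(2) s2(2)]
    by (subst infsum_parity_split[OF infsum_mult_Times(1)[OF s1(1) s1(1)]]) (simp add: T1 T2)
  show "(theta4 t)\<^sup>2 = (theta3 (2 * t))\<^sup>2 - (theta2 (2 * t))\<^sup>2"
    unfolding power2_eq_square theta3_def theta2_def theta4_def infsum_mult_Times(2)[OF s1(3) s1(3)]
      infsum_mult_Times(2)[OF s2(1) s2(1)] infsum_mult_Times(2)[OF s2(2) s2(2)]
    by (subst infsum_parity_split[OF infsum_mult_Times(1)[OF s1(3) s1(3)]])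
       (simp add: sgn_rearr T1 T2 sgE sgO infsum_uminus' case_prod_unfold)
  have "theta3 t * theta4 t = (\<Sum>\<^sub>\<infinity>(a, b). ((-1) powi a * theta_term 0 a (2 * t)) * ((-1) powi b * theta_term 0 b (2 * t)))
     + (\<Sum>\<^sub>\<infinity>(a, b). ((-1) powi a * theta_term (1/2) a (2 * t)) * ((-1) powi b * theta_term (1/2) b (2 * t)))"
    unfolding theta3_def theta4_def infsum_mult_Times(2)[OF s1(1) s1(3)]
    by (subst infsum_parity_split[OF infsum_mult_Times(1)[OF s1(1) s1(3)]])
       (simp add: T34 T34')
  then show "theta3 t * theta4 t = (theta4 (2 * t))\<^sup>2"
    unfolding power2_eq_square theta4_def infsum_mult_Times(2)[OF s2(3) s2(3)]
    by (simp add: infsum_mult_Times(2)[OF s2(4) s2(4), symmetric] theta1_zero[OF uhp_double[OF t]])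
  have "(theta2 t)\<^sup>2 = (\<Sum>\<^sub>\<infinity>(a, b). theta_term (1/2) a (2 * t) * theta_term 0 b (2 * t))
      + (\<Sum>\<^sub>\<infinity>(a, b). theta_term 0 (a + 1) (2 * t) * theta_term (1/2) b (2 * t))"
    unfolding power2_eq_square theta2_def infsum_mult_Times(2)[OF s1(2) s1(2)]
    by (subst infsum_parity_split[OF infsum_mult_Times(1)[OF s1(2) s1(2)]]) (simp add: T3 T4)
  then show "(theta2 t)\<^sup>2 = 2 * theta2 (2 * t) * theta3 (2 * t)"
    by (simp add: infsum_mult_Times(2)[OF s2(2) s2(1), symmetric] infsum_mult_Times(2)[OF s3 s2(2), symmetric]
      theta2_def[symmetric] theta3_def[symmetric] shift)
qed

section \<open>Behaviour for large imaginary part, and absence of zeros\<close>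

lemma theta_series_limit:
  fixes g :: "int \<Rightarrow> complex" and c :: "int \<Rightarrow> nat"
  assumes g: "\<And>n. norm (g n) = 1" and c: "(\<lambda>n. exp (- pi * real (c n))) summable_on UNIV"
    and T: "filterlim (\<lambda>k. Im (T k)) at_top F"
  shows "((\<lambda>k. \<Sum>\<^sub>\<infinity>n. g n * exp (\<i> * of_real (pi * c n) * T k)) \<longlongrightarrow> (\<Sum>\<^sub>\<infinity>n\<in>{n. c n = 0}. g n)) F"
proof -
  define K where "K = (\<Sum>\<^sub>\<infinity>n. exp (- pi * real (c n)))"
  let ?f = "\<lambda>t n. g n * exp (\<i> * of_real (pi * c n) * t)"
  have bound: "norm ((\<Sum>\<^sub>\<infinity>n. ?f t n) - (\<Sum>\<^sub>\<infinity>n\<in>{n. c n = 0}. g n)) \<le> K * exp (- pi * (Im t - 1))"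
    if t: "1 \<le> Im t" for t
  proof -
    have nf: "norm (?f t n) = exp (- pi * c n * Im t)" for n by (simp add: norm_mult g)
    have "exp (- pi * c n * Im t) \<le> exp (- pi * real (c n))" for n
      using t mult_left_mono[of 1 "Im t" "pi * c n"] by simp
    then have s: "(\<lambda>n. norm (?f t n)) summable_on UNIV"
      using c unfolding nf by (rule_tac summable_on_comparison_test[OF c]) auto
    have "?f t summable_on UNIV" using s by (rule abs_summable_summable)
    then have s1: "?f t summable_on {n. c n = 0}" and s2: "?f t summable_on {n. c n \<noteq> 0}"
      by (auto intro: summable_on_subset_banach)
    have "(\<Sum>\<^sub>\<infinity>n. ?f t n) = infsum (?f t) ({n. c n = 0} \<union> {n. c n \<noteq> 0})"
      by (rule arg_cong[where f = "infsum _"]) auto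
    also have "\<dots> = infsum (?f t) {n. c n = 0} + infsum (?f t) {n. c n \<noteq> 0}"
      by (rule infsum_Un_disjoint[OF s1 s2]) auto
    also have "infsum (?f t) {n. c n = 0} = (\<Sum>\<^sub>\<infinity>n\<in>{n. c n = 0}. g n)"
      by (rule infsum_cong) auto
    finally have "norm ((\<Sum>\<^sub>\<infinity>n. ?f t n) - (\<Sum>\<^sub>\<infinity>n\<in>{n. c n = 0}. g n)) = norm (infsum (?f t) {n. c n \<noteq> 0})"
      by simp
    also have "\<dots> \<le> (\<Sum>\<^sub>\<infinity>n\<in>{n. c n \<noteq> 0}. norm (?f t n))"
      by (rule norm_infsum_bound) (rule summable_on_subset_banach[OF s], simp)
    also have "\<dots> \<le> (\<Sum>\<^sub>\<infinity>n. exp (- pi * (Im t - 1)) * exp (- pi * real (c n)))"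
    proof (rule infsum_mono_neutral)
      show "(\<lambda>n. norm (?f t n)) summable_on {n. c n \<noteq> 0}"
        by (rule summable_on_subset_banach[OF s]) simp
      show "(\<lambda>n. exp (- pi * (Im t - 1)) * exp (- pi * real (c n))) summable_on UNIV"
        by (intro summable_on_cmult_right c)
      fix n assume n: "n \<in> {n. c n \<noteq> 0} \<inter> UNIV"
      \<comment> \<open>A nonzero exponent is at least 1, so the excess \<open>Im t - 1\<close> over
        the comparison series is gained in full.\<close>
      have "(Im t - 1) * 1 \<le> (Im t - 1) * c n" using n t by (intro mult_left_mono) auto
      then have "pi * (Im t - 1 + c n) \<le> pi * (c n * Im t)"
        by (intro mult_left_mono) (auto simp: algebra_simps)
      then show "norm (?f t n) \<le> exp (- pi * (Im t - 1)) * exp (- pi * real (c n))"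
        unfolding nf exp_add[symmetric] by (simp add: algebra_simps)
    qed auto
    also have "\<dots> = K * exp (- pi * (Im t - 1))"
      unfolding K_def infsum_cmult_right' by (rule mult.commute)
    finally show ?thesis .
  qed
  have "filterlim (\<lambda>x. - pi * (x - 1)) at_bot (at_top :: real filter)" by real_asymp
  then have "((\<lambda>x::real. K * exp (- pi * (x - 1))) \<longlongrightarrow> K * 0) at_top"
    by (intro tendsto_intros filterlim_compose[OF exp_at_bot])
  then have lim: "((\<lambda>k. K * exp (- pi * (Im (T k) - 1))) \<longlongrightarrow> 0) F"
    using filterlim_compose[OF _ T] by fastforce
  have "\<forall>\<^sub>F k in F. 1 \<le> Im (T k)" using T by (auto simp: filterlim_at_top)
  then have ev: "\<forall>\<^sub>F k in F. norm ((\<Sum>\<^sub>\<infinity>n. ?f (T k) n) - (\<Sum>\<^sub>\<infinity>n\<in>{n. c n = 0}. g n)) \<le> K * exp (- pi * (Im (T k) - 1))"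
    by eventually_elim (rule bound)
  show ?thesis
    by (rule LIM_zero_cancel) (rule Lim_null_comparison[OF ev lim])
qed

lemma filterlim_Im_double:
  assumes "t \<in> uhp"
  shows "filterlim (\<lambda>k. Im (2 ^ k * t)) at_top sequentially"
proof -
  have "filterlim (\<lambda>k. 2 ^ k * Im t) at_top sequentially"
    using assms unfolding uhp_def by (simp, real_asymp)
  moreover have "Im (2 ^ k * t) = 2 ^ k * Im t" for k
  proof -
    have "2 ^ k * t = (2 ^ k) *\<^sub>R t" by (simp add: scaleR_conv_of_real)
    then show ?thesis by simp
  qed
  ultimately show ?thesis by simp
qed

lemma summable_exp_quadratic:
  "(\<lambda>n::int. exp (- pi * real (nat (n\<^sup>2)))) summable_on UNIV"
  "(\<lambda>n::int. exp (- pi * real (nat (n\<^sup>2 + n)))) summable_on UNIV"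
proof -
  have *: "(\<lambda>n. exp pi * exp (- pi * \<bar>of_int n\<bar>)) summable_on (UNIV :: int set)"
    by (intro summable_on_cmult_right summable_exp_abs_int) auto
  have le: "\<bar>n\<bar> - 1 \<le> n\<^sup>2 \<and> \<bar>n\<bar> - 1 \<le> n\<^sup>2 + n \<and> 0 \<le> n\<^sup>2 + n" for n :: int
  proof -
    have "0 \<le> (\<bar>n\<bar> - 1)\<^sup>2" by simp
    then have "2 * \<bar>n\<bar> - 1 \<le> n\<^sup>2" by (simp add: power2_eq_square algebra_simps)
    moreover have "0 \<le> \<bar>n\<bar> * (\<bar>n\<bar> - 1)" by (cases "n = 0") (auto simp: zero_le_mult_iff)
    then have "\<bar>n\<bar> \<le> n\<^sup>2" by (simp add: power2_eq_square algebra_simps)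
    ultimately show ?thesis by linarith
  qed
  have "exp (- pi * real (nat m)) \<le> exp pi * exp (- pi * \<bar>of_int n\<bar>)" if "\<bar>n\<bar> - 1 \<le> m" "0 \<le> m" for n m :: int
  proof -
    have "real_of_int (\<bar>n\<bar> - 1) \<le> real_of_int m" using that(1) by linarith
    then have "pi * (real_of_int \<bar>n\<bar> - 1) \<le> pi * real_of_int m" by (intro mult_left_mono) auto
    then show ?thesis unfolding exp_add[symmetric] using that(2) by (simp add: algebra_simps)
  qed
  then show "(\<lambda>n::int. exp (- pi * real (nat (n\<^sup>2)))) summable_on UNIV"
    "(\<lambda>n::int. exp (- pi * real (nat (n\<^sup>2 + n)))) summable_on UNIV"
    using le by (intro summable_on_comparison_test[OF *]; simp del: of_nat_nat; blast)+
qed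

text \<open>\<open>theta2\<close> is divided by its leading factor: the remaining exponents
  \<open>(n + 1/2)^2 - 1/4 = n^2 + n\<close> vanish exactly at \<open>n = 0\<close> and
  \<open>n = -1\<close>, and these two terms make the limit 2.\<close>

lemma theta_limits:
  assumes "filterlim (\<lambda>k. Im (T k)) at_top F"
  shows "((\<lambda>k. theta3 (T k)) \<longlongrightarrow> 1) F" "((\<lambda>k. theta4 (T k)) \<longlongrightarrow> 1) F"
    "((\<lambda>k. theta2 (T k) / exp (\<i> * pi * T k / 4)) \<longlongrightarrow> 2) F"
proof -
  have t0: "theta_term 0 n t = exp (\<i> * of_real (pi * nat (n\<^sup>2)) * t)" for n t
    by (simp add: theta_term_def)
  have z0: "{n::int. nat (n\<^sup>2) = 0} = {0}" by auto
  have z2: "{n::int. nat (n\<^sup>2 + n) = 0} = {0, -1}"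
  proof -
    have "n\<^sup>2 + n \<le> 0 \<longleftrightarrow> n = 0 \<or> n = -1" for n :: int
    proof
      assume "n\<^sup>2 + n \<le> 0"
      then have "n * (n + 1) \<le> 0" by (simp add: power2_eq_square algebra_simps)
      then show "n = 0 \<or> n = -1" by (auto simp: mult_le_0_iff)
    qed auto
    then show ?thesis by auto
  qed
  have t2: "theta2 t / exp (\<i> * pi * t / 4) = (\<Sum>\<^sub>\<infinity>n. 1 * exp (\<i> * of_real (pi * nat (n\<^sup>2 + n)) * t))" for t
  proof -
    have "theta_term (1/2) n t = exp (\<i> * pi * t / 4) * exp (\<i> * of_real (pi * nat (n\<^sup>2 + n)) * t)" for n
    proof -
      have "0 \<le> n\<^sup>2 + n"
      proof (cases "0 \<le> n")
        case False
        then have "0 \<le> (- n) * (- n - 1)" by (intro mult_nonneg_nonneg) auto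
        then show ?thesis by (simp add: power2_eq_square algebra_simps)
      qed auto
      then show ?thesis
        unfolding theta_term_def exp_add[symmetric]
        by (simp add: power2_eq_square algebra_simps)
    qed
    then show ?thesis by (simp add: theta2_def infsum_cmult_right')
  qed
  show "((\<lambda>k. theta3 (T k)) \<longlongrightarrow> 1) F"
    using theta_series_limit[OF _ summable_exp_quadratic(1) assms, of "\<lambda>_. 1"]
    by (simp add: theta3_def t0 z0 del: nat_eq_iff)
  show "((\<lambda>k. theta4 (T k)) \<longlongrightarrow> 1) F"
    using theta_series_limit[OF _ summable_exp_quadratic(1) assms, of "\<lambda>n. (-1) powi n"]
    by (simp add: theta4_def t0 z0 norm_power_int)
  show "((\<lambda>k. theta2 (T k) / exp (\<i> * pi * T k / 4)) \<longlongrightarrow> 2) F"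
    using theta_series_limit[OF _ summable_exp_quadratic(2) assms, of "\<lambda>_. 1"]
    unfolding t2 z2 by simp
qed

lemma double_power_uhp: "t \<in> uhp \<Longrightarrow> 2 ^ k * t \<in> uhp"
  by (induction k) (use uhp_double in \<open>auto simp: mult.assoc\<close>)

text \<open>Since the square of \<open>theta4 (2 * t)\<close> is \<open>theta3 t * theta4 t\<close>,
  a zero would propagate along \<open>2 ^ k * t\<close>, against the limit 1. The same device serves
  for \<open>theta2\<close>.\<close>

lemma theta4_nonzero: "t \<in> uhp \<Longrightarrow> theta4 t \<noteq> 0"
proof
  assume t: "t \<in> uhp" and "theta4 t = 0"
  then have "theta4 (2 ^ k * t) = 0" for k
  proof (induction k)
    case (Suc k)
    then show ?case using theta_double(3)[OF double_power_uhp[OF t, of k]] by (simp add: mult.assoc)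
  qed simp
  then have "(\<lambda>k::nat. 0::complex) \<longlonglongrightarrow> 1"
    using theta_limits(2)[OF filterlim_Im_double[OF t]] by simp
  then show False by (simp add: LIMSEQ_const_iff)
qed

lemma theta3_nonzero: "t \<in> uhp \<Longrightarrow> theta3 t \<noteq> 0"
  using theta_double(3)[of t] theta4_nonzero[OF uhp_double] by fastforce

lemma theta2_nonzero: "t \<in> uhp \<Longrightarrow> theta2 t \<noteq> 0"
proof
  assume t: "t \<in> uhp" and "theta2 t = 0"
  then have "theta2 (2 ^ k * t) = 0" for k
  proof (induction k)
    case (Suc k)
    then show ?case
      using theta_double(4)[OF double_power_uhp[OF t, of k]] theta3_nonzero[OF double_power_uhp[OF t, of "Suc k"]]
      by (simp add: mult.assoc)
  qed simp
  then have "(\<lambda>k::nat. 0::complex) \<longlonglongrightarrow> 2"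
    using theta_limits(3)[OF filterlim_Im_double[OF t]] by simp
  then show False by (simp add: LIMSEQ_const_iff)
qed

section \<open>The modular function and its elementary symmetries\<close>

definition lam :: "complex \<Rightarrow> complex" where
  "lam t = (theta2 t / theta3 t) ^ 4"

lemma holomorphic_lam: "lam holomorphic_on uhp"
  unfolding lam_def[abs_def] using theta3_nonzero by (intro holomorphic_intros holomorphic_theta) auto

lemma one_minus_lam:
  assumes "t \<in> uhp"
  shows "1 - lam t = (theta4 t / theta3 t) ^ 4"
proof -
  note d = theta_double[OF assms]
  have "theta3 t ^ 4 - theta4 t ^ 4 = ((theta3 t)\<^sup>2 - (theta4 t)\<^sup>2) * ((theta3 t)\<^sup>2 + (theta4 t)\<^sup>2)"
    by (simp add: power2_eq_square power4_eq_xxxx algebra_simps)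
  also have "\<dots> = ((theta2 t)\<^sup>2)\<^sup>2" unfolding d by (simp add: power2_eq_square algebra_simps)
  finally have "theta3 t ^ 4 - theta4 t ^ 4 = theta2 t ^ 4" by simp
  then have "theta4 t ^ 4 = theta3 t ^ 4 - theta2 t ^ 4" by (simp add: algebra_simps)
  then show ?thesis
    using theta3_nonzero[OF assms] by (simp add: lam_def power_divide diff_divide_distrib)
qed

lemma lam_nonzero: "t \<in> uhp \<Longrightarrow> lam t \<noteq> 0"
  by (simp add: lam_def theta2_nonzero theta3_nonzero)

lemma lam_neq_1: "t \<in> uhp \<Longrightarrow> lam t \<noteq> 1"
  using one_minus_lam[of t] by (auto simp: theta4_nonzero theta3_nonzero)

lemma exp_i_pi_int: "exp (\<i> * of_real (pi * of_int k)) = (-1) powi k"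
proof -
  have "exp (\<i> * of_real (pi * of_int k)) = cis (pi * of_int k)" by (simp add: cis_conv_exp)
  also have "\<dots> = (-1) powi k"
    by (auto simp: complex_eq_iff cos_npi_int sin_npi_int power_int_minus_left)
  finally show ?thesis .
qed

lemma theta_add_1:
  shows "theta3 (t + 1) = theta4 t" "theta4 (t + 1) = theta3 t" "theta2 (t + 1) = exp (\<i> * pi / 4) * theta2 t"
proof -
  have 0: "theta_term 0 n (t + 1) = (-1) powi n * theta_term 0 n t" for n
  proof -
    have "theta_term 0 n (t + 1) = exp (\<i> * of_real (pi * of_int (n\<^sup>2))) * theta_term 0 n t"
      unfolding theta_term_def exp_add[symmetric] by (simp add: algebra_simps)
    then show ?thesis unfolding exp_i_pi_int by (cases "even n") (auto simp: power_int_minus_left)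
  qed
  have "(-1::complex) powi n * ((-1) powi n * x) = x" for n :: int and x
    by (cases "even n") (auto simp: power_int_minus_left)
  then show "theta3 (t + 1) = theta4 t" "theta4 (t + 1) = theta3 t"
    by (simp_all add: theta3_def theta4_def 0)
  have "theta_term (1/2) n (t + 1) = exp (\<i> * pi / 4) * theta_term (1/2) n t" for n
  proof -
    have "theta_term (1/2) n (t + 1) = exp (\<i> * of_real (pi * of_int (n\<^sup>2 + n))) * (exp (\<i> * pi / 4) * theta_term (1/2) n t)"
      unfolding theta_term_def exp_add[symmetric] by (simp add: power2_eq_square field_simps)
    then show ?thesis unfolding exp_i_pi_int by (cases "even n") (auto simp: power_int_minus_left)
  qed
  then show "theta2 (t + 1) = exp (\<i> * pi / 4) * theta2 t"
    by (simp add: theta2_def infsum_cmult_right')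
qed

text \<open>The shift exchanges \<open>theta3\<close> and \<open>theta4\<close> and multiplies
  \<open>theta2\<close> by an eighth root of unity whose fourth power is -1.\<close>

lemma lam_add_1:
  assumes "t \<in> uhp"
  shows "lam (t + 1) = lam t / (lam t - 1)"
proof -
  have "exp (\<i> * complex_of_real pi / 4) ^ 4 = -1" by (simp add: exp_of_nat_mult[symmetric])
  then have "lam (t + 1) = - ((theta2 t / theta4 t) ^ 4)"
    by (simp add: lam_def theta_add_1 power_divide power_mult_distrib)
  also have "\<dots> = lam t / - ((theta4 t / theta3 t) ^ 4)"
    using theta3_nonzero[OF assms] theta4_nonzero[OF assms] by (simp add: lam_def field_simps)
  also have "- ((theta4 t / theta3 t) ^ 4) = lam t - 1" using one_minus_lam[OF assms] by (simp add: algebra_simps)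
  finally show ?thesis .
qed

lemma theta_cnj:
  "theta2 (- cnj t) = cnj (theta2 t)" "theta3 (- cnj t) = cnj (theta3 t)" "theta4 (- cnj t) = cnj (theta4 t)"
proof -
  have "theta_term s n (- cnj t) = cnj (theta_term s n t)" for s n
    by (simp add: theta_term_def exp_cnj)
  moreover have "cnj ((-1) powi n) = (-1) powi n" for n by (cases "even n") (auto simp: power_int_minus_left)
  ultimately show "theta2 (- cnj t) = cnj (theta2 t)" "theta3 (- cnj t) = cnj (theta3 t)"
      "theta4 (- cnj t) = cnj (theta4 t)"
    by (simp_all add: theta2_def theta3_def theta4_def infsum_cnj[symmetric] del: infsum_cnj)
qed

lemma lam_cnj: "lam (- cnj t) = cnj (lam t)"
  by (simp add: lam_def theta_cnj)

lemma theta_imag: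
  "of_real (Re (theta2 (\<i> * of_real y))) = theta2 (\<i> * of_real y)"
  "of_real (Re (theta3 (\<i> * of_real y))) = theta3 (\<i> * of_real y)"
  "of_real (Re (theta4 (\<i> * of_real y))) = theta4 (\<i> * of_real y)"
  using theta_cnj[of "\<i> * of_real y"] by (simp_all add: complex_eq_iff)

section \<open>Growth of \<open>theta3\<close> towards 0 along the imaginary axis\<close>

lemma gaussian_integral_limit:
  assumes "0 < y"
  shows "(\<lambda>n. integral {0..real n} (\<lambda>x. exp (- pi * y * x\<^sup>2))) \<longlonglongrightarrow> 1 / (2 * sqrt y)"
proof -
  define c where "c = sqrt (pi * y)"
  have c: "0 < c" using assms by (simp add: c_def)
  let ?g = "\<lambda>x. indicator {0..} x *\<^sub>R exp (- pi * y * x\<^sup>2) :: real"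
  have "has_bochner_integral lborel (\<lambda>x. indicator {0..} (0 + c * x) *\<^sub>R exp (- (0 + c * x)\<^sup>2)) ((sqrt pi / 2) /\<^sub>R \<bar>c\<bar>)"
    using c gaussian_moment_0 by (subst lborel_has_bochner_integral_real_affine_iff[symmetric]) auto
  also have "(\<lambda>x. indicator {0..} (0 + c * x) *\<^sub>R exp (- (0 + c * x)\<^sup>2)) = ?g"
    using c by (auto simp: fun_eq_iff indicator_def zero_le_mult_iff power_mult_distrib)
       (use assms in \<open>simp add: c_def\<close>)
  also have "(sqrt pi / 2) /\<^sub>R \<bar>c\<bar> = 1 / (2 * sqrt y)"
    using assms by (simp add: c_def real_sqrt_mult field_simps)
  finally have hb: "has_bochner_integral lborel ?g (1 / (2 * sqrt y))" .
  then have "integrable lborel ?g" "integral\<^sup>L lborel ?g = 1 / (2 * sqrt y)"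
    by (auto simp: has_bochner_integral_iff)
  then have "((\<lambda>t. \<integral>x. indicator {..t} x *\<^sub>R ?g x \<partial>lborel) \<longlongrightarrow> 1 / (2 * sqrt y)) at_top"
    using tendsto_integral_at_top[of lborel ?g] by simp
  then have "(\<lambda>n. \<integral>x. indicator {..real n} x *\<^sub>R ?g x \<partial>lborel) \<longlonglongrightarrow> 1 / (2 * sqrt y)"
    by (rule filterlim_compose) (rule filterlim_real_sequentially)
  moreover have "(\<integral>x. indicator {..real n} x *\<^sub>R ?g x \<partial>lborel) = integral {0..real n} (\<lambda>x. exp (- pi * y * x\<^sup>2))" for n
  proof -
    have "set_integrable lborel {0..real n} (\<lambda>x. exp (- pi * y * x\<^sup>2))"
      by (rule borel_integrable_atLeastAtMost') (auto intro!: continuous_intros)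
    then have "(LINT x:{0..real n}|lborel. exp (- pi * y * x\<^sup>2)) = integral {0..real n} (\<lambda>x. exp (- pi * y * x\<^sup>2))"
      by (rule set_borel_integral_eq_integral)
    moreover have "(\<lambda>x. indicator {..real n} x *\<^sub>R ?g x) = (\<lambda>x. indicator {0..real n} x *\<^sub>R exp (- pi * y * x\<^sup>2))"
      by (auto simp: fun_eq_iff indicator_def)
    ultimately show ?thesis by (simp add: set_lebesgue_integral_def)
  qed
  ultimately show ?thesis by simp
qed

text \<open>The sum over \<open>n \<ge> 0\<close> of a decreasing function exceeds its integral by
  at most the first term, here 1, and the two-sided sum is twice that sum minus 1. It stands in for
  the inversion formula of \<open>theta3\<close>: the error stays bounded while
  \<open>1 / sqrt y\<close> grows as \<open>y\<close> tends to 0.\<close>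

lemma theta3_imag_bound:
  assumes "0 < y"
  shows "\<bar>Re (theta3 (\<i> * of_real y)) - 1 / sqrt y\<bar> \<le> 1"
proof -
  define f where "f = (\<lambda>x::real. exp (- pi * y * x\<^sup>2))"
  interpret antimono_fun_sum_integral_diff f
  proof
    fix u v :: real assume "0 \<le> u" "u \<le> v"
    then have "pi * y * u\<^sup>2 \<le> pi * y * v\<^sup>2" using assms by (intro mult_left_mono power_mono) auto
    then show "f v \<le> f u" by (simp add: f_def)
  qed (auto simp: f_def intro!: continuous_intros)
  have ff: "f (of_int n) = norm (theta_term 0 n (\<i> * of_real y))" for n
    by (simp add: f_def norm_theta_term algebra_simps)
  have s: "(\<lambda>n. f (of_int n)) summable_on UNIV"
    unfolding ff by (rule theta_sum_abs) (use assms in \<open>simp add: uhp_def\<close>)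
  have sn: "(\<lambda>n. f (real n)) summable_on UNIV"
    using summable_on_reindex[of int UNIV "\<lambda>n. f (of_int n)"] summable_on_subset_banach[OF s, of "range int"]
    by (simp add: o_def)
  define S where "S = (\<Sum>n. f (real n))"
  have sums: "(\<lambda>n. f (real n)) sums S"
    using sn summable_on_imp_summable summable_sums unfolding S_def by blast
  have hs: "((\<lambda>n. f (real n)) has_sum S) UNIV"
    using sn sums by (metis has_sum_imp_sums has_sum_infsum sums_unique2)
  have "((\<lambda>n. f (of_int n)) has_sum S) (range int)"
    using hs by (subst has_sum_reindex) (auto simp: o_def)
  moreover have "((\<lambda>n. f (of_int n)) has_sum (S - 1)) (range (\<lambda>n. - int n - 1))"
  proof -
    have "(\<lambda>n. f (real (Suc n))) sums (S - f (real 0))"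
      using sums by (subst sums_Suc_iff) simp
    then have "((\<lambda>n. f (real (Suc n))) has_sum (S - 1)) UNIV"
      by (intro sums_nonneg_imp_has_sum) (auto simp: f_def)
    then show ?thesis
      by (subst has_sum_reindex) (auto simp: inj_on_def o_def f_def power2_eq_square algebra_simps)
  qed
  ultimately have "((\<lambda>n. f (of_int n)) has_sum (S + (S - 1))) (range int \<union> range (\<lambda>n. - int n - 1))"
    by (rule has_sum_Un_disjoint) auto
  moreover have "range int \<union> range (\<lambda>n. - int n - 1) = UNIV"
  proof -
    have "n \<in> range int \<union> range (\<lambda>n. - int n - 1)" for n
    proof (cases "0 \<le> n")
      case False
      then have "n = - int (nat (- n - 1)) - 1" by simp
      then show ?thesis by blast
    qed (metis UnI1 nonneg_int_cases rangeI)
    then show ?thesis by auto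
  qed
  ultimately have "((\<lambda>n. f (of_int n)) has_sum (2 * S - 1)) UNIV" by simp
  then have "((\<lambda>n. complex_of_real (f (of_int n))) has_sum of_real (2 * S - 1)) UNIV"
    by (rule has_sum_of_real)
  moreover have "complex_of_real (f (of_int n)) = theta_term 0 n (\<i> * of_real y)" for n
    by (simp add: f_def theta_term_def exp_of_real[symmetric] algebra_simps)
  ultimately have th: "theta3 (\<i> * of_real y) = of_real (2 * S - 1)"
    by (simp add: theta3_def infsumI)
  have lim: "(\<lambda>n. (\<Sum>k\<le>n. f (of_nat k)) - integral {0..real n} f) \<longlonglongrightarrow> S - 1 / (2 * sqrt y)"
    using sums gaussian_integral_limit[OF assms] unfolding sums_def_le f_def by (intro tendsto_diff) auto
  have "0 \<le> (\<Sum>k\<le>n. f (of_nat k)) - integral {0..real n} f" for n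
    using sum_integral_diff_series_nonneg[of n] by (simp only: sum_integral_diff_series_def)
  then have lo: "0 \<le> S - 1 / (2 * sqrt y)" using LIMSEQ_le_const[OF lim] by blast
  have "(\<Sum>k\<le>n. f (of_nat k)) - integral {0..real n} f \<le> 1" for n
  proof -
    have "sum_integral_diff_series 0 = 1" unfolding sum_integral_diff_series_def by (simp add: f_def)
    then show ?thesis
      using sum_integral_diff_series_antimono[of 0 n] by (simp only: sum_integral_diff_series_def le0)
  qed
  then have hi: "S - 1 / (2 * sqrt y) \<le> 1" using LIMSEQ_le_const2[OF lim] by blast
  have "\<bar>2 * S - 1 - 1 / sqrt y\<bar> \<le> 1" using lo hi by simp
  then show ?thesis unfolding th by (simp only: Re_complex_of_real)
qed

section \<open>The complex arithmetic-geometric mean\<close>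

declare csqrt.sel [simp del]

lemma csqrt_Re_pos:
  assumes "z \<notin> \<real>\<^sub>\<le>\<^sub>0"
  shows "0 < Re (csqrt z)"
proof (rule ccontr)
  assume "\<not> 0 < Re (csqrt z)"
  then have "Re (csqrt z) = 0" using Re_csqrt[of z] by linarith
  then have "Im ((csqrt z)\<^sup>2) = 0" "Re ((csqrt z)\<^sup>2) \<le> 0"
    unfolding Im_power2 Re_power2 by simp_all
  with assms show False unfolding power2_csqrt complex_nonpos_Reals_iff by simp
qed

lemma csqrt_half_plane:
  assumes "0 < Re z"
  shows "0 < Re (csqrt z)" "\<bar>Im (csqrt z)\<bar> < Re (csqrt z)"
proof -
  have "Re z = (Re (csqrt z))\<^sup>2 - (Im (csqrt z))\<^sup>2"
    by (metis Re_power2 power2_csqrt)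
  then have "(Im (csqrt z))\<^sup>2 < (Re (csqrt z))\<^sup>2" using assms by linarith
  then show *: "\<bar>Im (csqrt z)\<bar> < Re (csqrt z)"
    by (metis Re_csqrt abs_of_nonneg power2_less_imp_less abs_ge_zero power2_abs)
  then show "0 < Re (csqrt z)" by linarith
qed

text \<open>After turning by \<open>cnj (csqrt w)\<close> the claim is that
  \<open>Re (x^2) \<ge> m\<close> and \<open>Re (y^2) \<ge> m\<close> imply
  \<open>Re (x * y) \<ge> m\<close> in the right half plane, a Cauchy-Schwarz inequality inside a
  branch of a hyperbola. Half planes of this form are closed under geometric means as well as
  arithmetic ones, so they trap the whole iteration, and the principal roots remain the right
  choice.\<close>

lemma csqrt_mult_polar:
  assumes "0 < Re a" "0 < Re b" "0 < Re w" "0 < m" "m \<le> Re (a * cnj w)" "m \<le> Re (b * cnj w)"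
  shows "m \<le> Re (csqrt a * csqrt b * cnj w)"
proof -
  define x where "x = csqrt a * cnj (csqrt w)"
  define y where "y = csqrt b * cnj (csqrt w)"
  have pos: "0 < Re (csqrt u * cnj (csqrt w))" if "0 < Re u" for u
  proof -
    have "\<bar>Im (csqrt u) * Im (csqrt w)\<bar> < Re (csqrt u) * Re (csqrt w)"
      unfolding abs_mult using csqrt_half_plane[OF that] csqrt_half_plane[OF assms(3)]
      by (intro mult_strict_mono') auto
    then show ?thesis by simp
  qed
  have x: "0 < Re x" and y: "0 < Re y" using pos assms by (auto simp: x_def y_def)
  have sq: "(cnj (csqrt w))\<^sup>2 = cnj w" by (metis complex_cnj_power power2_csqrt)
  have "x\<^sup>2 = a * cnj w" "y\<^sup>2 = b * cnj w"
    by (auto simp: x_def y_def power_mult_distrib sq)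
  then have "m + (Im x)\<^sup>2 \<le> (Re x)\<^sup>2" "m + (Im y)\<^sup>2 \<le> (Re y)\<^sup>2"
    using assms Re_power2[of x] Re_power2[of y] by auto
  then have "(m + (Im x)\<^sup>2) * (m + (Im y)\<^sup>2) \<le> (Re x)\<^sup>2 * (Re y)\<^sup>2"
    using assms by (intro mult_mono) auto
  moreover have "(m + \<bar>Im x * Im y\<bar>)\<^sup>2 \<le> (m + (Im x)\<^sup>2) * (m + (Im y)\<^sup>2)"
  proof -
    have "0 \<le> m * (\<bar>Im x\<bar> - \<bar>Im y\<bar>)\<^sup>2" using assms by simp
    then show ?thesis
      by (simp add: power2_eq_square algebra_simps abs_mult)
  qed
  ultimately have "(m + \<bar>Im x * Im y\<bar>)\<^sup>2 \<le> (Re x * Re y)\<^sup>2" by (simp add: power_mult_distrib)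
  then have "m + \<bar>Im x * Im y\<bar> \<le> Re x * Re y"
    using x y by (meson less_imp_le mult_pos_pos power2_le_imp_le)
  then have "m \<le> Re (x * y)" by simp
  moreover have "x * y = csqrt a * csqrt b * cnj w"
    unfolding x_def y_def by (simp add: sq[symmetric] power2_eq_square)
  ultimately show ?thesis by simp
qed

section \<open>The mean \<open>M(1, z)\<close> on the right half plane\<close>

fun agm_a agm_b :: "complex \<Rightarrow> nat \<Rightarrow> complex" where
  "agm_a z 0 = 1"
| "agm_b z 0 = z"
| "agm_a z (Suc n) = (agm_a z n + agm_b z n) / 2"
| "agm_b z (Suc n) = csqrt (agm_a z n) * csqrt (agm_b z n)"

definition agm :: "complex \<Rightarrow> complex" where
  "agm z = lim (agm_a z)"

lemma agm_Re_pos: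
  assumes "0 < Re z"
  shows "0 < Re (agm_a z n)" "0 < Re (agm_b z n)"
proof -
  define m where "m = min 1 (Re z)"
  have m: "0 < m" using assms by (simp add: m_def)
  have "m \<le> Re (agm_a z n) \<and> m \<le> Re (agm_b z n)"
  proof (induction n)
    case (Suc n)
    then show ?case using csqrt_mult_polar[of "agm_a z n" "agm_b z n" 1 m] m by auto
  qed (simp add: m_def)
  then show "0 < Re (agm_a z n)" "0 < Re (agm_b z n)" using m by auto
qed

lemma agm_polar:
  assumes "0 < Re z" "0 < Re w" "0 < m" "m \<le> Re w" "m \<le> Re (z * cnj w)"
  shows "m \<le> Re (agm_a z n * cnj w)" "m \<le> Re (agm_b z n * cnj w)"
proof -
  have "m \<le> Re (agm_a z n * cnj w) \<and> m \<le> Re (agm_b z n * cnj w)"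
  proof (induction n)
    case (Suc n)
    then show ?case
      using csqrt_mult_polar[of "agm_a z n" "agm_b z n" w m] agm_Re_pos[OF assms(1)] assms
      by (auto simp: algebra_simps add_divide_distrib)
  qed (use assms in auto)
  then show "m \<le> Re (agm_a z n * cnj w)" "m \<le> Re (agm_b z n * cnj w)" by auto
qed

text \<open>Principal roots of points in the right half plane lie in a sector of opening pi / 2,
  which gives \<open>norm (x - y) \<le> norm (x + y)\<close>. Hence the new gap
  \<open>(x - y)^2 / 2\<close> is at most half of the old gap \<open>x^2 - y^2\<close>.\<close>

lemma agm_diff_bound:
  assumes "0 < Re z"
  shows "norm (agm_a z n - agm_b z n) \<le> (1/2) ^ n * norm (1 - z)"
proof (induction n)
  case (Suc n)
  define x where "x = csqrt (agm_a z n)"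
  define y where "y = csqrt (agm_b z n)"
  have xy: "agm_a z n = x\<^sup>2" "agm_b z n = y\<^sup>2" by (auto simp: x_def y_def)
  have "\<bar>Im x\<bar> < Re x" "\<bar>Im y\<bar> < Re y"
    using agm_Re_pos[OF assms, of n] csqrt_half_plane unfolding x_def y_def by blast+
  then have "\<bar>Im x * Im y\<bar> \<le> Re x * Re y" unfolding abs_mult by (intro mult_mono) auto
  then have "norm (x - y) \<le> norm (x + y)"
    by (simp add: cmod_def power2_eq_square algebra_simps)
  then have "norm (x - y) * norm (x - y) \<le> norm (x - y) * norm (x + y)"
    by (intro mult_left_mono) auto
  also have "\<dots> = norm (x\<^sup>2 - y\<^sup>2)"
    by (simp add: norm_mult[symmetric] power2_eq_square algebra_simps)
  finally have *: "norm ((x - y)\<^sup>2) \<le> norm (agm_a z n - agm_b z n)"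
    by (simp add: xy norm_power power2_eq_square norm_mult)
  have "agm_a z (Suc n) - agm_b z (Suc n) = (x\<^sup>2 + y\<^sup>2) / 2 - x * y"
    by (simp add: xy[symmetric]) (simp add: x_def y_def)
  also have "\<dots> = (x - y)\<^sup>2 / 2" by (simp add: power2_eq_square field_simps)
  finally have "agm_a z (Suc n) - agm_b z (Suc n) = (x - y)\<^sup>2 / 2" .
  then have "norm (agm_a z (Suc n) - agm_b z (Suc n)) = norm ((x - y)\<^sup>2) / 2"
    by (metis norm_divide norm_numeral)
  with Suc * show ?case by (simp del: agm_a.simps agm_b.simps)
qed simp

lemma agm_cauchy_bound:
  assumes "0 < Re z" "n \<le> m"
  shows "norm (agm_a z m - agm_a z n) \<le> ((1/2) ^ n - (1/2) ^ m) * norm (1 - z)"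
  using assms(2)
proof (induction m rule: dec_induct)
  case (step m)
  have "agm_a z (Suc m) - agm_a z m = (agm_b z m - agm_a z m) / 2" by (simp add: field_simps)
  then have "norm (agm_a z (Suc m) - agm_a z m) = norm (agm_a z m - agm_b z m) / 2"
    by (metis norm_divide norm_minus_commute norm_numeral)
  then have "norm (agm_a z (Suc m) - agm_a z m) \<le> (1/2) ^ m * norm (1 - z) / 2"
    using agm_diff_bound[OF assms(1), of m] by simp
  moreover have "norm (agm_a z (Suc m) - agm_a z n)
      \<le> norm (agm_a z (Suc m) - agm_a z m) + norm (agm_a z m - agm_a z n)"
    by norm
  ultimately show ?case using step.IH by (simp add: algebra_simps)
qed simp

lemma agm_tendsto:
  assumes "0 < Re z"
  shows "agm_a z \<longlonglongrightarrow> agm z"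
proof -
  have "summable (\<lambda>n. agm_a z (Suc n) - agm_a z n)"
  proof (rule summable_comparison_test')
    show "summable (\<lambda>n. (1/2) ^ n * norm (1 - z))" by (intro summable_mult2 summable_geometric) simp
    show "norm (agm_a z (Suc n) - agm_a z n) \<le> (1/2) ^ n * norm (1 - z)" for n
    proof -
      have "((1/2::real) ^ n - (1/2) ^ Suc n) * norm (1 - z) \<le> (1/2) ^ n * norm (1 - z)"
        by (intro mult_right_mono) auto
      then show ?thesis using agm_cauchy_bound[OF assms, of n "Suc n"] by linarith
    qed
  qed
  then have "convergent (\<lambda>n. \<Sum>i<n. agm_a z (Suc i) - agm_a z i)"
    by (simp only: summable_iff_convergent)
  then have "convergent (\<lambda>n. (agm_a z n - agm_a z 0) + agm_a z 0)"
    unfolding sum_lessThan_telescope by (intro convergent_add convergent_const)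
  then have "convergent (agm_a z)" by simp
  then show ?thesis by (simp add: agm_def convergent_LIMSEQ_iff)
qed

lemma agm_uniform_bound:
  assumes "0 < Re z"
  shows "norm (agm_a z n - agm z) \<le> (1/2) ^ n * norm (1 - z)"
proof -
  have "(\<lambda>m. norm (agm_a z m - agm_a z n)) \<longlonglongrightarrow> norm (agm z - agm_a z n)"
    by (intro tendsto_intros agm_tendsto assms)
  moreover have "\<forall>\<^sub>F m in sequentially. norm (agm_a z m - agm_a z n) \<le> (1/2) ^ n * norm (1 - z)"
    using eventually_ge_at_top[of n]
  proof eventually_elim
    case (elim m)
    have "((1/2::real) ^ n - (1/2) ^ m) * norm (1 - z) \<le> (1/2) ^ n * norm (1 - z)"
      by (intro mult_right_mono) auto
    then show ?case using agm_cauchy_bound[OF assms elim] by simp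
  qed
  ultimately have "norm (agm z - agm_a z n) \<le> (1/2) ^ n * norm (1 - z)"
    by (intro tendsto_upperbound) auto
  then show ?thesis by (simp add: norm_minus_commute)
qed

lemma holomorphic_agm_ab:
  "(\<lambda>z. agm_a z n) holomorphic_on {z. 0 < Re z} \<and> (\<lambda>z. agm_b z n) holomorphic_on {z. 0 < Re z}"
proof (induction n)
  case (Suc n)
  have "\<And>z. 0 < Re z \<Longrightarrow> agm_a z n \<notin> \<real>\<^sub>\<le>\<^sub>0 \<and> agm_b z n \<notin> \<real>\<^sub>\<le>\<^sub>0"
    unfolding complex_nonpos_Reals_iff using agm_Re_pos by (meson not_le)
  with Suc show ?case by (auto intro!: holomorphic_intros)
qed auto

lemma holomorphic_agm: "agm holomorphic_on {z. 0 < Re z}"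
proof (rule holomorphic_uniform_sequence)
  show op: "open {z. 0 < Re z}" by (simp add: open_halfspace_Re_gt)
  show "(\<lambda>z. agm_a z n) holomorphic_on {z. 0 < Re z}" for n using holomorphic_agm_ab by blast
  fix x assume "x \<in> {z. 0 < Re z}"
  then obtain d where d: "0 < d" "cball x d \<subseteq> {z. 0 < Re z}"
    using op open_contains_cball by blast
  have "uniform_limit (cball x d) (\<lambda>n z. agm_a z n) agm sequentially"
  proof (rule uniform_limitI)
    fix e :: real assume "0 < e"
    have "(\<lambda>n. (1/2::real) ^ n * (1 + norm x + d)) \<longlonglongrightarrow> 0 * (1 + norm x + d)"
      by (intro tendsto_intros) auto
    then have "\<forall>\<^sub>F n in sequentially. (1/2::real) ^ n * (1 + norm x + d) < e"
      using \<open>0 < e\<close> by (auto intro: order_tendstoD)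
    then show "\<forall>\<^sub>F n in sequentially. \<forall>z\<in>cball x d. dist (agm_a z n) (agm z) < e"
    proof eventually_elim
      case (elim n)
      show ?case
      proof
        fix z assume z: "z \<in> cball x d"
        have "norm (1 - z) \<le> 1 + norm x + d"
        proof -
          have "norm (z - x) \<le> d" using z by (simp add: dist_norm norm_minus_commute)
          then show ?thesis using norm_triangle_ineq4[of 1 z] norm_triangle_sub[of z x] by simp
        qed
        then have "(1/2::real) ^ n * norm (1 - z) \<le> (1/2) ^ n * (1 + norm x + d)"
          by (intro mult_left_mono) auto
        moreover have "0 < Re z" using z d(2) by blast
        ultimately show "dist (agm_a z n) (agm z) < e"
          using agm_uniform_bound[of z n] elim unfolding dist_norm by linarith
      qed
    qed
  qed
  with d show "\<exists>d>0. cball x d \<subseteq> {z. 0 < Re z} \<and> uniform_limit (cball x d) (\<lambda>n z. agm_a z n) agm sequentially"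
    by blast
qed

lemma agm_cnj:
  assumes "0 < Re z"
  shows "agm (cnj z) = cnj (agm z)"
proof -
  have "agm_a (cnj z) n = cnj (agm_a z n) \<and> agm_b (cnj z) n = cnj (agm_b z n)" for n
  proof (induction n)
    case (Suc n)
    have "agm_a z n \<notin> \<real>\<^sub>\<le>\<^sub>0" "agm_b z n \<notin> \<real>\<^sub>\<le>\<^sub>0"
      using agm_Re_pos[OF assms, of n] by (auto simp: complex_nonpos_Reals_iff)
    with Suc show ?case by (simp add: cnj_csqrt)
  qed auto
  then have "agm_a (cnj z) = (\<lambda>n. cnj (agm_a z n))" by auto
  moreover have "(\<lambda>n. cnj (agm_a z n)) \<longlonglongrightarrow> cnj (agm z)"
    by (intro tendsto_cnj agm_tendsto assms)
  ultimately show ?thesis using agm_tendsto[of "cnj z"] assms LIMSEQ_unique by fastforce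
qed

lemma Im_agm_nonneg:
  assumes "0 < Re z" "0 \<le> Im z"
  shows "0 \<le> Im (agm z)"
proof -
  have cs: "0 \<le> Im (csqrt u)" if "0 < Re u" "0 \<le> Im u" for u
  proof -
    have "Im u = 2 * Re (csqrt u) * Im (csqrt u)" by (metis Im_power2 power2_csqrt)
    then have "0 \<le> 2 * Re (csqrt u) * Im (csqrt u)" using that(2) by linarith
    then show ?thesis using csqrt_half_plane(1)[OF that(1)]
      by (metis mult_pos_pos zero_le_mult_iff not_le zero_less_numeral)
  qed
  have "0 \<le> Im (agm_a z n) \<and> 0 \<le> Im (agm_b z n)" for n
  proof (induction n)
    case (Suc n)
    note p = agm_Re_pos[OF assms(1), of n]
    have *: "0 \<le> Im (u * v)" if "0 < Re u" "0 < Re v" "0 \<le> Im u" "0 \<le> Im v" for u v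
      using that by simp
    have "0 \<le> Im (agm_b z (Suc n))"
      unfolding agm_b.simps by (intro * csqrt_half_plane(1) p cs conjunct1[OF Suc] conjunct2[OF Suc])
    moreover have "0 \<le> Im (agm_a z (Suc n))" using Suc by simp
    ultimately show ?case by blast
  qed (use assms in auto)
  moreover have "(\<lambda>n. Im (agm_a z n)) \<longlonglongrightarrow> Im (agm z)"
    by (intro tendsto_Im agm_tendsto assms)
  ultimately show ?thesis by (intro LIMSEQ_le_const) auto
qed

lemma Im_agm_nonpos:
  assumes "0 < Re z" "Im z \<le> 0"
  shows "Im (agm z) \<le> 0"
  using Im_agm_nonneg[of "cnj z"] assms by (simp add: agm_cnj)

text \<open>Homogeneity: a run of real means, divided by \<open>x 0\<close>, is the run that starts
  at 1. The sequences left open here will be theta values, whose limits are known.\<close>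

lemma agm_of_real:
  fixes x y :: "nat \<Rightarrow> real"
  assumes "\<And>n. 0 < x n" "\<And>n. 0 < y n" "\<And>n. x (Suc n) = (x n + y n) / 2"
    "\<And>n. y (Suc n) = sqrt (x n * y n)" "x \<longlonglongrightarrow> L"
  shows "agm (of_real (y 0 / x 0)) = of_real (L / x 0)"
proof -
  have "agm_a (of_real (y 0 / x 0)) n = of_real (x n / x 0) \<and>
        agm_b (of_real (y 0 / x 0)) n = of_real (y n / x 0)" for n
  proof (induction n)
    case (Suc n)
    have *: "sqrt (x n / x 0) * sqrt (y n / x 0) = sqrt (x n * y n) / x 0"
      using assms(1)[of 0] by (simp add: real_sqrt_divide real_sqrt_mult)
    have "agm_b (of_real (y 0 / x 0)) (Suc n) = of_real (sqrt (x n / x 0)) * of_real (sqrt (y n / x 0))"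
      using Suc assms(1)[of 0] assms(1)[of n] assms(2)[of n]
      by (simp add: csqrt_of_real less_imp_le del: of_real_divide)
    then have "agm_b (of_real (y 0 / x 0)) (Suc n) = of_real (y (Suc n) / x 0)"
      by (simp only: of_real_mult[symmetric] assms(4) *)
    moreover have "agm_a (of_real (y 0 / x 0)) (Suc n) = of_real (x (Suc n) / x 0)"
      using Suc by (simp add: assms(3) add_divide_distrib mult.commute)
    ultimately show ?case by blast
  qed (use assms(1)[of 0] in auto)
  then have "agm_a (of_real (y 0 / x 0)) = (\<lambda>n. of_real (x n / x 0))" by auto
  moreover have "(\<lambda>n. complex_of_real (x n / x 0)) \<longlonglongrightarrow> of_real (L / x 0)"
    using assms(1)[of 0] by (intro tendsto_intros assms) auto
  moreover have "0 < Re (of_real (y 0 / x 0))" using assms(1)[of 0] assms(2)[of 0] by simp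
  ultimately show ?thesis using agm_tendsto LIMSEQ_unique by metis
qed

section \<open>The inverse of the modular function\<close>

text \<open>The squares of the two roots add up to 1. If the roots were at least a right angle
  apart, the vanishing imaginary part would give \<open>u^2 \<le> y^2\<close> and
  \<open>x^2 \<le> v^2\<close>, against the real part 1.\<close>

lemma csqrt_polar:
  assumes "Im z \<noteq> 0 \<or> 0 < Re z \<and> Re z < 1"
  shows "0 < Re (csqrt (1 - z) * cnj (csqrt z))"
proof -
  define x y where "x = Re (csqrt z)" and "y = Im (csqrt z)"
  define u v where "u = Re (csqrt (1 - z))" and "v = Im (csqrt (1 - z))"
  have "z \<notin> \<real>\<^sub>\<le>\<^sub>0" "1 - z \<notin> \<real>\<^sub>\<le>\<^sub>0" using assms by (auto simp: complex_nonpos_Reals_iff)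
  then have pos: "0 < x" "0 < u" unfolding x_def u_def by (auto intro: csqrt_Re_pos)
  have "Re ((csqrt z)\<^sup>2 + (csqrt (1 - z))\<^sup>2) = 1" "Im ((csqrt z)\<^sup>2 + (csqrt (1 - z))\<^sup>2) = 0"
    unfolding power2_csqrt by simp_all
  then have re: "x\<^sup>2 - y\<^sup>2 + (u\<^sup>2 - v\<^sup>2) = 1" and im: "x * y = - (u * v)"
    by (simp_all only: Re_power2 Im_power2 plus_complex.sel x_def y_def u_def v_def)
  show ?thesis
  proof (rule ccontr)
    assume "\<not> ?thesis"
    then have le: "x * u \<le> - (y * v)" by (simp add: x_def y_def u_def v_def mult.commute)
    have "x * u\<^sup>2 = u * (x * u)" by (simp add: power2_eq_square)
    also have "\<dots> \<le> u * (- (y * v))" using le pos by (intro mult_left_mono) auto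
    also have "\<dots> = - (u * v) * y" by simp
    also have "\<dots> = x * y\<^sup>2" by (simp only: im[symmetric]) (simp add: power2_eq_square)
    finally have 1: "u\<^sup>2 \<le> y\<^sup>2" using pos by simp
    have "u * x\<^sup>2 = x * (x * u)" by (simp add: power2_eq_square)
    also have "\<dots> \<le> x * (- (y * v))" using le pos by (intro mult_left_mono) auto
    also have "\<dots> = - (x * y) * v" by simp
    also have "\<dots> = u * v\<^sup>2" by (simp only: im) (simp add: power2_eq_square)
    finally have "x\<^sup>2 \<le> v\<^sup>2" using pos by simp
    with 1 re show False by linarith
  qed
qed

definition slit :: "complex set" where
  "slit = {z. Im z \<noteq> 0 \<or> 0 < Re z \<and> Re z < 1}"

lemma slit_not_nonpos: "z \<in> slit \<Longrightarrow> z \<notin> \<real>\<^sub>\<le>\<^sub>0" "z \<in> slit \<Longrightarrow> 1 - z \<notin> \<real>\<^sub>\<le>\<^sub>0"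
  by (auto simp: slit_def complex_nonpos_Reals_iff)

lemma open_slit: "open slit"
proof -
  have "slit = (- \<real>\<^sub>\<le>\<^sub>0) \<inter> ((\<lambda>z. 1 - z) -` (- \<real>\<^sub>\<le>\<^sub>0))"
    by (auto simp: slit_def complex_nonpos_Reals_iff)
  moreover have "open \<dots>"
    by (intro open_Int open_vimage continuous_intros) (auto simp: open_Compl)
  ultimately show ?thesis by simp
qed

lemma connected_slit: "connected slit"
proof (rule starlike_imp_connected)
  have "u *\<^sub>R (1/2) + v *\<^sub>R z \<in> slit" if "z \<in> slit" "0 \<le> u" "0 \<le> v" "u + v = 1" for z :: complex and u v
  proof (cases "v = 0 \<or> Im z \<noteq> 0")
    case False
    then have z: "0 < v" "0 < Re z" "Re z < 1" using that by (auto simp: slit_def)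
    then have "v * Re z < v * 1" "0 < v * Re z" by (intro mult_strict_left_mono, auto)
    then have "0 < u / 2 + v * Re z" "u / 2 + v * Re z < 1" using that by linarith+
    then show ?thesis by (simp add: slit_def)
  qed (use that in \<open>auto simp: slit_def\<close>)
  then show "starlike slit"
    unfolding starlike_def by (intro bexI[of _ "1/2"] ballI) (auto simp: closed_segment_def, simp add: slit_def)
qed

lemma one_minus_slit: "z \<in> slit \<Longrightarrow> 1 - z \<in> slit" and cnj_slit: "z \<in> slit \<Longrightarrow> cnj z \<in> slit"
  by (auto simp: slit_def)

text \<open>The classical period ratio \<open>i K' / K\<close> for the modulus
  \<open>k = csqrt z\<close>, with the elliptic integrals expressed by Gauss's formula
  \<open>K = pi / (2 M(1, k'))\<close>.\<close>

definition tau :: "complex \<Rightarrow> complex" where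
  "tau z = \<i> * agm (csqrt (1 - z)) / agm (csqrt z)"

text \<open>Trapping in half planes is applied twice: the run of \<open>k'\<close> is trapped in
  half planes given by 1 and \<open>k\<close>, and then each of its iterates serves as the direction
  that traps the run of \<open>k\<close>. The two runs, and their limits, thus stay less than a
  right angle apart.\<close>

lemma agm_ratio_pos:
  assumes "z \<in> slit"
  shows "0 < Re (agm (csqrt (1 - z)) * cnj (agm (csqrt z)))"
proof -
  define k k' where "k = csqrt z" and "k' = csqrt (1 - z)"
  have k: "0 < Re k" and k': "0 < Re k'"
    using csqrt_Re_pos slit_not_nonpos[OF assms] by (auto simp: k_def k'_def)
  define m where "m = min (min 1 (Re k)) (min (Re k') (Re (k' * cnj k)))"
  have m: "0 < m" using csqrt_polar[of z] assms k k' unfolding m_def by (auto simp: k_def k'_def slit_def)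
  have m_le: "m \<le> 1" "m \<le> Re k" "m \<le> Re k'" "m \<le> Re (k' * cnj k)" by (auto simp: m_def)
  have "m \<le> Re (agm_a k n * cnj (agm_a k' n))" for n
  proof (rule agm_polar[OF k agm_Re_pos(1)[OF k'] m])
    show "m \<le> Re (agm_a k' n)" using agm_polar(1)[OF k', of 1 m n] m m_le by simp
    show "m \<le> Re (k * cnj (agm_a k' n))"
      using agm_polar(1)[OF k' k m, of n] m_le by (simp add: mult.commute)
  qed
  moreover have "(\<lambda>n. Re (agm_a k n * cnj (agm_a k' n))) \<longlonglongrightarrow> Re (agm k * cnj (agm k'))"
    by (intro tendsto_intros agm_tendsto k k')
  ultimately have "m \<le> Re (agm k * cnj (agm k'))" by (intro LIMSEQ_le_const) auto
  with m show ?thesis by (simp add: k_def k'_def mult.commute)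
qed

lemma agm_csqrt_nonzero: "z \<in> slit \<Longrightarrow> agm (csqrt z) \<noteq> 0" "z \<in> slit \<Longrightarrow> agm (csqrt (1 - z)) \<noteq> 0"
  using agm_ratio_pos[of z] by auto

lemma tau_in_uhp: "z \<in> slit \<Longrightarrow> tau z \<in> uhp"
  using agm_ratio_pos[of z] agm_csqrt_nonzero[of z]
  by (auto simp: tau_def uhp_def complex_div_cnj[of "\<i> * _"])

lemma holomorphic_tau: "tau holomorphic_on slit"
proof -
  have "(\<lambda>z. agm (csqrt z)) holomorphic_on slit" "(\<lambda>z. agm (csqrt (1 - z))) holomorphic_on slit"
    using slit_not_nonpos csqrt_Re_pos
    by (auto intro!: holomorphic_on_compose_gen[OF _ holomorphic_agm, unfolded o_def] holomorphic_intros)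
  then show ?thesis
    unfolding tau_def[abs_def] by (intro holomorphic_intros) (auto simp: agm_csqrt_nonzero)
qed

lemma tau_nonzero: "z \<in> slit \<Longrightarrow> tau z \<noteq> 0"
  using tau_in_uhp[of z] by (auto simp: uhp_def)

lemma tau_one_minus: "z \<in> slit \<Longrightarrow> tau (1 - z) = - 1 / tau z"
  using agm_csqrt_nonzero[of z] by (simp add: tau_def field_simps)

lemma tau_cnj: "z \<in> slit \<Longrightarrow> tau (cnj z) = - cnj (tau z)"
  using slit_not_nonpos[of z] csqrt_Re_pos[of z] csqrt_Re_pos[of "1 - z"] cnj_csqrt[of z] cnj_csqrt[of "1 - z"]
  by (simp add: tau_def agm_cnj[symmetric])

text \<open>For \<open>z\<close> above the real axis, \<open>k\<close> lies above and
  \<open>k'\<close> below it, and the iteration preserves both signs.\<close>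

lemma Re_tau_nonneg:
  assumes "0 < Im z"
  shows "0 \<le> Re (tau z)"
proof -
  have z: "z \<in> slit" using assms by (simp add: slit_def)
  define k k' where "k = csqrt z" and "k' = csqrt (1 - z)"
  have k: "0 < Re k" and k': "0 < Re k'"
    using csqrt_Re_pos slit_not_nonpos[OF z] by (auto simp: k_def k'_def)
  have "Im (k\<^sup>2) = Im z" "Im (k'\<^sup>2) = - Im z" by (simp_all add: k_def k'_def)
  then have "0 < 2 * Re k * Im k" "2 * Re k' * Im k' < 0" using assms by (simp_all add: Im_power2)
  then have "0 \<le> Im k" "Im k' \<le> 0" using k k' by (auto simp: zero_less_mult_iff mult_less_0_iff)
  then have I: "0 \<le> Im (agm k)" "Im (agm k') \<le> 0" using Im_agm_nonneg Im_agm_nonpos k k' by auto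
  have R: "0 \<le> Re (agm w)" if w: "0 < Re w" for w
    using agm_tendsto[OF w] agm_Re_pos(1)[OF w] by (intro LIMSEQ_le_const[OF tendsto_Re]) (auto intro: less_imp_le)
  have "0 \<le> Re (agm k') * Im (agm k)" "Im (agm k') * Re (agm k) \<le> 0"
    using I R[OF k] R[OF k'] by (auto intro: mult_nonneg_nonneg mult_nonpos_nonneg)
  then have "0 \<le> Re (\<i> * agm k' * cnj (agm k))" by simp
  then show ?thesis
    unfolding tau_def complex_div_cnj[of "\<i> * _"] k_def[symmetric] k'_def[symmetric] by simp
qed

section \<open>Theta values on the imaginary axis as runs of the mean\<close>

lemma theta_imag_double:
  fixes y :: real
  defines "A \<equiv> \<lambda>y. Re (theta3 (\<i> * of_real y))" and "B \<equiv> \<lambda>y. Re (theta4 (\<i> * of_real y))"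
    and "C \<equiv> \<lambda>y. Re (theta2 (\<i> * of_real y))"
  assumes y: "0 < y"
  shows "A y \<noteq> 0" "B y \<noteq> 0" "C y \<noteq> 0"
    "(A y)\<^sup>2 = (A (2 * y))\<^sup>2 + (C (2 * y))\<^sup>2" "(B y)\<^sup>2 = (A (2 * y))\<^sup>2 - (C (2 * y))\<^sup>2"
    "A y * B y = (B (2 * y))\<^sup>2" "(C y)\<^sup>2 = 2 * C (2 * y) * A (2 * y)"
proof -
  have u: "\<i> * of_real y \<in> uhp" using y by (simp add: uhp_def)
  have e: "2 * (\<i> * complex_of_real y) = \<i> * of_real (2 * y)" by simp
  note im = theta_imag
  show "A y \<noteq> 0" "B y \<noteq> 0" "C y \<noteq> 0"
    using theta3_nonzero[OF u] theta4_nonzero[OF u] theta2_nonzero[OF u] im[of y]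
    unfolding A_def B_def C_def by (metis of_real_0)+
  have of_real: "of_real (A r) = theta3 (\<i> * of_real r)" "of_real (B r) = theta4 (\<i> * of_real r)"
    "of_real (C r) = theta2 (\<i> * of_real r)" for r
    by (simp_all only: im A_def B_def C_def)
  note d = theta_double[OF u, unfolded e, folded of_real, folded of_real_mult of_real_power of_real_add of_real_diff,
      unfolded of_real_eq_iff]
  show "(A y)\<^sup>2 = (A (2 * y))\<^sup>2 + (C (2 * y))\<^sup>2" "(B y)\<^sup>2 = (A (2 * y))\<^sup>2 - (C (2 * y))\<^sup>2"
    "A y * B y = (B (2 * y))\<^sup>2" using d(1,2,3) by blast+
  have "complex_of_real ((C y)\<^sup>2) = of_real (2 * C (2 * y) * A (2 * y))"
    using theta_double(4)[OF u, unfolded e, folded of_real] by simp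
  then show "(C y)\<^sup>2 = 2 * C (2 * y) * A (2 * y)" by (simp only: of_real_eq_iff)
qed

text \<open>Doubling \<open>y\<close> runs the mean from the squares of \<open>theta3\<close> and
  \<open>theta4\<close> to the limit 1. Halving \<open>y\<close> runs it from the squares of
  \<open>theta3\<close> and \<open>theta2\<close>, rescaled by \<open>2 ^ n\<close> to compensate
  the factor 2, to the limit \<open>1 / y\<close>. The common starting value cancels and the
  quotient of the two means is \<open>y\<close>.\<close>

lemma tau_lam_imag:
  assumes y: "0 < y"
  shows "lam (\<i> * of_real y) \<in> slit" "tau (lam (\<i> * of_real y)) = \<i> * of_real y"
proof -
  define A B C where "A = (\<lambda>y. Re (theta3 (\<i> * of_real y)))" and "B = (\<lambda>y. Re (theta4 (\<i> * of_real y)))"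
    and "C = (\<lambda>y. Re (theta2 (\<i> * of_real y)))"
  have D: "A y \<noteq> 0" "B y \<noteq> 0" "C y \<noteq> 0"
    "(A y)\<^sup>2 = (A (2 * y))\<^sup>2 + (C (2 * y))\<^sup>2" "(B y)\<^sup>2 = (A (2 * y))\<^sup>2 - (C (2 * y))\<^sup>2"
    "A y * B y = (B (2 * y))\<^sup>2" "(C y)\<^sup>2 = 2 * C (2 * y) * A (2 * y)" if "0 < y" for y
    using theta_imag_double[OF that] unfolding A_def B_def C_def by blast+
  have of_real: "theta3 (\<i> * of_real r) = of_real (A r)" "theta4 (\<i> * of_real r) = of_real (B r)"
    "theta2 (\<i> * of_real r) = of_real (C r)" for r
    by (simp_all only: theta_imag A_def B_def C_def)
  have u: "\<i> * of_real y \<in> uhp" using y by (simp add: uhp_def)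
  have nz: "A y \<noteq> 0" "B y \<noteq> 0" "C y \<noteq> 0" using D[OF y] by auto
  have l1: "lam (\<i> * of_real y) = of_real (((C y)\<^sup>2 / (A y)\<^sup>2)\<^sup>2)"
    by (simp add: lam_def of_real power_divide flip: of_real_power of_real_divide power_mult)
  have l2: "1 - lam (\<i> * of_real y) = of_real (((B y)\<^sup>2 / (A y)\<^sup>2)\<^sup>2)"
    unfolding one_minus_lam[OF u] by (simp add: of_real power_divide flip: of_real_power of_real_divide power_mult)
  have k1: "csqrt (lam (\<i> * of_real y)) = of_real ((C y)\<^sup>2 / (A y)\<^sup>2)"
    unfolding l1 by (subst csqrt_of_real) (simp_all del: of_real_divide)
  have k2: "csqrt (1 - lam (\<i> * of_real y)) = of_real ((B y)\<^sup>2 / (A y)\<^sup>2)"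
    unfolding l2 by (subst csqrt_of_real) (simp_all del: of_real_divide)
  have "0 < Re (lam (\<i> * of_real y))"
    unfolding l1 Re_complex_of_real using nz by simp
  moreover have "0 < Re (1 - lam (\<i> * of_real y))"
    unfolding l2 Re_complex_of_real using nz by simp
  ultimately show "lam (\<i> * of_real y) \<in> slit" by (simp add: slit_def)
  have "agm (of_real ((B (2 ^ 0 * y))\<^sup>2 / (A (2 ^ 0 * y))\<^sup>2)) = of_real (1 / (A (2 ^ 0 * y))\<^sup>2)"
  proof (rule agm_of_real[where x = "\<lambda>n. (A (2 ^ n * y))\<^sup>2" and y = "\<lambda>n. (B (2 ^ n * y))\<^sup>2"])
    fix n
    have p: "0 < 2 ^ n * y" using y by simp
    note d = D[OF p] 
    have e: "2 * (2 ^ n * y) = 2 ^ Suc n * y" by simp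
    show "0 < (A (2 ^ n * y))\<^sup>2" "0 < (B (2 ^ n * y))\<^sup>2" using d(1,2) by auto
    show "(A (2 ^ Suc n * y))\<^sup>2 = ((A (2 ^ n * y))\<^sup>2 + (B (2 ^ n * y))\<^sup>2) / 2"
      using d(4,5) unfolding e by simp
    have "(A (2 ^ n * y))\<^sup>2 * (B (2 ^ n * y))\<^sup>2 = ((B (2 ^ Suc n * y))\<^sup>2)\<^sup>2"
      using d(6) unfolding e by (metis power_mult_distrib)
    then show "(B (2 ^ Suc n * y))\<^sup>2 = sqrt ((A (2 ^ n * y))\<^sup>2 * (B (2 ^ n * y))\<^sup>2)"
      by (metis real_sqrt_abs abs_power2)
  next
    have "(\<lambda>n. Re (theta3 (2 ^ n * (\<i> * of_real y)))) \<longlonglongrightarrow> Re 1"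
      by (intro tendsto_Re theta_limits filterlim_Im_double u)
    then have "(\<lambda>n. (A (2 ^ n * y))\<^sup>2) \<longlonglongrightarrow> (Re 1)\<^sup>2"
      unfolding A_def by (intro tendsto_power) (simp add: mult.left_commute)
    then show "(\<lambda>n. (A (2 ^ n * y))\<^sup>2) \<longlonglongrightarrow> 1" by simp
  qed
  then have a2: "agm (csqrt (1 - lam (\<i> * of_real y))) = of_real (1 / (A y)\<^sup>2)" unfolding k2 by simp
  have "agm (of_real (((C (y / 2 ^ 0))\<^sup>2 / 2 ^ 0) / ((A (y / 2 ^ 0))\<^sup>2 / 2 ^ 0))) = of_real ((1 / y) / ((A (y / 2 ^ 0))\<^sup>2 / 2 ^ 0))"
  proof (rule agm_of_real[where x = "\<lambda>n. (A (y / 2 ^ n))\<^sup>2 / 2 ^ n" and y = "\<lambda>n. (C (y / 2 ^ n))\<^sup>2 / 2 ^ n"])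
    fix n
    have p: "0 < y / 2 ^ n" "0 < y / 2 ^ Suc n" using y by simp_all
    have e: "2 * (y / 2 ^ Suc n) = y / 2 ^ n" by simp
    note d = D(4-)[OF p(2), unfolded e] and nz = D(1-3)[OF p(1)]
    show "0 < (A (y / 2 ^ n))\<^sup>2 / 2 ^ n" "0 < (C (y / 2 ^ n))\<^sup>2 / 2 ^ n" using nz by auto
    show "(A (y / 2 ^ Suc n))\<^sup>2 / 2 ^ Suc n = ((A (y / 2 ^ n))\<^sup>2 / 2 ^ n + (C (y / 2 ^ n))\<^sup>2 / 2 ^ n) / 2"
      using d(1) by (simp add: add_divide_distrib)
    have "(C (y / 2 ^ Suc n))\<^sup>2 / 2 ^ Suc n = C (y / 2 ^ n) * A (y / 2 ^ n) / 2 ^ n"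
      using d(4) by simp
    moreover have "(A (y / 2 ^ n))\<^sup>2 / 2 ^ n * ((C (y / 2 ^ n))\<^sup>2 / 2 ^ n) = (C (y / 2 ^ n) * A (y / 2 ^ n) / 2 ^ n)\<^sup>2"
      by (simp add: power_mult_distrib power_divide power2_eq_square)
    moreover have "0 \<le> (C (y / 2 ^ Suc n))\<^sup>2 / 2 ^ Suc n" by simp
    ultimately show "(C (y / 2 ^ Suc n))\<^sup>2 / 2 ^ Suc n = sqrt ((A (y / 2 ^ n))\<^sup>2 / 2 ^ n * ((C (y / 2 ^ n))\<^sup>2 / 2 ^ n))"
      by (metis real_sqrt_abs abs_of_nonneg)
  next
    \<comment> \<open>The bounded error of \<open>theta3_imag_bound\<close> disappears after
      division by \<open>sqrt (2 ^ n)\<close>; this fixes the constant \<open>1 / y\<close>.\<close>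
    have "(\<lambda>n. A (y / 2 ^ n) / sqrt (2 ^ n)) \<longlonglongrightarrow> 1 / sqrt y"
    proof (rule LIM_zero_cancel, rule Lim_null_comparison)
      show "\<forall>\<^sub>F n in sequentially. norm (A (y / 2 ^ n) / sqrt (2 ^ n) - 1 / sqrt y) \<le> 1 / sqrt (2 ^ n)"
      proof (rule always_eventually, rule allI)
        fix n
        have "1 / sqrt y = (1 / sqrt (y / 2 ^ n)) / sqrt (2 ^ n)" by (simp add: real_sqrt_divide)
        then have "A (y / 2 ^ n) / sqrt (2 ^ n) - 1 / sqrt y = (A (y / 2 ^ n) - 1 / sqrt (y / 2 ^ n)) / sqrt (2 ^ n)"
          by (simp add: diff_divide_distrib)
        then show "norm (A (y / 2 ^ n) / sqrt (2 ^ n) - 1 / sqrt y) \<le> 1 / sqrt (2 ^ n)"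
          using theta3_imag_bound[of "y / 2 ^ n"] y by (simp add: A_def divide_right_mono del: of_real_divide)
      qed
      show "(\<lambda>n. 1 / sqrt (2 ^ n)) \<longlonglongrightarrow> 0" by real_asymp
    qed
    then have "(\<lambda>n. (A (y / 2 ^ n) / sqrt (2 ^ n))\<^sup>2) \<longlonglongrightarrow> (1 / sqrt y)\<^sup>2" by (rule tendsto_power)
    then show "(\<lambda>n. (A (y / 2 ^ n))\<^sup>2 / 2 ^ n) \<longlonglongrightarrow> 1 / y" using y by (simp add: power_divide)
  qed
  then have a1: "agm (csqrt (lam (\<i> * of_real y))) = of_real (1 / y / (A y)\<^sup>2)" unfolding k1 by simp
  show "tau (lam (\<i> * of_real y)) = \<i> * of_real y"
    unfolding tau_def a1 a2 using nz y by simp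
qed

section \<open>From the imaginary axis to the upper half plane\<close>

definition Wset :: "complex set" where
  "Wset = connected_component_set (uhp \<inter> lam -` slit) \<i>"

lemma open_uhp_lam: "open (uhp \<inter> lam -` slit)"
  using continuous_open_preimage[OF holomorphic_on_imp_continuous_on[OF holomorphic_lam] open_uhp open_slit] .

lemma open_Wset: "open Wset" and connected_Wset: "connected Wset"
  unfolding Wset_def by (auto intro: open_connected_component open_uhp_lam)

lemma Wset_subset: "Wset \<subseteq> uhp" "t \<in> Wset \<Longrightarrow> lam t \<in> slit"
  using connected_component_subset[of "uhp \<inter> lam -` slit" \<i>] by (auto simp: Wset_def)

lemma Wset_maximal: "connected S \<Longrightarrow> \<i> \<in> S \<Longrightarrow> S \<subseteq> uhp \<inter> lam -` slit \<Longrightarrow> S \<subseteq> Wset"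
  unfolding Wset_def by (rule connected_component_maximal)

lemma imag_axis_Wset: "0 < y \<Longrightarrow> \<i> * of_real y \<in> Wset"
proof -
  have "connected ((\<lambda>y. \<i> * complex_of_real y) ` {0<..})"
    by (intro connected_continuous_image continuous_intros) auto
  moreover have "\<i> \<in> (\<lambda>y. \<i> * complex_of_real y) ` {0<..}"
    by (rule image_eqI[of _ _ 1]) auto
  moreover have "(\<lambda>y. \<i> * complex_of_real y) ` {0<..} \<subseteq> uhp \<inter> lam -` slit"
    using tau_lam_imag by (auto simp: uhp_def)
  ultimately have "(\<lambda>y. \<i> * complex_of_real y) ` {0<..} \<subseteq> Wset" by (rule Wset_maximal)
  then show "0 < y \<Longrightarrow> \<i> * of_real y \<in> Wset" by auto
qed

text \<open>\<open>Wset\<close> is a connected component so that the identity theorem applies to it,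
  and membership only requires a connected set through \<open>i\<close>. The relation spreads from
  the imaginary axis, which accumulates at \<open>i\<close>.\<close>

lemma tau_lam:
  assumes "t \<in> Wset"
  shows "tau (lam t) = t"
proof -
  define U where "U = (\<lambda>y. \<i> * complex_of_real y) ` {0<..}"
  have "tau (lam t) - t = 0"
  proof (rule analytic_continuation[where f = "\<lambda>t. tau (lam t) - t" and U = U and \<xi> = \<i> and S = Wset])
    have "(tau \<circ> lam) holomorphic_on Wset"
      using Wset_subset holomorphic_lam holomorphic_tau
      by (intro holomorphic_on_compose_gen[OF holomorphic_on_subset[OF holomorphic_lam] holomorphic_tau]) auto
    then show "(\<lambda>t. tau (lam t) - t) holomorphic_on Wset"
      by (intro holomorphic_intros) (simp add: o_def)
    show "U \<subseteq> Wset" "\<i> \<in> Wset" using imag_axis_Wset imag_axis_Wset[of 1] by (auto simp: U_def)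
    show "\<i> islimpt U"
      unfolding islimpt_approachable
    proof (intro allI impI)
      fix e :: real assume "0 < e"
      then have "\<i> * of_real (1 + e / 2) \<in> U" "dist (\<i> * of_real (1 + e / 2)) \<i> < e" "\<i> * of_real (1 + e / 2) \<noteq> \<i>"
        by (auto simp: U_def dist_norm algebra_simps norm_mult norm_divide complex_eq_iff)
      then show "\<exists>x'\<in>U. x' \<noteq> \<i> \<and> dist x' \<i> < e" by blast
    qed
    show "tau (lam z) - z = 0" if "z \<in> U" for z using that tau_lam_imag by (auto simp: U_def)
  qed (use assms open_Wset connected_Wset in auto)
  then show ?thesis by simp
qed

lemma open_lam_image: "open S \<Longrightarrow> S \<subseteq> Wset \<Longrightarrow> open (lam ` S)"
  using Wset_subset by (intro open_mapping_thm3 holomorphic_on_subset[OF holomorphic_lam])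
    (auto intro!: inj_on_inverseI[where g = tau] tau_lam)

text \<open>By \<open>tau_lam\<close> the function \<open>lam\<close> is injective on
  \<open>Wset\<close>, so the image is open. There the relation is immediate, and it continues to
  the connected \<open>slit\<close>.\<close>

lemma lam_tau:
  assumes "z \<in> slit"
  shows "lam (tau z) = z"
proof (rule analytic_continuation_open[where s = "lam ` Wset" and s' = slit and f = "\<lambda>z. lam (tau z)" and g = "\<lambda>z. z"])
  show "(\<lambda>z. lam (tau z)) holomorphic_on slit"
    using holomorphic_on_compose_gen[OF holomorphic_tau holomorphic_lam] tau_in_uhp by (auto simp: o_def)
  show "lam ` Wset \<noteq> {}" using imag_axis_Wset[of 1] by auto
  show "open (lam ` Wset)" by (intro open_lam_image open_Wset order_refl)
qed (use assms open_slit connected_slit Wset_subset tau_lam in auto)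

lemma uhp_neg_inverse: "t \<in> uhp \<Longrightarrow> - 1 / t \<in> uhp"
  by (auto simp: uhp_def Im_divide power2_eq_square intro!: divide_pos_pos)
     (metis add_pos_pos add_nonneg_pos mult_pos_pos zero_le_square)

text \<open>On \<open>Wset\<close> this is \<open>tau (1 - z) = - 1 / tau z\<close> read through
  \<open>lam\<close>, and that holds because \<open>1 - z\<close> merely exchanges the two
  means.\<close>

lemma lam_neg_inverse:
  assumes "t \<in> uhp"
  shows "lam (- 1 / t) = 1 - lam t"
proof (rule analytic_continuation_open[where s = Wset and s' = uhp and f = "\<lambda>t. lam (- 1 / t)" and g = "\<lambda>t. 1 - lam t"])
  have "(\<lambda>t. - 1 / t) holomorphic_on uhp" by (intro holomorphic_intros) (auto simp: uhp_def)
  from holomorphic_on_compose_gen[OF this holomorphic_lam]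
  show "(\<lambda>t. lam (- 1 / t)) holomorphic_on uhp" using uhp_neg_inverse by (auto simp: o_def)
  show "(\<lambda>t. 1 - lam t) holomorphic_on uhp" by (intro holomorphic_intros holomorphic_lam)
  show "Wset \<noteq> {}" using imag_axis_Wset[of 1] by auto
  show "connected uhp" by (simp add: convex_connected convex_uhp)
  fix t assume t: "t \<in> Wset"
  then have z: "lam t \<in> slit" by (rule Wset_subset)
  have "lam (- 1 / t) = lam (tau (1 - lam t))" using tau_one_minus[OF z] tau_lam[OF t] by simp
  also have "\<dots> = 1 - lam t" by (rule lam_tau[OF one_minus_slit[OF z]])
  finally show "lam (- 1 / t) = 1 - lam t" .
qed (use assms open_Wset open_uhp Wset_subset in auto)

text \<open>On the unit circle the inversion \<open>- 1 / t\<close> coincides with the reflection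
  \<open>- cnj t\<close>, so that \<open>cnj (lam t) = 1 - lam t\<close>.\<close>

lemma Re_lam_unit_circle:
  assumes "t \<in> uhp" "norm t = 1"
  shows "Re (lam t) = 1 / 2"
proof -
  have "t * cnj t = 1" using assms by (simp add: complex_norm_square[symmetric])
  then have "1 / t = cnj t" using assms by (metis norm_zero zero_neq_one nonzero_mult_div_cancel_left)
  then have "- 1 / t = - cnj t" by (metis minus_divide_left)
  then have "cnj (lam t) = 1 - lam t" using lam_neg_inverse[OF assms(1)] lam_cnj by metis
  then have "Re (cnj (lam t)) = Re (1 - lam t)" by simp
  then show ?thesis by simp
qed

lemma unit_circle_Wset:
  assumes "t \<in> uhp" "norm t = 1"
  shows "t \<in> Wset"
proof -
  have c: "connected (cis ` {0<..<pi})" by (intro connected_continuous_image continuous_intros) auto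
  have "cis ` {0<..<pi} \<subseteq> uhp \<inter> lam -` slit"
  proof safe
    fix x assume x: "x \<in> {0<..<pi}"
    then show "cis x \<in> uhp" by (auto simp: uhp_def sin_gt_zero)
    then have "Re (lam (cis x)) = 1 / 2" by (intro Re_lam_unit_circle) auto
    then show "cis x \<in> lam -` slit" by (simp add: slit_def)
  qed
  moreover have "\<i> \<in> cis ` {0<..<pi}" by (rule image_eqI[of _ _ "pi/2"]) auto
  ultimately have "cis ` {0<..<pi} \<subseteq> Wset" using c by (intro Wset_maximal)
  moreover have "t \<noteq> 0" using assms by auto
  then have "t = cis (Arg t)" "0 < Arg t" "Arg t < pi"
    using assms cis_Arg[of t] Arg_lt_pi[of t] by (auto simp: sgn_eq uhp_def)
  ultimately show ?thesis by (metis greaterThanLessThan_iff image_subset_iff)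
qed

lemma norm_tau_half:
  assumes "Re z = 1 / 2"
  shows "norm (tau z) = 1"
proof -
  have z: "z \<in> slit" using assms by (simp add: slit_def)
  have "1 - z = cnj z" using assms by (simp add: complex_eq_iff)
  then have "- cnj (tau z) = - 1 / tau z" using tau_cnj[OF z] tau_one_minus[OF z] by simp
  then have "tau z * cnj (tau z) = 1" using tau_nonzero[OF z] by (simp add: field_simps)
  then show ?thesis
    by (metis complex_mod_mult_cnj norm_one norm_ge_zero power2_eq_1_iff abs_norm_cancel abs_1 abs_minus norm_not_less_zero zero_less_one neg_less_0_iff_less)
qed

lemma Re_tau_real:
  assumes "Im z = 0" "0 < Re z" "Re z < 1"
  shows "Re (tau z) = 0"
proof -
  have z: "z \<in> slit" using assms by (simp add: slit_def)
  have "cnj z = z" using assms by (simp add: complex_eq_iff)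
  then have "Re (tau z) = Re (- cnj (tau z))" using tau_cnj[OF z] by simp
  then show ?thesis by simp
qed

lemma Re_tau_nonpos:
  assumes "Im z < 0"
  shows "Re (tau z) \<le> 0"
  using Re_tau_nonneg[of "cnj z"] tau_cnj[of z] assms by (simp add: slit_def)

section \<open>Branches of the inverse over the other two cut planes\<close>

definition sig2 :: "complex \<Rightarrow> complex" where "sig2 z = tau (z / (z - 1)) + 1"
definition sig3 :: "complex \<Rightarrow> complex" where "sig3 z = - 1 / sig2 (1 - z)"
definition slit2 :: "complex set" where "slit2 = {z. Im z \<noteq> 0 \<or> Re z < 0}"
definition slit3 :: "complex set" where "slit3 = {z. Im z \<noteq> 0 \<or> 1 < Re z}"

lemma Im_div_minus_1: "Im (z / (z - 1)) = - Im z / (norm (z - 1))\<^sup>2"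
  unfolding complex_div_cnj[of z] by (simp add: algebra_simps)

lemma slit2_div: 
  assumes "z \<in> slit2" 
  shows "z / (z - 1) \<in> slit"
proof (cases "Im z = 0")
  case False
  then have "z \<noteq> 1" by auto
  with False show ?thesis by (simp add: slit_def Im_div_minus_1)
next
  case True
  with assms have "Re z < 0" by (simp add: slit2_def)
  moreover have "z / (z - 1) = of_real (Re z / (Re z - 1))"
    using True by (metis complex_is_Real_iff of_real_Re of_real_1 of_real_diff of_real_divide)
  moreover have "0 < Re z / (Re z - 1)" "Re z / (Re z - 1) < 1" using \<open>Re z < 0\<close>
    by (auto simp: field_simps)
  ultimately show ?thesis by (simp add: slit_def del: of_real_divide)
qed

lemma div_minus_1_involution: "(z::complex) \<noteq> 1 \<Longrightarrow> (z / (z - 1)) / (z / (z - 1) - 1) = z"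
  by (simp add: field_simps)

lemma lam_sig2:
  assumes "z \<in> slit2"
  shows "lam (sig2 z) = z"
proof -
  have "z \<noteq> 1" using assms by (auto simp: slit2_def)
  have "lam (sig2 z) = (z / (z - 1)) / (z / (z - 1) - 1)"
    unfolding sig2_def lam_add_1[OF tau_in_uhp[OF slit2_div[OF assms]]] lam_tau[OF slit2_div[OF assms]] ..
  also have "\<dots> = z" using \<open>z \<noteq> 1\<close> by (rule div_minus_1_involution)
  finally show ?thesis .
qed

lemma sig2_in_uhp: "z \<in> slit2 \<Longrightarrow> sig2 z \<in> uhp"
  using tau_in_uhp[OF slit2_div] by (simp add: sig2_def uhp_def)

lemma one_minus_slit3: "z \<in> slit3 \<Longrightarrow> 1 - z \<in> slit2" by (auto simp: slit2_def slit3_def)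

lemma lam_sig3: "z \<in> slit3 \<Longrightarrow> lam (sig3 z) = z"
  using lam_neg_inverse[OF sig2_in_uhp[OF one_minus_slit3]] lam_sig2[OF one_minus_slit3]
  by (simp add: sig3_def)

lemma sig3_in_uhp: "z \<in> slit3 \<Longrightarrow> sig3 z \<in> uhp"
  unfolding sig3_def by (intro uhp_neg_inverse sig2_in_uhp one_minus_slit3)

lemma open_slit2: "open slit2" and open_slit3: "open slit3"
proof -
  have "slit2 = {z. Im z \<noteq> 0} \<union> {z. Re z < 0}" "slit3 = {z. Im z \<noteq> 0} \<union> {z. 1 < Re z}"
    by (auto simp: slit2_def slit3_def)
  moreover have "{z. Im z \<noteq> 0} = {z. Im z < 0} \<union> {z. Im z > 0}" by auto
  moreover have "open ({z. Im z < 0} \<union> {z. Im z > 0} \<union> {z. Re z < 0})" "open ({z. Im z < 0} \<union> {z. Im z > 0} \<union> {z. 1 < Re z})"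
    by (intro open_Un open_halfspace_Im_lt open_halfspace_Im_gt open_halfspace_Re_lt open_halfspace_Re_gt)+
  ultimately show "open slit2" "open slit3" by simp_all
qed

lemma holomorphic_sig2: "sig2 holomorphic_on slit2"
proof -
  have "(\<lambda>z. z / (z - 1)) holomorphic_on slit2" by (intro holomorphic_intros) (auto simp: slit2_def)
  from holomorphic_on_compose_gen[OF this holomorphic_tau] slit2_div
  have "(\<lambda>z. tau (z / (z - 1))) holomorphic_on slit2" by (auto simp: o_def)
  then show ?thesis unfolding sig2_def[abs_def] by (intro holomorphic_intros)
qed

lemma holomorphic_sig3: "sig3 holomorphic_on slit3"
proof -
  have "(\<lambda>z. 1 - z) holomorphic_on slit3" by (intro holomorphic_intros)
  from holomorphic_on_compose_gen[OF this holomorphic_sig2] one_minus_slit3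
  have "(\<lambda>z. sig2 (1 - z)) holomorphic_on slit3" by (auto simp: o_def)
  then show ?thesis unfolding sig3_def[abs_def]
  proof (intro holomorphic_intros)
    show "sig2 (1 - z) \<noteq> 0" if "z \<in> slit3" for z
      using sig2_in_uhp[OF one_minus_slit3[OF that]] by (auto simp: uhp_def)
  qed
qed

text \<open>The point \<open>w = exp (i pi / 3)\<close> and its shift \<open>w - 1\<close> both lie
  on the unit circle, hence in \<open>Wset\<close>, so the two branches agree over a neighbourhood
  of \<open>lam w\<close>. Because \<open>Re w > 0\<close>, the value \<open>lam w\<close> lies in
  the upper half plane, and the identity theorem does the rest.\<close>

lemma sig2_upper:
  assumes "0 < Im z"
  shows "sig2 z = tau z"
proof -
  define w where "w = Complex (1/2) (sqrt 3 / 2)"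
  have n: "norm w = 1" "norm (w - 1) = 1" by (auto simp: w_def cmod_def power2_eq_square)
  have w: "w \<in> Wset" "w - 1 \<in> Wset"
    by (intro unit_circle_Wset n; simp add: w_def uhp_def)+
  define W' where "W' = Wset \<inter> (\<lambda>t. t - 1) -` Wset"
  have oW': "open W'" unfolding W'_def by (intro open_Int open_vimage open_Wset continuous_intros)
  have lw: "tau (lam w) = w" by (rule tau_lam[OF w(1)])
  have "0 < Im (lam w)"
  proof (rule ccontr)
    assume "\<not> 0 < Im (lam w)"
    then consider "Im (lam w) < 0" | "Im (lam w) = 0" by linarith
    then have "Re (tau (lam w)) \<le> 0"
    proof cases
      case 2
      then show ?thesis using Wset_subset(2)[OF w(1)] Re_tau_real[of "lam w"] by (auto simp: slit_def)
    qed (rule Re_tau_nonpos)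
    then show False unfolding lw by (simp add: w_def)
  qed
  then have ne: "lam w \<in> lam ` W' \<inter> {z. 0 < Im z}" using w by (auto simp: W'_def)
  show ?thesis
  proof (rule analytic_continuation_open[where s = "lam ` W' \<inter> {z. 0 < Im z}" and s' = "{z. 0 < Im z}" and f = sig2 and g = tau])
    show "open (lam ` W' \<inter> {z. 0 < Im z})"
      by (intro open_Int open_lam_image oW' open_halfspace_Im_gt) (auto simp: W'_def)
    show "sig2 holomorphic_on {z. 0 < Im z}" "tau holomorphic_on {z. 0 < Im z}"
      by (rule holomorphic_on_subset[OF holomorphic_sig2] holomorphic_on_subset[OF holomorphic_tau];
          auto simp: slit2_def slit_def)+
    fix z assume "z \<in> lam ` W' \<inter> {z. 0 < Im z}"
    then obtain t where t: "t \<in> Wset" "t - 1 \<in> Wset" "z = lam t" by (auto simp: W'_def)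
    have u: "t - 1 \<in> uhp" using t Wset_subset by auto
    have "z = lam (t - 1) / (lam (t - 1) - 1)" using lam_add_1[OF u] t by simp
    then have "z / (z - 1) = lam (t - 1)" using div_minus_1_involution[OF lam_neq_1[OF u]] by simp
    then show "sig2 z = tau z" using tau_lam t by (simp add: sig2_def)
  qed (use assms ne in \<open>auto simp: open_halfspace_Im_gt convex_connected convex_halfspace_Im_gt\<close>)
qed

text \<open>Reflection reverses the shift by 1, which gives
  \<open>cnj (sig2 (cnj z)) = 2 - sig2 z\<close>. The difference 2 between the branches is the
  monodromy around 0.\<close>

lemma sig2_lower:
  assumes "Im z < 0"
  shows "sig2 z = tau z + 2"
proof -
  have z: "z \<in> slit2" "z \<in> slit" using assms by (auto simp: slit2_def slit_def)
  have "cnj (sig2 (cnj z)) = 2 - sig2 z"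
    using tau_cnj[OF slit2_div[OF z(1)]] by (simp add: sig2_def)
  moreover have "sig2 (cnj z) = - cnj (tau z)" using sig2_upper[of "cnj z"] tau_cnj[OF z(2)] assms by simp
  ultimately show ?thesis by (simp add: algebra_simps)
qed

lemma sig3_lower:
  assumes "Im z < 0"
  shows "sig3 z = tau z"
proof -
  have z: "z \<in> slit" using assms by (auto simp: slit_def)
  show ?thesis using sig2_upper[of "1 - z"] assms tau_one_minus[OF z] tau_nonzero[OF z] by (simp add: sig3_def)
qed

lemma sig3_upper:
  assumes "0 < Im z"
  shows "sig3 z = tau z / (1 - 2 * tau z)"
proof -
  have z: "z \<in> slit" using assms by (auto simp: slit_def)
  have "sig2 (1 - z) = - 1 / tau z + 2" using sig2_lower[of "1 - z"] assms tau_one_minus[OF z] by simp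
  also have "\<dots> = - ((1 - 2 * tau z) / tau z)" using tau_nonzero[OF z] by (simp add: field_simps)
  finally show ?thesis by (simp add: sig3_def)
qed

section \<open>The covering of the twice punctured plane\<close>

text \<open>Described by invariance of \<open>lam\<close> instead of by generators: sheets that meet
  will coincide by the identity theorem, so no normal form for words in the deck group enters the
  covering property.\<close>

definition deck_maps :: "(complex \<Rightarrow> complex) set" where
  "deck_maps = {M. M holomorphic_on uhp \<and> M ` uhp \<subseteq> uhp \<and> (\<forall>t\<in>uhp. lam (M t) = lam t)}"

lemma deck_mapsD:
  assumes "M \<in> deck_maps"
  shows "M holomorphic_on uhp" "t \<in> uhp \<Longrightarrow> M t \<in> uhp" "t \<in> uhp \<Longrightarrow> lam (M t) = lam t"
  using assms by (auto simp: deck_maps_def)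

lemma deck_maps_compose:
  assumes "M \<in> deck_maps" "N \<in> deck_maps"
  shows "(\<lambda>t. M (N t)) \<in> deck_maps"
proof -
  have "(\<lambda>t. M (N t)) holomorphic_on uhp"
    using holomorphic_on_compose_gen[of N uhp M uhp] assms by (auto simp: deck_maps_def o_def)
  then show ?thesis using deck_mapsD[OF assms(1)] deck_mapsD[OF assms(2)] by (auto simp: deck_maps_def)
qed

lemma deck_maps_id: "(\<lambda>t. t) \<in> deck_maps"
  by (auto simp: deck_maps_def)

definition deckA :: "int \<Rightarrow> complex \<Rightarrow> complex" where "deckA n t = t + 2 * of_int n"
definition deckB :: "int \<Rightarrow> complex \<Rightarrow> complex" where "deckB n t = t / (1 - 2 * of_int n * t)"

lemma lam_add_2: "t \<in> uhp \<Longrightarrow> lam (t + 2) = lam t"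
  using lam_add_1[of t] lam_add_1[of "t + 1"] div_minus_1_involution[OF lam_neq_1[of t]]
  by (simp add: uhp_def add.commute)

lemma lam_add_even: "t \<in> uhp \<Longrightarrow> lam (t + 2 * of_nat n) = lam t"
proof (induction n)
  case (Suc n)
  have "t + 2 * of_nat n \<in> uhp" using Suc.prems by (simp add: uhp_def)
  from lam_add_2[OF this] Suc show ?case by (simp add: algebra_simps)
qed simp

lemma deckA_in: "deckA n \<in> deck_maps"
proof -
  have "lam (deckA n t) = lam t" if t: "t \<in> uhp" for t
  proof (cases "0 \<le> n")
    case True
    then show ?thesis using lam_add_even[OF t, of "nat n"] by (simp add: deckA_def)
  next
    case False
    have "t + 2 * of_int n \<in> uhp" using t by (simp add: uhp_def)
    from lam_add_even[OF this, of "nat (- n)"] False show ?thesis by (simp add: deckA_def)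
  qed
  moreover have "deckA n holomorphic_on uhp" unfolding deckA_def[abs_def] by (intro holomorphic_intros)
  ultimately show ?thesis by (auto simp: deck_maps_def deckA_def uhp_def)
qed

lemma deckB_denom: "t \<in> uhp \<Longrightarrow> 1 - 2 * of_int n * t \<noteq> 0"
proof
  assume t: "t \<in> uhp" and "1 - 2 * of_int n * t = 0"
  then have e: "2 * of_int n * t = 1" by simp
  from arg_cong[OF this, of Im] t have "n = 0" by (simp add: uhp_def)
  with e show False by simp
qed

text \<open>Inversion exchanges \<open>lam\<close> and \<open>1 - lam\<close>, hence the two
  punctures; the deck map of one is the conjugate of the deck map of the other.\<close>

lemma deckB_conj: "t \<in> uhp \<Longrightarrow> deckB n t = - 1 / deckA n (- 1 / t)"
proof -
  assume t: "t \<in> uhp"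
  then have "t \<noteq> 0" by (auto simp: uhp_def)
  then have "deckA n (- 1 / t) = - ((1 - 2 * of_int n * t) / t)" by (simp add: deckA_def field_simps)
  then show ?thesis by (simp add: deckB_def)
qed

lemma deckB_in: "deckB n \<in> deck_maps"
proof -
  have "deckB n t \<in> uhp" "lam (deckB n t) = lam t" if t: "t \<in> uhp" for t
    unfolding deckB_conj[OF t]
    using uhp_neg_inverse[OF t] deck_mapsD(2,3)[OF deckA_in, of "- 1 / t" n] lam_neg_inverse[OF t]
      uhp_neg_inverse[of "deckA n (- 1 / t)"] lam_neg_inverse[of "deckA n (- 1 / t)"] by auto
  moreover have "deckB n holomorphic_on uhp"
    unfolding deckB_def[abs_def] by (intro holomorphic_intros deckB_denom)
  ultimately show ?thesis by (auto simp: deck_maps_def)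
qed

lemma deckA_inverse: "deckA (- n) (deckA n t) = t"
  by (simp add: deckA_def)

lemma deckB_inverse:
  assumes "t \<in> uhp"
  shows "deckB (- n) (deckB n t) = t"
proof -
  have "- 1 / t \<in> uhp" by (rule uhp_neg_inverse[OF assms])
  then have "deckA n (- 1 / t) \<noteq> 0" "t \<noteq> 0"
    using deck_mapsD(2)[OF deckA_in, of "- 1 / t" n] assms by (auto simp: uhp_def)
  then show ?thesis
    using deckB_conj[OF assms] deckB_conj[OF deck_mapsD(2)[OF deckB_in[of n] assms], of "- n"]
    by (simp add: deckA_inverse)
qed

section \<open>Sheets and the covering property\<close>

definition sections :: "(complex set \<times> (complex \<Rightarrow> complex)) set" where
  "sections = {(slit, tau), (slit2, sig2), (slit3, sig3)}"

lemma sectionsD: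
  assumes "(U, s) \<in> sections"
  shows "open U" "s holomorphic_on U" "z \<in> U \<Longrightarrow> s z \<in> uhp" "z \<in> U \<Longrightarrow> lam (s z) = z"
  using assms open_slit open_slit2 open_slit3 holomorphic_tau holomorphic_sig2 holomorphic_sig3
    tau_in_uhp sig2_in_uhp sig3_in_uhp lam_tau lam_sig2 lam_sig3
  by (auto simp: sections_def)

lemma section_vs_tau:
  assumes "(U, s) \<in> sections" "Im z \<noteq> 0"
  shows "\<exists>M\<in>deck_maps. s z = M (tau z)" "\<exists>M\<in>deck_maps. tau z = M (s z)"
proof -
  have t: "tau z \<in> uhp" using assms by (intro tau_in_uhp) (simp add: slit_def)
  have "s z = tau z \<or> s z = deckA 1 (tau z) \<or> s z = deckB 1 (tau z)"
    using assms sig2_upper[of z] sig2_lower[of z] sig3_upper[of z] sig3_lower[of z]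
    by (cases "0 < Im z") (auto simp: sections_def deckA_def deckB_def)
  then show "\<exists>M\<in>deck_maps. s z = M (tau z)" "\<exists>M\<in>deck_maps. tau z = M (s z)"
    using deck_maps_id deckA_in deckB_in deckA_inverse[of 1 "tau z"] deckB_inverse[OF t, of 1]
    by (metis (no_types))+
qed

text \<open>Two different cut planes meet only off the real axis. There every branch differs from
  \<open>tau\<close> by a deck map that depends on the half plane.\<close>

lemma sections_related:
  assumes "(U, s) \<in> sections" "(U', s') \<in> sections" "z \<in> U" "z \<in> U'"
  shows "\<exists>M\<in>deck_maps. s' z = M (s z)"
proof (cases "U = U'")
  case True
  have "1/2 \<in> slit" "1/2 \<notin> slit2" "1/2 \<notin> slit3" "-1 \<in> slit2" "-1 \<notin> slit3"
    by (auto simp: slit_def slit2_def slit3_def)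
  then have "s = s'" using True assms by (auto simp: sections_def)
  then show ?thesis using deck_maps_id by (intro bexI[of _ "\<lambda>t. t"]) auto
next
  case False
  then have i: "Im z \<noteq> 0" using assms by (auto simp: sections_def slit_def slit2_def slit3_def)
  obtain M where "M \<in> deck_maps" "tau z = M (s z)" using section_vs_tau(2)[OF assms(1) i] by blast
  moreover obtain N where "N \<in> deck_maps" "s' z = N (tau z)" using section_vs_tau(1)[OF assms(2) i] by blast
  ultimately show ?thesis using deck_maps_compose[of N M] by (intro bexI[of _ "\<lambda>t. N (M t)"]) auto
qed

definition cover :: "complex \<Rightarrow> complex" where "cover t = 2 * lam t - 1"

text \<open>The total space consists by construction of translated branches, so that every point
  comes with a sheet through it.\<close>

definition cover_dom :: "complex set" where
  "cover_dom = (\<Union>M\<in>deck_maps. \<Union>(U, s)\<in>sections. (\<lambda>z. M (s z)) ` U)"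

lemma cover_domI: "M \<in> deck_maps \<Longrightarrow> (U, s) \<in> sections \<Longrightarrow> z \<in> U \<Longrightarrow> M (s z) \<in> cover_dom"
  unfolding cover_dom_def by blast

lemma cover_dom_uhp: "cover_dom \<subseteq> uhp"
  using deck_mapsD(2) sectionsD(3) unfolding cover_dom_def by fastforce

lemma cover_dom_deck:
  assumes "M \<in> deck_maps" "t \<in> cover_dom"
  shows "M t \<in> cover_dom"
proof -
  obtain N U s z where "N \<in> deck_maps" "(U, s) \<in> sections" "z \<in> U" "t = N (s z)"
    using assms(2) unfolding cover_dom_def by blast
  then show ?thesis using cover_domI[OF deck_maps_compose[OF assms(1)]] by blast
qed

lemma cover_deck: "M \<in> deck_maps \<Longrightarrow> t \<in> uhp \<Longrightarrow> cover (M t) = cover t"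
  by (simp add: cover_def deck_mapsD)

lemma cover_eqI: "lam t = (1 + x) / 2 \<Longrightarrow> cover t = x"
  by (simp add: cover_def add_divide_distrib)

lemma holomorphic_cover: "cover holomorphic_on uhp"
  unfolding cover_def[abs_def] by (intro holomorphic_intros holomorphic_lam)

lemma cover_in_Xpunct: "t \<in> uhp \<Longrightarrow> cover t \<in> Xpunct"
  using lam_nonzero[of t] lam_neq_1[of t] by (auto simp: cover_def Xpunct_def)

lemma deck_section:
  assumes "M \<in> deck_maps" "(U, s) \<in> sections"
  shows "(\<lambda>z. M (s z)) holomorphic_on U" "z \<in> U \<Longrightarrow> M (s z) \<in> uhp" "z \<in> U \<Longrightarrow> lam (M (s z)) = z"
    "open V \<Longrightarrow> V \<subseteq> U \<Longrightarrow> open ((\<lambda>z. M (s z)) ` V)"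
proof -
  show h: "(\<lambda>z. M (s z)) holomorphic_on U"
    using holomorphic_on_compose_gen[OF sectionsD(2)[OF assms(2)] deck_mapsD(1)[OF assms(1)]]
      sectionsD(3)[OF assms(2)] by (auto simp: o_def)
  show *: "z \<in> U \<Longrightarrow> M (s z) \<in> uhp" "z \<in> U \<Longrightarrow> lam (M (s z)) = z" for z
    using deck_mapsD[OF assms(1)] sectionsD[OF assms(2)] by auto
  show "open ((\<lambda>z. M (s z)) ` V)" if "open V" "V \<subseteq> U"
    using that * by (intro open_mapping_thm3 holomorphic_on_subset[OF h])
      (auto intro!: inj_on_inverseI[where g = lam])
qed

text \<open>Near \<open>z0\<close> the second sheet runs inside the open image of the first, where
  \<open>lam\<close> inverts both, so they agree locally and then on all of the connected
  \<open>B\<close>. It makes two sheets over the same disc equal or disjoint.\<close>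

lemma deck_sections_eq:
  assumes M: "M \<in> deck_maps" and N: "N \<in> deck_maps" and s: "(U, s) \<in> sections"
    and B: "open B" "connected B" "B \<subseteq> U" and z: "z0 \<in> B" "M (s z0) = N (s z0)" "z \<in> B"
  shows "M (s z) = N (s z)"
proof -
  let ?f = "\<lambda>z. M (s z)" and ?g = "\<lambda>z. N (s z)"
  have hol: "?f holomorphic_on B" "?g holomorphic_on B"
    using deck_section(1)[OF M s] deck_section(1)[OF N s] B(3) by (auto intro: holomorphic_on_subset)
  have fB: "open (?f ` B)" by (rule deck_section(4)[OF M s B(1,3)])
  define V where "V = B \<inter> ?g -` (?f ` B)"
  have "open V" unfolding V_def
    by (rule continuous_open_preimage[OF holomorphic_on_imp_continuous_on[OF hol(2)] B(1) fB])
  moreover have "z0 \<in> V" using z by (auto simp: V_def image_iff intro!: bexI[of _ z0])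
  moreover have "?f y = ?g y" if yV: "y \<in> V" for y
  proof -
    obtain y' where y': "y' \<in> B" "?g y = ?f y'" using yV unfolding V_def by blast
    then have "lam (?g y) = lam (?f y')" by simp
    then have "y = y'" using deck_section(3)[OF M s, of y'] deck_section(3)[OF N s, of y] y' yV B(3)
      by (auto simp: V_def)
    with y' show ?thesis by simp
  qed
  moreover have "V \<subseteq> B" by (auto simp: V_def)
  ultimately show ?thesis
    using analytic_continuation_open[of V B ?f ?g z] B(1,2) hol z(3) by blast
qed

lemma covering_space_cover: "covering_space cover_dom cover Xpunct"
  unfolding covering_space_def
proof (intro conjI ballI)
  show "continuous_on cover_dom cover"
    using holomorphic_on_imp_continuous_on[OF holomorphic_cover] cover_dom_uhp continuous_on_subset by blast
  have sec: "\<exists>U s. (U, s) \<in> sections \<and> (1 + x) / 2 \<in> U" if "x \<in> Xpunct" for x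
  proof -
    let ?y = "(1 + x) / 2"
    have "x \<noteq> -1" "x \<noteq> 1" using that by (auto simp: Xpunct_def)
    then have "1 + x \<noteq> 0" "1 + x \<noteq> 2" by (metis add_eq_0_iff, metis add_left_cancel one_add_one)
    then have "?y \<noteq> 0" "?y \<noteq> 1" by simp_all
    then have "Im ?y \<noteq> 0 \<or> Re ?y \<noteq> 0 \<and> Re ?y \<noteq> 1" unfolding complex_eq_iff by auto
    then have "?y \<in> slit \<or> ?y \<in> slit2 \<or> ?y \<in> slit3" unfolding slit_def slit2_def slit3_def by force
    then show ?thesis unfolding sections_def by blast
  qed
  show "cover ` cover_dom = Xpunct"
  proof
    show "cover ` cover_dom \<subseteq> Xpunct" using cover_in_Xpunct cover_dom_uhp by blast
    show "Xpunct \<subseteq> cover ` cover_dom"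
    proof
      fix x assume "x \<in> Xpunct"
      then obtain U s where s: "(U, s) \<in> sections" "(1 + x) / 2 \<in> U" using sec by blast
      then have "s ((1 + x) / 2) \<in> cover_dom" using cover_domI[OF deck_maps_id] by blast
      moreover have "cover (s ((1 + x) / 2)) = x" by (rule cover_eqI[OF sectionsD(4)[OF s]])
      ultimately show "x \<in> cover ` cover_dom" by force
    qed
  qed
  fix x assume "x \<in> Xpunct"
  then obtain U s where s: "(U, s) \<in> sections" "(1 + x) / 2 \<in> U" using sec by blast
  then obtain r where r: "0 < r" "ball ((1 + x) / 2) r \<subseteq> U" using sectionsD(1) open_contains_ball by blast
  define B where "B = ball ((1 + x) / 2) r"
  define T where "T = (\<lambda>y. (1 + y) / 2) -` B"
  have B: "open B" "connected B" "B \<subseteq> U" using r by (auto simp: B_def)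
  have T_iff: "y \<in> T \<longleftrightarrow> (1 + y) / 2 \<in> B" for y
    by (simp add: T_def)
  have openT: "open T" unfolding T_def by (auto intro!: open_vimage B continuous_intros)
  have cover_T: "cover t \<in> T \<longleftrightarrow> lam t \<in> B" for t by (simp add: T_iff cover_def)
  let ?v = "{(\<lambda>z. M (s z)) ` B |M. M \<in> deck_maps}"
  have xT: "x \<in> T" using r by (simp add: T_iff B_def)
  have TX: "T \<subseteq> Xpunct"
  proof
    fix y assume "y \<in> T"
    then have y: "(1 + y) / 2 \<in> U" using B T_iff by auto
    have "cover (s ((1 + y) / 2)) = y" by (rule cover_eqI[OF sectionsD(4)[OF s(1) y]])
    then show "y \<in> Xpunct" using cover_in_Xpunct[OF sectionsD(3)[OF s(1) y]] by simp
  qed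
  show "\<exists>T. x \<in> T \<and> openin (top_of_set Xpunct) T \<and>
      (\<exists>v. \<Union> v = cover_dom \<inter> cover -` T \<and> (\<forall>u\<in>v. openin (top_of_set cover_dom) u) \<and>
        pairwise disjnt v \<and> (\<forall>u\<in>v. \<exists>q. homeomorphism u T cover q))"
  proof (intro exI[of _ T] conjI exI[of _ ?v])
    show "openin (top_of_set Xpunct) T" using openT TX by (simp add: open_subset)
    show "\<Union> ?v = cover_dom \<inter> cover -` T"
    proof
      show "\<Union> ?v \<subseteq> cover_dom \<inter> cover -` T"
        using deck_section(3)[OF _ s(1)] cover_domI[OF _ s(1)] B(3) cover_T by fastforce
      show "cover_dom \<inter> cover -` T \<subseteq> \<Union> ?v"
      proof
        fix t assume "t \<in> cover_dom \<inter> cover -` T"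
        then have "t \<in> cover_dom" and lB: "lam t \<in> B" using cover_T by auto
        then obtain M U' s' z where t: "M \<in> deck_maps" "(U', s') \<in> sections" "z \<in> U'" "t = M (s' z)"
          unfolding cover_dom_def by blast
        then have z: "lam t = z" using deck_section(3) by blast
        \<comment> \<open>The point may come from another branch than the one chosen for the disc;
          the deck map \<open>N\<close> between the two branches is absorbed into
          \<open>M\<close>.\<close>
        then obtain N where N: "N \<in> deck_maps" "s' z = N (s z)"
          using sections_related[OF s(1) t(2), of z] lB t(3) B(3) by blast
        then have "t = (\<lambda>z. M (N (s z))) z" using t by simp
        moreover have "(\<lambda>t. M (N t)) \<in> deck_maps" by (rule deck_maps_compose[OF t(1) N(1)])
        ultimately show "t \<in> \<Union> ?v" using lB z by (auto intro!: exI[of _ "\<lambda>t. M (N t)"])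
      qed
    qed
    show "\<forall>u\<in>?v. openin (top_of_set cover_dom) u"
    proof
      fix u assume "u \<in> ?v"
      then obtain M where M: "M \<in> deck_maps" "u = (\<lambda>z. M (s z)) ` B" by blast
      have "open u" unfolding M(2) by (rule deck_section(4)[OF M(1) s(1) B(1,3)])
      moreover have "u \<subseteq> cover_dom" using M cover_domI[OF M(1) s(1)] B(3) by blast
      ultimately show "openin (top_of_set cover_dom) u" by (simp add: open_subset)
    qed
    show "pairwise disjnt ?v"
    proof (rule pairwiseI)
      fix u u' assume "u \<in> ?v" "u' \<in> ?v" "u \<noteq> u'"
      then obtain M N where M: "M \<in> deck_maps" "u = (\<lambda>z. M (s z)) ` B"
        and N: "N \<in> deck_maps" "u' = (\<lambda>z. N (s z)) ` B" by blast
      show "disjnt u u'"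
      proof (rule ccontr)
        assume "\<not> disjnt u u'"
        then obtain y y' where y: "y \<in> B" "y' \<in> B" "M (s y) = N (s y')" unfolding disjnt_def M N by auto
        then have "lam (M (s y)) = lam (N (s y'))" by simp
        then have "y = y'" using deck_section(3)[OF M(1) s(1), of y] deck_section(3)[OF N(1) s(1), of y'] y B(3) by auto
        then have "M (s z) = N (s z)" if "z \<in> B" for z
          using deck_sections_eq[OF M(1) N(1) s(1) B y(1) _ that] y by simp
        then have "u = u'" unfolding M N by (intro image_cong) auto
        with \<open>u \<noteq> u'\<close> show False by simp
      qed
    qed
    show "\<forall>u\<in>?v. \<exists>q. homeomorphism u T cover q"
    proof
      fix u assume "u \<in> ?v"
      then obtain M where M: "M \<in> deck_maps" "u = (\<lambda>z. M (s z)) ` B" by blast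
      have lu: "lam (M (s z)) = z" if "z \<in> B" for z using deck_section(3)[OF M(1) s(1)] B(3) that by blast
      have "homeomorphism u T cover (\<lambda>y. M (s ((1 + y) / 2)))"
      proof (rule homeomorphismI)
        have "u \<subseteq> uhp" using M deck_section(2)[OF M(1) s(1)] B(3) by blast
        then show "continuous_on u cover"
          using holomorphic_on_imp_continuous_on[OF holomorphic_cover] continuous_on_subset by blast
        have "continuous_on B (\<lambda>z. M (s z))"
          using holomorphic_on_imp_continuous_on[OF deck_section(1)[OF M(1) s(1)]] B(3) continuous_on_subset by blast
        then show "continuous_on T (\<lambda>y. M (s ((1 + y) / 2)))"
          by (rule continuous_on_compose2) (auto intro!: continuous_intros simp: T_iff)
        show "cover ` u \<subseteq> T" using lu by (auto simp: M(2) cover_T)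
        show "(\<lambda>y. M (s ((1 + y) / 2))) ` T \<subseteq> u" using T_iff by (auto simp: M(2))
        show "M (s ((1 + cover t) / 2)) = t" if "t \<in> u" for t using that lu by (auto simp: M(2) cover_def)
        show "cover (M (s ((1 + y) / 2))) = y" if "y \<in> T" for y using that lu T_iff cover_eqI by blast
      qed
      then show "\<exists>q. homeomorphism u T cover q" by blast
    qed
  qed (use xT in auto)
qed

text \<open>Sheets are open, so a continuous lift stays locally in one of them and equals
  \<open>M (s ((1 + f z) / 2))\<close> with fixed \<open>M\<close> and \<open>s\<close>.\<close>

lemma holomorphic_lift:
  assumes "open S" "f holomorphic_on S" "continuous_on S F" "F ` S \<subseteq> cover_dom" "\<And>z. z \<in> S \<Longrightarrow> cover (F z) = f z"
  shows "F holomorphic_on S"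
proof -
  have "\<exists>N. open N \<and> z \<in> N \<and> N \<subseteq> S \<and> F holomorphic_on N" if "z \<in> S" for z
  proof -
    have "F z \<in> cover_dom" using assms that by blast
    then obtain M U s y where M: "M \<in> deck_maps" and s: "(U, s) \<in> sections" and y: "y \<in> U" "F z = M (s y)"
      unfolding cover_dom_def by blast
    define N where "N = S \<inter> F -` ((\<lambda>z. M (s z)) ` U)"
    have "open N" unfolding N_def
      by (rule continuous_open_preimage[OF assms(3,1)]) (rule deck_section(4)[OF M s sectionsD(1)[OF s] order_refl])
    moreover have "z \<in> N" using that y by (auto simp: N_def)
    moreover have fU: "(1 + f x) / 2 \<in> U" "F x = M (s ((1 + f x) / 2))" if "x \<in> N" for x
    proof -
      obtain u where u: "u \<in> U" "F x = M (s u)" using \<open>x \<in> N\<close> by (auto simp: N_def)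
      then have "lam (F x) = u" using deck_section(3)[OF M s] by simp
      moreover have "f x = 2 * lam (F x) - 1" using assms(5)[of x] that by (simp add: N_def cover_def)
      ultimately have "(1 + f x) / 2 = u" by simp
      with u show "(1 + f x) / 2 \<in> U" "F x = M (s ((1 + f x) / 2))" by auto
    qed
    moreover have "(\<lambda>x. M (s ((1 + f x) / 2))) holomorphic_on N"
    proof -
      have "(\<lambda>x. (1 + f x) / 2) holomorphic_on N"
        by (intro holomorphic_intros holomorphic_on_subset[OF assms(2)]) (auto simp: N_def)
      from holomorphic_on_compose_gen[OF this deck_section(1)[OF M s]] fU(1) show ?thesis by (auto simp: o_def)
    qed
    then have "F holomorphic_on N" by (rule holomorphic_transform) (use fU(2) in simp)
    moreover have "N \<subseteq> S" by (auto simp: N_def)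
    ultimately show ?thesis by blast
  qed
  then show ?thesis
    by (meson assms(1) field_differentiable_at_within holomorphic_on_def holomorphic_on_imp_differentiable_at)
qed

section \<open>Syllables and integral geodesics\<close>

definition syl_prod :: "int list \<Rightarrow> int" where
  "syl_prod ns = (\<Prod>d\<leftarrow>syl_degs ns. 4 * int d - 1)"

lemma syl_degs_pos: "d \<in> set (syl_degs ns) \<Longrightarrow> 0 < d"
  by (induction ns rule: syl_degs.induct) (auto split: if_splits)

lemma syl_prod_pos: "0 < syl_prod ns"
proof -
  have "(\<And>d. d \<in> set ds \<Longrightarrow> 0 < d) \<Longrightarrow> 0 < (\<Prod>d\<leftarrow>ds. 4 * int d - 1)" for ds
    by (induction ds) fastforce+
  then show ?thesis unfolding syl_prod_def using syl_degs_pos by blast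
qed

lemma Lw_eq_ln: "Lw w = ln (real_of_int (syl_prod (map snd w)))"
proof -
  have "(\<And>d. d \<in> set ds \<Longrightarrow> 0 < d) \<Longrightarrow>
    (\<Sum>d\<leftarrow>ds. ln (4 * real d - 1)) = ln (real_of_int (\<Prod>d\<leftarrow>ds. 4 * int d - 1)) \<and> 0 < (\<Prod>d\<leftarrow>ds. 4 * int d - 1)" for ds
  proof (induction ds)
    case (Cons d ds)
    have "0 < d" using Cons.prems by simp
    then have p: "0 < 4 * int d - 1" by simp
    have IH: "(\<Sum>d\<leftarrow>ds. ln (4 * real d - 1)) = ln (real_of_int (\<Prod>d\<leftarrow>ds. 4 * int d - 1))"
      "0 < (\<Prod>d\<leftarrow>ds. 4 * int d - 1)" using Cons by auto
    have "ln (real_of_int ((4 * int d - 1) * (\<Prod>d\<leftarrow>ds. 4 * int d - 1)))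
        = ln (real_of_int (4 * int d - 1)) + ln (real_of_int (\<Prod>d\<leftarrow>ds. 4 * int d - 1))"
      unfolding of_int_mult by (rule ln_mult_pos; simp only: of_int_0_less_iff p IH(2))
    moreover have "real_of_int (4 * int d - 1) = 4 * real d - 1" by simp
    ultimately show ?case using IH mult_pos_pos[OF p IH(2)] by (simp only: list.map sum_list.Cons prod_list.Cons)
  qed simp
  then show ?thesis unfolding Lw_def syl_prod_def using syl_degs_pos by blast
qed

lemma syl_degs_run_split:
  assumes "\<bar>n\<bar> < 2"
  obtains d rest where "n # ns = replicate (Suc d) n @ rest" "rest = [] \<or> hd rest \<noteq> n"
    "syl_degs (n # ns) = Suc d # syl_degs rest" "length rest < length (n # ns)"
proof
  let ?k = "length (takeWhile (\<lambda>m. m = n) ns)" and ?r = "dropWhile (\<lambda>m. m = n) ns"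
  have "takeWhile (\<lambda>m. m = n) ns = replicate ?k n"
    by (rule replicate_eqI) (auto dest: set_takeWhileD)
  then show "n # ns = replicate (Suc ?k) n @ ?r"
    by (metis append_Cons replicate_Suc takeWhile_dropWhile_id)
  show "?r = [] \<or> hd ?r \<noteq> n" using hd_dropWhile[of "\<lambda>m. m = n" ns] by auto
  show "syl_degs (n # ns) = Suc ?k # syl_degs ?r" using assms by simp
  show "length ?r < length (n # ns)" by (simp add: le_imp_less_Suc length_dropWhile_le)
qed

text \<open>A cut changes the decomposition only when it falls inside a run of equal exponents of
  absolute value below 2.\<close>

lemma syl_degs_append:
  assumes "xs = [] \<or> ys = [] \<or> last xs \<noteq> hd ys \<or> 2 \<le> \<bar>last xs\<bar>"
  shows "syl_degs (xs @ ys) = syl_degs xs @ syl_degs ys"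
  using assms
proof (induction xs rule: syl_degs.induct)
  case (2 x xs)
  show ?case
  proof (cases "2 \<le> \<bar>x\<bar>")
    case True
    then show ?thesis using 2(1)[OF True] 2(3) by (cases "xs = []") auto
  next
    case False
    show ?thesis
    proof (cases "\<forall>m\<in>set xs. m = x")
      case True
      then have "last (x # xs) = x" by (metis last.simps last_in_set)
      then have "ys = [] \<or> hd ys \<noteq> x" using 2(3) False by auto
      then have "takeWhile (\<lambda>m. m = x) ys = []" "dropWhile (\<lambda>m. m = x) ys = ys" by (cases ys; simp)+
      moreover have tw: "takeWhile (\<lambda>m. m = x) xs = xs" and dw: "dropWhile (\<lambda>m. m = x) xs = []"
        using True by auto
      ultimately show ?thesis using False True by (simp add: takeWhile_append2 dropWhile_append2 tw dw)
    next
      case neq: False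
      then obtain m where m: "m \<in> set xs" "m \<noteq> x" by blast
      have "dropWhile (\<lambda>m. m = x) xs \<noteq> []" using m by auto
      then have l: "last (dropWhile (\<lambda>m. m = x) xs) = last (x # xs)"
        by (metis last_ConsR last_appendR takeWhile_dropWhile_id append_Nil2 dropWhile.simps(1))
      have "takeWhile (\<lambda>m. m = x) (xs @ ys) = takeWhile (\<lambda>m. m = x) xs"
        "dropWhile (\<lambda>m. m = x) (xs @ ys) = dropWhile (\<lambda>m. m = x) xs @ ys"
        using m by (auto intro!: takeWhile_append1 dropWhile_append1)
      then show ?thesis using 2(2)[OF False] 2(3) l False by auto
    qed
  qed
qed simp

lemma syl_prod_append:
  "xs = [] \<or> ys = [] \<or> last xs \<noteq> hd ys \<or> 2 \<le> \<bar>last xs\<bar> \<Longrightarrow> syl_prod (xs @ ys) = syl_prod xs * syl_prod ys"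
  by (simp add: syl_prod_def syl_degs_append)

lemma syl_prod_Nil [simp]: "syl_prod [] = 1"
  by (simp add: syl_prod_def)

lemma syl_degs_replicate: "\<bar>n\<bar> < 2 \<Longrightarrow> syl_degs (replicate (Suc d) n) = [Suc d]"
  by simp

lemma syl_prod_Cons_big: "2 \<le> \<bar>n\<bar> \<Longrightarrow> syl_prod (n # ns) = (4 * \<bar>n\<bar> - 1) * syl_prod ns"
  by (simp add: syl_prod_def)

text \<open>\<open>syl_degs\<close> reads from the left, but a first syllable can be peeled off and
  appended at the other end. The inverse word reverses and negates the exponents, which is why this
  is wanted.\<close>

lemma syl_prod_rev: "syl_prod (rev ns) = syl_prod ns"
proof (induction ns rule: length_induct)
  case (1 ns)
  show ?case
  proof (cases ns)
    case (Cons n ns')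
    show ?thesis
    proof (cases "2 \<le> \<bar>n\<bar>")
      case True
      have "syl_prod (rev ns' @ [n]) = syl_prod (rev ns') * syl_prod [n]"
        using True by (intro syl_prod_append) auto
      then show ?thesis using 1 Cons True by (simp add: syl_prod_Cons_big)
    next
      case False
      then obtain d rest where r: "n # ns' = replicate (Suc d) n @ rest" "rest = [] \<or> hd rest \<noteq> n"
        "syl_degs (n # ns') = Suc d # syl_degs rest" "length rest < length (n # ns')"
        using syl_degs_run_split[of n ns'] by auto
      have "syl_prod (rev rest @ replicate (Suc d) n) = syl_prod (rev rest) * syl_prod (replicate (Suc d) n)"
        using r(2) by (intro syl_prod_append) (cases rest, auto)
      moreover have "syl_prod (replicate (Suc d) n) = 4 * int (Suc d) - 1"
        using False unfolding syl_prod_def by (subst syl_degs_replicate) auto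
      moreover have "syl_prod (rev rest) = syl_prod rest" using 1 r(4) Cons by simp
      moreover have "rev ns = rev rest @ replicate (Suc d) n" unfolding Cons r(1) by (simp del: replicate_Suc)
      moreover have "syl_prod ns = (4 * int (Suc d) - 1) * syl_prod rest"
        unfolding Cons syl_prod_def r(3) by simp
      ultimately show ?thesis by simp
    qed
  qed simp
qed

lemma syl_prod_uminus: "syl_prod (map uminus ns) = syl_prod ns"
proof -
  have "syl_degs (map uminus ns) = syl_degs ns"
    by (induction ns rule: syl_degs.induct) (simp_all add: takeWhile_map dropWhile_map o_def)
  then show ?thesis by (simp add: syl_prod_def)
qed

text \<open>A triple \<^term>\<open>(E, C, D)\<close> encodes the hyperbolic geodesic \<open>E |t|\<^sup>2 - 2 C Re t + D = 0\<close>;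
  \<open>slide n\<close> is the effect of \<open>t \<mapsto> t + 2 n\<close> followed by \<open>t \<mapsto> - 1 / t\<close>.\<close>
type_synonym geod = "int \<times> int \<times> int"

fun slide :: "int \<Rightarrow> geod \<Rightarrow> geod" where
  "slide n (E, C, D) = (D + 4 * n * C + 4 * n\<^sup>2 * E, - (C + 2 * n * E), E)"

text \<open>The start \<open>(1, 0, -1)\<close> is the unit circle. Because \<open>deckB\<close> is
  \<open>deckA\<close> conjugated by the inversion and the generators of a reduced word alternate,
  the inversion built into \<open>slide\<close> lets both generators act alike, and only the
  exponents remain.\<close>

definition word_geod :: "int list \<Rightarrow> geod" where
  "word_geod ns = foldr slide ns (1, 0, -1)"

lemma word_geod_simps [simp]:
  "word_geod [] = (1, 0, -1)" "word_geod (n # ns) = slide n (word_geod ns)"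
  by (simp_all add: word_geod_def)

text \<open>\<open>slide\<close> substitutes a matrix of determinant 1 into a quadratic form and so
  keeps the discriminant of the unit circle.\<close>

lemma word_geod_disc: "word_geod ns = (E, C, D) \<Longrightarrow> C\<^sup>2 - E * D = 1"
proof (induction ns arbitrary: E C D)
  case (Cons n ns)
  obtain E' C' D' where "word_geod ns = (E', C', D')" by (metis prod_cases3)
  note g = this
  have eq: "E = D' + 4 * n * C' + 4 * n\<^sup>2 * E'" "C = - (C' + 2 * n * E')" "D = E'"
    using Cons.prems g by auto
  have "C'\<^sup>2 - E' * D' = 1" by (rule Cons.IH[OF g])
  then show ?case unfolding eq by (simp add: power2_eq_square algebra_simps)
qed auto

text \<open>A ping-pong argument: the condition on \<open>C\<close> and \<open>E\<close> puts the
  ends \<open>(C - 1) / E\<close> and \<open>(C + 1) / E\<close> of the geodesic into [-1, 1]. Since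
  \<open>E * E' = (\<bar>C'\<bar> - 1) * (\<bar>C'\<bar> + 1)\<close>, a lower bound for
  \<open>\<bar>C'\<bar>\<close> in terms of \<open>E\<close> becomes one for \<open>E'\<close> in
  terms of \<open>\<bar>C'\<bar>\<close>. The sign of \<open>C'\<close> is recorded because it
  decides whether a run placed in front gains or loses; the factor 3 for large \<open>n\<close> pays
  for the loss.\<close>

lemma slide_invariant:
  fixes E C D n :: int
  assumes "\<bar>C\<bar> + 1 \<le> E" "C\<^sup>2 - E * D = 1" "n \<noteq> 0" "slide n (E, C, D) = (E', C', D')"
  shows "\<bar>C'\<bar> + 1 \<le> E'" "0 \<le> D'" "0 < n \<Longrightarrow> C' < 0" "n < 0 \<Longrightarrow> 0 < C'"
    "2 \<le> \<bar>n\<bar> \<Longrightarrow> 3 * \<bar>C'\<bar> + 3 \<le> E'" "(2 * \<bar>n\<bar> - 1) * E + 1 \<le> \<bar>C'\<bar>"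
proof -
  have eq: "E' = D + 4 * n * C + 4 * n\<^sup>2 * E" "C' = - (C + 2 * n * E)" "D' = E" using assms(4) by auto
  have E: "1 \<le> E" using assms(1) by linarith
  show big: "(2 * \<bar>n\<bar> - 1) * E + 1 \<le> \<bar>C'\<bar>"
    using assms(1) by (cases "0 < n") (auto simp: eq algebra_simps)
  have ge: "m * E \<le> (2 * \<bar>n\<bar> - 1) * E" if "m \<le> 2 * \<bar>n\<bar> - 1" for m
    using that E by (intro mult_right_mono) auto
  have disc: "E * E' = (\<bar>C'\<bar> - 1) * (\<bar>C'\<bar> + 1)"
  proof -
    have "E * E' = C'\<^sup>2 - 1" using assms(2) by (simp add: eq power2_eq_square algebra_simps)
    also have "\<dots> = \<bar>C'\<bar>\<^sup>2 - 1" by simp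
    also have "\<dots> = (\<bar>C'\<bar> - 1) * (\<bar>C'\<bar> + 1)" by (simp add: power2_eq_square algebra_simps)
    finally show ?thesis .
  qed
  have *: "m * (\<bar>C'\<bar> + 1) \<le> E'" if "m \<le> 2 * \<bar>n\<bar> - 1" for m
  proof -
    have "m * E * (\<bar>C'\<bar> + 1) \<le> (\<bar>C'\<bar> - 1) * (\<bar>C'\<bar> + 1)"
      using ge[OF that] big by (intro mult_right_mono) auto
    then have "E * (m * (\<bar>C'\<bar> + 1)) \<le> E * E'" by (simp add: disc algebra_simps)
    then show ?thesis using E by (simp add: mult_le_cancel_left)
  qed
  show "\<bar>C'\<bar> + 1 \<le> E'" using *[of 1] assms(3) by auto
  show "2 \<le> \<bar>n\<bar> \<Longrightarrow> 3 * \<bar>C'\<bar> + 3 \<le> E'" using *[of 3] by auto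
  show "0 \<le> D'" using E eq by simp
  have "0 < n \<Longrightarrow> 1 * E \<le> n * E" "n < 0 \<Longrightarrow> n * E \<le> -1 * E" using E by (intro mult_right_mono; simp)+
  then show "0 < n \<Longrightarrow> C' < 0" "n < 0 \<Longrightarrow> 0 < C'" using assms(1) E unfolding eq by linarith+
qed

lemma word_geod_invariant:
  assumes "\<forall>n\<in>set ns. n \<noteq> 0" "word_geod ns = (E, C, D)"
  shows "\<bar>C\<bar> + 1 \<le> E"
    "ns \<noteq> [] \<Longrightarrow> 0 \<le> D \<and> (0 < hd ns \<longrightarrow> C < 0) \<and> (hd ns < 0 \<longrightarrow> 0 < C) \<and> (2 \<le> \<bar>hd ns\<bar> \<longrightarrow> 3 * \<bar>C\<bar> + 3 \<le> E)"
proof -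
  have "\<bar>C\<bar> + 1 \<le> E \<and> (ns \<noteq> [] \<longrightarrow> 0 \<le> D \<and> (0 < hd ns \<longrightarrow> C < 0) \<and> (hd ns < 0 \<longrightarrow> 0 < C) \<and> (2 \<le> \<bar>hd ns\<bar> \<longrightarrow> 3 * \<bar>C\<bar> + 3 \<le> E))"
    using assms
  proof (induction ns arbitrary: E C D)
    case (Cons n ns)
    obtain E' C' D' where g: "word_geod ns = (E', C', D')" by (metis prod_cases3)
    have 1: "\<bar>C'\<bar> + 1 \<le> E'" using Cons g by auto
    have 2: "slide n (E', C', D') = (E, C, D)" using Cons.prems(2) by (metis word_geod_simps(2) g)
    show ?case using slide_invariant[OF 1 word_geod_disc[OF g] _ 2] Cons.prems by auto
  qed auto
  then show "\<bar>C\<bar> + 1 \<le> E"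
    "ns \<noteq> [] \<Longrightarrow> 0 \<le> D \<and> (0 < hd ns \<longrightarrow> C < 0) \<and> (hd ns < 0 \<longrightarrow> 0 < C) \<and> (2 \<le> \<bar>hd ns\<bar> \<longrightarrow> 3 * \<bar>C\<bar> + 3 \<le> E)"
    by auto
qed

text \<open>For \<open>s = 1\<close> or \<open>s = -1\<close> the map behind \<open>slide s\<close>
  is parabolic: the entries of its powers are linear in \<open>d\<close>, and so the form changes
  quadratically in \<open>d\<close>. Hence a whole run behaves like one syllable.\<close>

lemma word_geod_run:
  assumes "s = 1 \<or> s = -1" "word_geod ns = (E, C, D)"
  shows "word_geod (replicate d s @ ns) =
    ((int d + 1)\<^sup>2 * E + 2 * int d * (int d + 1) * s * C + (int d)\<^sup>2 * D,
     - s * (int d * (int d + 1) * E + (2 * (int d)\<^sup>2 - 1) * s * C + int d * (int d - 1) * D),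
     (int d)\<^sup>2 * E + 2 * int d * (int d - 1) * s * C + (int d - 1)\<^sup>2 * D)"
proof (induction d)
  case 0
  then show ?case using assms by auto
next
  case (Suc d)
  then show ?case using assms(1) by (auto simp: power2_eq_square algebra_simps)
qed

section \<open>Growth of the form along the syllables\<close>

lemma syl_prod_le_C_sq:
  assumes "\<forall>n\<in>set ns. n \<noteq> 0" "ns \<noteq> []" "word_geod ns = (E, C, D)"
  shows "syl_prod ns \<le> C\<^sup>2"
  using assms
proof (induction ns arbitrary: E C D rule: length_induct)
  case (1 ns)
  obtain n ns' where ns: "ns = n # ns'" using 1(3) by (cases ns) auto
  have n0: "n \<noteq> 0" using 1 ns by auto
  \<comment> \<open>Every syllable but the innermost multiplies \<open>\<bar>C\<bar>\<close> by some
    \<open>m\<close> with \<open>m\<^sup>2 \<ge> k = 4 d - 1\<close>, where \<open>d\<close> is its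
    degree: \<open>m\<close> is \<open>2 * \<bar>n\<bar> - 1\<close> for a large exponent and
    \<open>4 * d - 1\<close> for a run. The innermost one starts from \<open>C = 0\<close> and
    yields \<open>\<bar>C\<bar> = 2 d\<close>, which is handled directly.\<close>
  have combine: "k * P \<le> c\<^sup>2" if "P \<le> c'\<^sup>2" "0 \<le> k" "k \<le> m\<^sup>2" "m * \<bar>c'\<bar> \<le> \<bar>c\<bar>" "0 \<le> m" "0 < P" for k P c c' m :: int
  proof -
    have "k * P \<le> m\<^sup>2 * c'\<^sup>2" using that by (intro mult_mono) auto
    also have "\<dots> = (m * \<bar>c'\<bar>)\<^sup>2" by (simp add: power_mult_distrib)
    also have "\<dots> \<le> \<bar>c\<bar>\<^sup>2" using that by (intro power_mono) auto
    finally show ?thesis by simp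
  qed
  show ?case
  proof (cases "2 \<le> \<bar>n\<bar>")
    case True
    obtain E' C' D' where g: "word_geod ns' = (E', C', D')" by (metis prod_cases3)
    have inv: "\<bar>C'\<bar> + 1 \<le> E'" using word_geod_invariant(1)[OF _ g] 1 ns by auto
    have sl: "slide n (E', C', D') = (E, C, D)" using 1(4) ns by (metis word_geod_simps(2) g)
    note big = slide_invariant(6)[OF inv word_geod_disc[OF g] n0 sl]
    show ?thesis
    proof (cases "ns' = []")
      case nil: True
      have "C = - 2 * n" using 1(4) ns nil by auto
      moreover have "0 \<le> (2 * \<bar>n\<bar> - 1)\<^sup>2" by simp
      then have "4 * \<bar>n\<bar> - 1 \<le> 4 * n\<^sup>2" by (simp add: power2_eq_square algebra_simps)
      ultimately show ?thesis
        unfolding ns syl_prod_Cons_big[OF True] nil by (simp add: syl_prod_def power_mult_distrib)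
    next
      case nnil: False
      show ?thesis unfolding ns syl_prod_Cons_big[OF True]
      proof (rule combine[where m = "2 * \<bar>n\<bar> - 1" and c' = C'])
        show "syl_prod ns' \<le> C'\<^sup>2" using 1 ns nnil g by auto
        \<comment> \<open>The estimate would fail for \<open>\<bar>n\<bar> = 1\<close>, which forces
          runs of such exponents to be treated as a whole.\<close>
        have "0 \<le> 4 * \<bar>n\<bar> * (\<bar>n\<bar> - 2)" using True by (intro mult_nonneg_nonneg) auto
        then show "4 * \<bar>n\<bar> - 1 \<le> (2 * \<bar>n\<bar> - 1)\<^sup>2" by (simp add: power2_eq_square algebra_simps)
        have "(2 * \<bar>n\<bar> - 1) * \<bar>C'\<bar> \<le> (2 * \<bar>n\<bar> - 1) * E'" using True inv by (intro mult_left_mono) auto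
        then show "(2 * \<bar>n\<bar> - 1) * \<bar>C'\<bar> \<le> \<bar>C\<bar>" using big by linarith
      qed (use True syl_prod_pos in auto)
    qed
  next
    case False
    then obtain k rest where r: "n # ns' = replicate (Suc k) n @ rest" "rest = [] \<or> hd rest \<noteq> n"
        "syl_degs (n # ns') = Suc k # syl_degs rest" "length rest < length (n # ns')"
      using syl_degs_run_split[of n ns'] by auto
    define d where "d = int (Suc k)"
    have d: "1 \<le> d" by (simp add: d_def)
    have n1: "n = 1 \<or> n = -1" using False n0 by auto
    have sp: "syl_prod ns = (4 * d - 1) * syl_prod rest" unfolding ns syl_prod_def r(3) by (simp add: d_def)
    obtain E' C' D' where g: "word_geod rest = (E', C', D')" by (metis prod_cases3)
    have nz: "\<forall>n\<in>set rest. n \<noteq> 0" using 1(2) ns r(1) by auto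
    have C: "C = - n * (d * (d + 1) * E' + (2 * d\<^sup>2 - 1) * (n * C') + d * (d - 1) * D')"
      using word_geod_run[OF n1 g, of "Suc k"] 1(4) unfolding ns r(1) d_def[symmetric] by (simp add: mult.assoc)
    have absC: "\<bar>C\<bar> = \<bar>d * (d + 1) * E' + (2 * d\<^sup>2 - 1) * (n * C') + d * (d - 1) * D'\<bar>"
      unfolding C abs_mult using n1 by auto
    show ?thesis
    proof (cases "rest = []")
      case True
      then have "E' = 1" "C' = 0" "D' = -1" using g by auto
      then have "\<bar>C\<bar> = \<bar>2 * d\<bar>" unfolding absC by (simp add: algebra_simps)
      then have "C\<^sup>2 = (2 * d)\<^sup>2" by (metis power2_abs)
      moreover have "0 \<le> (2 * d - 1)\<^sup>2" by simp
      ultimately show ?thesis unfolding sp True by (simp add: syl_prod_def power2_eq_square algebra_simps)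
    next
      case nnil: False
      note inv = word_geod_invariant[OF nz g]
      define c where "c = n * C'"
      have ac: "\<bar>c\<bar> = \<bar>C'\<bar>" using n1 by (auto simp: c_def)
      have hd: "hd rest \<noteq> n" "hd rest \<noteq> 0" using r(2) nnil nz by auto
      have dd: "0 \<le> d * (d - 1) * D'" using d inv(2) nnil by simp
      \<comment> \<open>For \<open>c > 0\<close> no term of the closed form is negative and
        \<open>c \<le> E'\<close> suffices. For \<open>c \<le> 0\<close> the middle term is a loss,
        but then the next exponent is large, and \<open>3 * \<bar>c\<bar> \<le> E'\<close> outweighs
        it.\<close>
      have "(4 * d - 1) * \<bar>c\<bar> \<le> d * (d + 1) * E' + (2 * d\<^sup>2 - 1) * c + d * (d - 1) * D'"
      proof (cases "0 < c")
        case True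
        have "0 \<le> d * (d + 1) * (E' - c)" using d inv(1) ac True by simp
        moreover have "0 \<le> 3 * (d * (d - 1)) * c" using d True by simp
        moreover have "d * (d + 1) * E' + (2 * d\<^sup>2 - 1) * c - (4 * d - 1) * c = d * (d + 1) * (E' - c) + 3 * (d * (d - 1)) * c"
          by (simp add: power2_eq_square algebra_simps)
        ultimately show ?thesis using dd True by linarith
      next
        case neg: False
        have "2 \<le> \<bar>hd rest\<bar>"
        proof (rule ccontr)
          assume "\<not> ?thesis"
          then have "hd rest = - n" using hd n1 by auto
          then have "0 < c" using inv(2) nnil n1 by (auto simp: c_def)
          with neg show False by simp
        qed
        then have "3 * \<bar>c\<bar> \<le> E'" using inv(2) nnil ac by auto
        then have "d * (d + 1) * (3 * \<bar>c\<bar>) \<le> d * (d + 1) * E'" using d by (intro mult_left_mono) auto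
        moreover have "0 \<le> (d * (d - 1) + 2) * \<bar>c\<bar>" using d by simp
        moreover have "c = - \<bar>c\<bar>" using neg by simp
        ultimately show ?thesis using dd by (simp add: power2_eq_square algebra_simps)
      qed
      then have "(4 * d - 1) * \<bar>C'\<bar> \<le> \<bar>C\<bar>" unfolding absC c_def[symmetric] ac[symmetric] by linarith
      moreover have "4 * d - 1 \<le> (4 * d - 1)\<^sup>2" using d by (simp add: power2_eq_square)
      moreover have "syl_prod rest \<le> C'\<^sup>2" using 1(1) nz nnil g r(4) ns by auto
      ultimately show ?thesis unfolding sp using d syl_prod_pos[of rest]
        by (intro combine[where m = "4 * d - 1" and c' = C']) auto
    qed
  qed
qed

text \<open>The size \<open>\<bar>E\<bar> + 2 * \<bar>C\<bar> + \<bar>D\<bar>\<close> is 2 for the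
  unit circle. A syllable of degree d multiplies it by at most the square of 2 d + 1, which is the
  total coefficient that \<open>\<bar>E'\<bar>\<close> receives for large exponents and for runs
  alike; and 2 d + 1 is at most 4 d - 1.\<close>

lemma C_le_syl_prod:
  assumes "\<forall>n\<in>set ns. n \<noteq> 0" "word_geod ns = (E, C, D)"
  shows "\<bar>C\<bar> \<le> (syl_prod ns)\<^sup>2"
proof -
  have "\<bar>E\<bar> + 2 * \<bar>C\<bar> + \<bar>D\<bar> \<le> 2 * (syl_prod ns)\<^sup>2"
    using assms
  proof (induction ns arbitrary: E C D rule: length_induct)
    case (1 ns)
    have combine: "N \<le> 2 * (k * P)\<^sup>2" if "N \<le> m\<^sup>2 * N'" "N' \<le> 2 * P\<^sup>2" "m \<le> k" "0 \<le> m" for N N' m k P :: int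
    proof -
      have "m\<^sup>2 * N' \<le> m\<^sup>2 * (2 * P\<^sup>2)" using that by (intro mult_left_mono) auto
      also have "\<dots> \<le> k\<^sup>2 * (2 * P\<^sup>2)" using that by (intro mult_right_mono power_mono) auto
      finally show ?thesis using that(1) by (simp add: power_mult_distrib)
    qed
    show ?case
    proof (cases ns)
      case Nil
      then show ?thesis using 1 by (auto simp: syl_prod_def)
    next
      case (Cons n ns')
      have n0: "n \<noteq> 0" using 1 Cons by auto
      show ?thesis
      proof (cases "2 \<le> \<bar>n\<bar>")
        case True
        obtain E' C' D' where g: "word_geod ns' = (E', C', D')" by (metis prod_cases3)
        have eq: "E = D' + 4 * n * C' + 4 * n\<^sup>2 * E'" "C = - (C' + 2 * n * E')" "D = E'"
          using 1(3) g Cons by auto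
        define m where "m = \<bar>n\<bar>"
        have m: "0 \<le> m" by (simp add: m_def)
        have "\<bar>E\<bar> \<le> \<bar>D'\<bar> + 4 * m * \<bar>C'\<bar> + 4 * m\<^sup>2 * \<bar>E'\<bar>"
          unfolding eq m_def using abs_triangle_ineq[of "D' + 4 * n * C'" "4 * n\<^sup>2 * E'"] abs_triangle_ineq[of D' "4 * n * C'"]
          by (simp add: abs_mult)
        moreover have "\<bar>C\<bar> \<le> \<bar>C'\<bar> + 2 * m * \<bar>E'\<bar>"
          unfolding eq m_def using abs_triangle_ineq[of C' "2 * n * E'"] by (simp add: abs_mult)
        moreover have "0 \<le> m * \<bar>C'\<bar>" "0 \<le> m\<^sup>2 * \<bar>C'\<bar>" "0 \<le> m * \<bar>D'\<bar>" "0 \<le> m\<^sup>2 * \<bar>D'\<bar>"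
          using m by simp_all
        ultimately have "\<bar>E\<bar> + 2 * \<bar>C\<bar> + \<bar>D\<bar> \<le> (2 * m + 1)\<^sup>2 * (\<bar>E'\<bar> + 2 * \<bar>C'\<bar> + \<bar>D'\<bar>)"
          unfolding eq(3) by (simp add: power2_eq_square algebra_simps)
        moreover have "\<bar>E'\<bar> + 2 * \<bar>C'\<bar> + \<bar>D'\<bar> \<le> 2 * (syl_prod ns')\<^sup>2" using 1 Cons g by auto
        ultimately show ?thesis unfolding Cons syl_prod_Cons_big[OF True]
          by (rule combine) (use True in \<open>auto simp: m_def\<close>)
      next
        case False
        then obtain k rest where r: "n # ns' = replicate (Suc k) n @ rest" "rest = [] \<or> hd rest \<noteq> n"
            "syl_degs (n # ns') = Suc k # syl_degs rest" "length rest < length (n # ns')"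
          using syl_degs_run_split[of n ns'] by auto
        define d where "d = int (Suc k)"
        have d: "1 \<le> d" by (simp add: d_def)
        have n1: "n = 1 \<or> n = -1" using False n0 by auto
        have sp: "syl_prod ns = (4 * d - 1) * syl_prod rest" unfolding Cons syl_prod_def r(3) by (simp add: d_def)
        obtain E' C' D' where g: "word_geod rest = (E', C', D')" by (metis prod_cases3)
        have eq: "E = (d + 1)\<^sup>2 * E' + 2 * d * (d + 1) * (n * C') + d\<^sup>2 * D'"
          "C = - n * (d * (d + 1) * E' + (2 * d\<^sup>2 - 1) * (n * C') + d * (d - 1) * D')"
          "D = d\<^sup>2 * E' + 2 * d * (d - 1) * (n * C') + (d - 1)\<^sup>2 * D'"
          using word_geod_run[OF n1 g, of "Suc k"] 1(3) unfolding Cons r(1) d_def[symmetric] by (auto simp: mult.assoc)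
        have nC: "\<bar>n * C'\<bar> = \<bar>C'\<bar>" "\<bar>n\<bar> = 1" using n1 by auto
        have d2: "0 \<le> 2 * d\<^sup>2 - 1" using one_le_power[OF d, of 2] by linarith
        have tri: "\<bar>x * u + y * v + z * w\<bar> \<le> x * \<bar>u\<bar> + y * \<bar>v\<bar> + z * \<bar>w\<bar>" if "0 \<le> x" "0 \<le> y" "0 \<le> z" for x y z u v w :: int
          using that abs_triangle_ineq[of "x * u + y * v" "z * w"] abs_triangle_ineq[of "x * u" "y * v"] by (simp add: abs_mult)
        have "\<bar>E\<bar> \<le> (d + 1)\<^sup>2 * \<bar>E'\<bar> + 2 * d * (d + 1) * \<bar>C'\<bar> + d\<^sup>2 * \<bar>D'\<bar>"
          unfolding eq nC(1)[symmetric] using d by (intro tri) auto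
        moreover have "\<bar>C\<bar> = \<bar>d * (d + 1) * E' + (2 * d\<^sup>2 - 1) * (n * C') + d * (d - 1) * D'\<bar>"
          unfolding eq abs_mult using n1 by auto
        then have "\<bar>C\<bar> \<le> d * (d + 1) * \<bar>E'\<bar> + (2 * d\<^sup>2 - 1) * \<bar>C'\<bar> + d * (d - 1) * \<bar>D'\<bar>"
          unfolding nC(1)[symmetric] using d d2 by (simp only:) (intro tri, auto)
        moreover have "\<bar>D\<bar> \<le> d\<^sup>2 * \<bar>E'\<bar> + 2 * d * (d - 1) * \<bar>C'\<bar> + (d - 1)\<^sup>2 * \<bar>D'\<bar>"
          unfolding eq nC(1)[symmetric] using d by (intro tri) auto
        moreover have "0 \<le> d * \<bar>C'\<bar>" "0 \<le> d * \<bar>D'\<bar>" "0 \<le> \<bar>C'\<bar>" using d by simp_all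
        moreover have "x + 2 * y + z \<le> (2 * d + 1)\<^sup>2 * (e + 2 * c + f)"
          if "x \<le> (d + 1)\<^sup>2 * e + 2 * d * (d + 1) * c + d\<^sup>2 * f"
            "y \<le> d * (d + 1) * e + (2 * d\<^sup>2 - 1) * c + d * (d - 1) * f"
            "z \<le> d\<^sup>2 * e + 2 * d * (d - 1) * c + (d - 1)\<^sup>2 * f" "0 \<le> d * c" "0 \<le> d * f" "0 \<le> c"
          for x y z e c f :: int
          using that by (simp add: power2_eq_square algebra_simps)
        ultimately have "\<bar>E\<bar> + 2 * \<bar>C\<bar> + \<bar>D\<bar> \<le> (2 * d + 1)\<^sup>2 * (\<bar>E'\<bar> + 2 * \<bar>C'\<bar> + \<bar>D'\<bar>)"
          by blast
        moreover have "\<bar>E'\<bar> + 2 * \<bar>C'\<bar> + \<bar>D'\<bar> \<le> 2 * (syl_prod rest)\<^sup>2"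
          using 1(1)[rule_format, of rest] 1(2) r g Cons by (metis Un_iff set_append)
        ultimately show ?thesis unfolding sp by (rule combine) (use d in auto)
      qed
    qed
  qed
  then show ?thesis by linarith
qed

section \<open>Lifting loops\<close>

lemma lam_i: "lam \<i> = 1 / 2"
proof -
  have "lam (- 1 / \<i>) = 1 - lam \<i>" by (rule lam_neg_inverse) (simp add: uhp_def)
  moreover have "- 1 / \<i> = \<i>" by simp
  ultimately have "lam \<i> = 1 - lam \<i>" by simp
  then show ?thesis by (simp add: complex_eq_iff)
qed

lemma tau_half: "tau (1 / 2) = \<i>"
  using tau_lam[of \<i>] imag_axis_Wset[of 1] by (simp add: lam_i)

lemma half_slit: "1 / 2 \<in> slit"
  by (simp add: slit_def)

lemma i_cover_dom: "\<i> \<in> cover_dom"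
  using cover_domI[OF deck_maps_id, of slit tau "1/2"] half_slit by (simp add: sections_def tau_half)

lemma cover_i: "cover \<i> = 0"
  by (simp add: cover_def lam_i)

text \<open>The monodromy of a loop at 0, with \<open>\<i>\<close> as base point of the covering.
  Only \<open>M \<i>\<close> enters, so the deck map may be rewritten by any identity valid at that
  point.\<close>

definition loop_lift :: "(real \<Rightarrow> complex) \<Rightarrow> (complex \<Rightarrow> complex) \<Rightarrow> bool" where
  "loop_lift \<gamma> M \<longleftrightarrow> (\<exists>p. path p \<and> path_image p \<subseteq> cover_dom \<and> pathstart p = \<i> \<and> pathfinish p = M \<i> \<and>
     (\<forall>t\<in>{0..1}. cover (p t) = \<gamma> t))"

lemma loop_lift_const: "loop_lift (\<lambda>t. 0) (\<lambda>t. t)"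
  unfolding loop_lift_def
  by (rule exI[of _ "\<lambda>_. \<i>"]) (auto simp: path_def path_image_def pathstart_def pathfinish_def i_cover_dom cover_i)

lemma path_deck:
  assumes "M \<in> deck_maps" "path p" "path_image p \<subseteq> cover_dom"
  shows "path (M \<circ> p)" "path_image (M \<circ> p) \<subseteq> cover_dom"
proof -
  have "continuous_on (path_image p) M"
    using holomorphic_on_imp_continuous_on[OF deck_mapsD(1)[OF assms(1)]] assms(3) cover_dom_uhp
      continuous_on_subset by blast
  then show "path (M \<circ> p)" using assms(2) by (intro path_continuous_image)
  show "path_image (M \<circ> p) \<subseteq> cover_dom"
    using assms(3) cover_dom_deck[OF assms(1)] by (auto simp: path_image_compose)
qed

text \<open>The lift of the second loop starts at \<open>\<i>\<close>, and \<open>M\<close> carries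
  it to the end of the first lift. Concatenation therefore becomes composition in the same
  order.\<close>

lemma loop_lift_join:
  assumes "loop_lift \<gamma> M" "loop_lift \<delta> N" "M \<in> deck_maps"
  shows "loop_lift (\<gamma> +++ \<delta>) (\<lambda>t. M (N t))"
proof -
  obtain p where p: "path p" "path_image p \<subseteq> cover_dom" "pathstart p = \<i>" "pathfinish p = M \<i>"
     "\<forall>t\<in>{0..1}. cover (p t) = \<gamma> t" using assms(1) unfolding loop_lift_def by blast
  obtain q where q: "path q" "path_image q \<subseteq> cover_dom" "pathstart q = \<i>" "pathfinish q = N \<i>"
     "\<forall>t\<in>{0..1}. cover (q t) = \<delta> t" using assms(2) unfolding loop_lift_def by blast
  have j: "pathfinish p = pathstart (M \<circ> q)" by (simp add: p pathstart_compose q)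
  have qu: "q t \<in> uhp" if "t \<in> {0..1}" for t using q(2) cover_dom_uhp that unfolding path_image_def by blast
  show ?thesis unfolding loop_lift_def
  proof (intro exI[of _ "p +++ (M \<circ> q)"] conjI ballI)
    show "path (p +++ (M \<circ> q))" using p(1) path_deck(1)[OF assms(3) q(1,2)] j by (rule path_join_imp)
    show "path_image (p +++ (M \<circ> q)) \<subseteq> cover_dom"
      by (rule subset_path_image_join[OF p(2) path_deck(2)[OF assms(3) q(1,2)]])
    show "pathstart (p +++ (M \<circ> q)) = \<i>" by (simp add: p)
    show "pathfinish (p +++ (M \<circ> q)) = M (N \<i>)" by (simp add: pathfinish_compose q)
    fix t :: real assume t: "t \<in> {0..1}"
    show "cover ((p +++ (M \<circ> q)) t) = (\<gamma> +++ \<delta>) t"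
      using p(5) q(5) t cover_deck[OF assms(3) qu, of "2 * t - 1"] by (auto simp: joinpaths_def)
  qed
qed

lemma loop_lift_reverse:
  assumes "loop_lift \<gamma> M" "M' \<in> deck_maps" "M' (M \<i>) = \<i>"
  shows "loop_lift (reversepath \<gamma>) M'"
proof -
  obtain p where p: "path p" "path_image p \<subseteq> cover_dom" "pathstart p = \<i>" "pathfinish p = M \<i>"
     "\<forall>t\<in>{0..1}. cover (p t) = \<gamma> t" using assms(1) unfolding loop_lift_def by blast
  have r: "path (reversepath p)" "path_image (reversepath p) \<subseteq> cover_dom" using p by auto
  have pu: "p t \<in> uhp" if "t \<in> {0..1}" for t using p(2) cover_dom_uhp that unfolding path_image_def by blast
  show ?thesis unfolding loop_lift_def
  proof (intro exI[of _ "M' \<circ> reversepath p"] conjI ballI)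
    show "path (M' \<circ> reversepath p)" "path_image (M' \<circ> reversepath p) \<subseteq> cover_dom"
      using path_deck[OF assms(2) r] by auto
    show "pathstart (M' \<circ> reversepath p) = \<i>" "pathfinish (M' \<circ> reversepath p) = M' \<i>"
      by (auto simp: pathstart_compose pathfinish_compose p assms)
    fix t :: real assume t: "t \<in> {0..1}"
    then show "cover ((M' \<circ> reversepath p) t) = reversepath \<gamma> t"
      using p(5) cover_deck[OF assms(2) pu, of "1 - t"] by (auto simp: reversepath_def)
  qed
qed

lemma loop_lift_three:
  fixes f1 f2 f3 \<gamma> :: "real \<Rightarrow> complex"
  assumes c: "continuous_on {0..1/4} f1" "continuous_on {1/4..3/4} f2" "continuous_on {3/4..1} f3"
    and agree: "f1 (1/4) = f2 (1/4)" "f2 (3/4) = f3 (3/4)"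
    and lift: "\<And>t. t \<in> {0..1/4} \<Longrightarrow> f1 t \<in> cover_dom \<and> cover (f1 t) = \<gamma> t"
      "\<And>t. t \<in> {1/4..3/4} \<Longrightarrow> f2 t \<in> cover_dom \<and> cover (f2 t) = \<gamma> t"
      "\<And>t. t \<in> {3/4..1} \<Longrightarrow> f3 t \<in> cover_dom \<and> cover (f3 t) = \<gamma> t"
    and ends: "f1 0 = \<i>" "f3 1 = M \<i>"
  shows "loop_lift \<gamma> M"
proof -
  define p where "p = (\<lambda>t. if t \<le> 1/4 then f1 t else if t \<le> 3/4 then f2 t else f3 t)"
  have glue: "continuous_on ({a..b} \<union> {b..c}) (\<lambda>t. if t \<le> b then f t else g t)"
    if "continuous_on {a..b} f" "continuous_on {b..c} g" "f b = g b" for a b c :: real and f g :: "real \<Rightarrow> complex"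
    using that by (intro continuous_on_cases) (auto dest: order_antisym)
  have "continuous_on ({1/4..3/4} \<union> {3/4..1}) (\<lambda>t. if t \<le> 3/4 then f2 t else f3 t)"
    using c agree by (intro glue)
  also have "{1/4..3/4} \<union> {3/4..1} = {1/4..1::real}" by auto
  finally have "continuous_on ({0..1/4} \<union> {1/4..1}) p"
    unfolding p_def using c agree by (intro glue) auto
  also have "{0..1/4} \<union> {1/4..1} = {0..1::real}" by auto
  finally have "path p" by (simp add: path_def)
  moreover have pl: "p t \<in> cover_dom \<and> cover (p t) = \<gamma> t" if "t \<in> {0..1}" for t
    using that lift by (auto simp: p_def)
  moreover have "path_image p \<subseteq> cover_dom" using pl by (auto simp: path_image_def)
  moreover have "pathstart p = \<i>" "pathfinish p = M \<i>"
    by (simp_all add: pathstart_def pathfinish_def p_def ends)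
  ultimately show ?thesis unfolding loop_lift_def by blast
qed

lemma trig_quarters:
  fixes t :: real
  shows "t \<in> {0..1/4} \<union> {3/4..1} \<Longrightarrow> 0 \<le> cos (2 * pi * t)" "t \<in> {1/4..3/4} \<Longrightarrow> cos (2 * pi * t) \<le> 0"
proof -
  have m: "2 * pi * t \<le> 2 * pi * u \<longleftrightarrow> t \<le> u" for t u by simp
  assume t: "t \<in> {0..1/4} \<union> {3/4..1}"
  show "0 \<le> cos (2 * pi * t)"
  proof (cases "t \<le> 1/4")
    case True
    then have "2 * pi * 0 \<le> 2 * pi * t" "2 * pi * t \<le> 2 * pi * (1/4)" using t unfolding m by auto
    then show ?thesis using pi_gt_zero by (intro cos_ge_zero) linarith+
  next
    case False
    then have "3/4 \<le> t" "t \<le> 1" using t by auto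
    then have "2 * pi * (3/4) \<le> 2 * pi * t" "2 * pi * t \<le> 2 * pi * 1" unfolding m by auto
    then have "0 \<le> cos (2 * pi * t - 2 * pi)" using pi_gt_zero by (intro cos_ge_zero) linarith+
    then show ?thesis by (simp add: cos_diff)
  qed
next
  have m: "2 * pi * t \<le> 2 * pi * u \<longleftrightarrow> t \<le> u" for t u by simp
  assume "t \<in> {1/4..3/4}"
  then have "2 * pi * (1/4) \<le> 2 * pi * t" "2 * pi * t \<le> 2 * pi * (3/4)" unfolding m by auto
  then have "0 \<le> cos (2 * pi * t - pi)" using pi_gt_zero by (intro cos_ge_zero) linarith+
  then show "cos (2 * pi * t) \<le> 0" by (simp add: cos_diff)
qed

section \<open>Monodromy of the two generators\<close>

definition circ :: "real \<Rightarrow> complex" where "circ t = cis (2 * pi * t) / 2"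

lemma circ_ReIm: "Re (circ t) = cos (2 * pi * t) / 2" "Im (circ t) = sin (2 * pi * t) / 2"
  by (auto simp: circ_def)

lemma continuous_circ: "continuous_on S circ"
  unfolding circ_def[abs_def] by (intro continuous_intros) auto

text \<open>A real point of the circle is 1 / 2 or -1 / 2, and the sign of the cosine tells
  which.\<close>

lemma circ_slit:
  "t \<in> {0..1/4} \<union> {3/4..1} \<Longrightarrow> circ t \<in> slit" "t \<in> {1/4..3/4} \<Longrightarrow> circ t \<in> slit2"
proof -
  have *: "sin (2 * pi * t) = 0 \<Longrightarrow> (cos (2 * pi * t))\<^sup>2 = 1"
    by (metis cos_squared_eq diff_zero zero_power2)
  show "t \<in> {0..1/4} \<union> {3/4..1} \<Longrightarrow> circ t \<in> slit" "t \<in> {1/4..3/4} \<Longrightarrow> circ t \<in> slit2"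
    using * trig_quarters[of t] unfolding slit_def slit2_def mem_Collect_eq circ_ReIm
    by (auto simp: power2_eq_1_iff)
qed

lemma circ_points: "circ 0 = 1/2" "circ 1 = 1/2" "0 < Im (circ (1/4))" "Im (circ (3/4)) < 0"
proof -
  have "sin (2 * pi * (3/4)) = - 1"
  proof -
    have "2 * pi * (3/4) = pi / 2 + pi" by simp
    then show ?thesis by (simp only: sin_periodic_pi) simp
  qed
  then show "Im (circ (3/4)) < 0" by (simp add: circ_ReIm)
qed (auto simp: circ_def cis.ctr complex_eq_iff)

lemma gen_loop_circ: "(1 + gen_loop A1 t) / 2 = circ t" "(1 + gen_loop A2 t) / 2 = 1 - circ t"
  by (auto simp: circ_def cis_conv_exp mult_ac add_divide_distrib diff_divide_distrib)

lemma continuous_on_circ_compose: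
  assumes "f holomorphic_on U" "\<And>t. t \<in> S \<Longrightarrow> g (circ t) \<in> U" "continuous_on UNIV g"
  shows "continuous_on S (\<lambda>t. f (g (circ t)))"
proof -
  have "continuous_on S (\<lambda>t. g (circ t))"
    by (rule continuous_on_compose2[OF assms(3) continuous_circ]) auto
  then show ?thesis
    by (rule continuous_on_compose2[OF holomorphic_on_imp_continuous_on[OF assms(1)]]) (use assms(2) in auto)
qed

lemma section_lift:
  assumes "(U, s) \<in> sections" "(1 + x) / 2 \<in> U" "M \<in> deck_maps"
  shows "M (s ((1 + x) / 2)) \<in> cover_dom \<and> cover (M (s ((1 + x) / 2))) = x"
  using cover_domI[OF assms(3,1,2)] deck_section(3)[OF assms(3,1,2)] cover_eqI by blast

lemma sections_mem: "(slit, tau) \<in> sections" "(slit2, sig2) \<in> sections" "(slit3, sig3) \<in> sections"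
  by (auto simp: sections_def)

text \<open>In the coordinate of \<open>lam\<close> the loop is the circle of radius 1 / 2 around 0.
  It leaves \<open>slit\<close> at -1 / 2, so its middle half is lifted by \<open>sig2\<close>; the
  change of branch happens at the quarter points, above the real axis where \<open>sig2\<close> is
  \<open>tau\<close> and below it where \<open>sig2\<close> is \<open>tau\<close> shifted by
  2.\<close>

lemma loop_lift_A1: "loop_lift (gen_loop A1) (deckA 1)"
proof (rule loop_lift_three[where ?f1.0 = "\<lambda>t. tau (circ t)" and ?f2.0 = "\<lambda>t. sig2 (circ t)" and ?f3.0 = "\<lambda>t. deckA 1 (tau (circ t))"])
  have dA: "(\<lambda>z. deckA 1 (tau z)) holomorphic_on slit" by (rule deck_section(1)[OF deckA_in sections_mem(1)])
  show "continuous_on {0..1/4} (\<lambda>t. tau (circ t))"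
    by (rule continuous_on_circ_compose[OF holomorphic_tau, of _ "\<lambda>z. z"]) (auto intro: circ_slit)
  show "continuous_on {1/4..3/4} (\<lambda>t. sig2 (circ t))"
    by (rule continuous_on_circ_compose[OF holomorphic_sig2, of _ "\<lambda>z. z"]) (auto intro: circ_slit)
  show "continuous_on {3/4..1} (\<lambda>t. deckA 1 (tau (circ t)))"
    by (rule continuous_on_circ_compose[OF dA, of _ "\<lambda>z. z"]) (auto intro: circ_slit)
  show "tau (circ (1/4)) = sig2 (circ (1/4))" using sig2_upper circ_points by simp
  show "sig2 (circ (3/4)) = deckA 1 (tau (circ (3/4)))" using sig2_lower circ_points by (simp add: deckA_def)
  show "tau (circ 0) = \<i>" "deckA 1 (tau (circ 1)) = deckA 1 \<i>" by (simp_all add: circ_points tau_half)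
next
  fix t :: real
  show "t \<in> {0..1/4} \<Longrightarrow> tau (circ t) \<in> cover_dom \<and> cover (tau (circ t)) = gen_loop A1 t"
    unfolding gen_loop_circ(1)[symmetric]
    by (rule section_lift[OF sections_mem(1) _ deck_maps_id]) (auto simp: gen_loop_circ simp del: gen_loop.simps intro: circ_slit)
  show "t \<in> {1/4..3/4} \<Longrightarrow> sig2 (circ t) \<in> cover_dom \<and> cover (sig2 (circ t)) = gen_loop A1 t"
    unfolding gen_loop_circ(1)[symmetric]
    by (rule section_lift[OF sections_mem(2) _ deck_maps_id]) (auto simp: gen_loop_circ simp del: gen_loop.simps intro: circ_slit)
  show "t \<in> {3/4..1} \<Longrightarrow> deckA 1 (tau (circ t)) \<in> cover_dom \<and> cover (deckA 1 (tau (circ t))) = gen_loop A1 t"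
    unfolding gen_loop_circ(1)[symmetric]
    by (rule section_lift[OF sections_mem(1) _ deckA_in]) (auto simp: gen_loop_circ simp del: gen_loop.simps intro: circ_slit)
qed

lemma one_minus_slit2: "z \<in> slit2 \<Longrightarrow> 1 - z \<in> slit3"
  by (auto simp: slit2_def slit3_def)

lemma loop_lift_A2: "loop_lift (gen_loop A2) (deckB 1)"
proof (rule loop_lift_three[where ?f1.0 = "\<lambda>t. tau (1 - circ t)" and ?f2.0 = "\<lambda>t. sig3 (1 - circ t)" and ?f3.0 = "\<lambda>t. deckB 1 (tau (1 - circ t))"])
  have dB: "(\<lambda>z. deckB 1 (tau z)) holomorphic_on slit" by (rule deck_section(1)[OF deckB_in sections_mem(1)])
  have c: "continuous_on UNIV (\<lambda>z::complex. 1 - z)" by (intro continuous_intros)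
  show "continuous_on {0..1/4} (\<lambda>t. tau (1 - circ t))"
    by (rule continuous_on_circ_compose[OF holomorphic_tau _ c]) (auto intro!: circ_slit one_minus_slit)
  show "continuous_on {1/4..3/4} (\<lambda>t. sig3 (1 - circ t))"
    by (rule continuous_on_circ_compose[OF holomorphic_sig3 _ c]) (auto intro!: circ_slit one_minus_slit2)
  show "continuous_on {3/4..1} (\<lambda>t. deckB 1 (tau (1 - circ t)))"
    by (rule continuous_on_circ_compose[OF dB _ c]) (auto intro!: circ_slit one_minus_slit)
  show "tau (1 - circ (1/4)) = sig3 (1 - circ (1/4))" using sig3_lower circ_points by simp
  show "sig3 (1 - circ (3/4)) = deckB 1 (tau (1 - circ (3/4)))" using sig3_upper circ_points by (simp add: deckB_def)
  show "tau (1 - circ 0) = \<i>" "deckB 1 (tau (1 - circ 1)) = deckB 1 \<i>" by (simp_all add: circ_points tau_half)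
next
  fix t :: real
  show "t \<in> {0..1/4} \<Longrightarrow> tau (1 - circ t) \<in> cover_dom \<and> cover (tau (1 - circ t)) = gen_loop A2 t"
    unfolding gen_loop_circ(2)[symmetric]
    by (rule section_lift[OF sections_mem(1) _ deck_maps_id]) (auto simp: gen_loop_circ simp del: gen_loop.simps intro!: circ_slit one_minus_slit)
  show "t \<in> {1/4..3/4} \<Longrightarrow> sig3 (1 - circ t) \<in> cover_dom \<and> cover (sig3 (1 - circ t)) = gen_loop A2 t"
    unfolding gen_loop_circ(2)[symmetric]
    by (rule section_lift[OF sections_mem(3) _ deck_maps_id]) (auto simp: gen_loop_circ simp del: gen_loop.simps intro!: circ_slit one_minus_slit2)
  show "t \<in> {3/4..1} \<Longrightarrow> deckB 1 (tau (1 - circ t)) \<in> cover_dom \<and> cover (deckB 1 (tau (1 - circ t))) = gen_loop A2 t"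
    unfolding gen_loop_circ(2)[symmetric]
    by (rule section_lift[OF sections_mem(1) _ deckB_in]) (auto simp: gen_loop_circ simp del: gen_loop.simps intro!: circ_slit one_minus_slit)
qed

section \<open>Monodromy of words and of their inverses\<close>

fun deck_gen :: "gen \<Rightarrow> int \<Rightarrow> complex \<Rightarrow> complex" where
  "deck_gen A1 n = deckA n"
| "deck_gen A2 n = deckB n"

lemma deck_gen_in: "deck_gen g n \<in> deck_maps"
  by (cases g) (auto intro: deckA_in deckB_in)

lemma deck_gen_add: "t \<in> uhp \<Longrightarrow> deck_gen g m (deck_gen g n t) = deck_gen g (m + n) t"
proof (cases g)
  case A2
  assume t: "t \<in> uhp"
  have "- 1 / t \<in> uhp" by (rule uhp_neg_inverse[OF t])
  then have "deckA n (- 1 / t) \<noteq> 0" using deck_mapsD(2)[OF deckA_in, of "- 1 / t" n] by (auto simp: uhp_def)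
  then have "deckB m (deckB n t) = - 1 / deckA m (deckA n (- 1 / t))"
    unfolding deckB_conj[OF deck_mapsD(2)[OF deckB_in t]] by (simp add: deckB_conj[OF t])
  then show ?thesis using A2 t by (simp add: deckB_conj deckA_def algebra_simps)
qed (simp add: deckA_def algebra_simps)

lemma deck_gen_0: "deck_gen g 0 t = t"
  by (cases g) (auto simp: deckA_def deckB_def)

lemma i_uhp: "\<i> \<in> uhp" by (simp add: uhp_def)

lemma loop_lift_eq: "loop_lift \<gamma> M \<Longrightarrow> M \<i> = N \<i> \<Longrightarrow> loop_lift \<gamma> N"
  by (auto simp: loop_lift_def)

lemma loop_lift_nat_pow:
  assumes "loop_lift \<gamma> (deck_gen g k)"
  shows "loop_lift (nat_pow_path \<gamma> n) (deck_gen g (k * int n))"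
proof (induction n)
  case 0
  then show ?case using loop_lift_eq[OF loop_lift_const] by (simp add: deck_gen_0)
next
  case (Suc n)
  then show ?case
    using loop_lift_eq[OF loop_lift_join[OF assms Suc deck_gen_in], of "deck_gen g (k * int (Suc n))"]
    by (simp add: deck_gen_add i_uhp algebra_simps)
qed

lemma loop_lift_int_pow: "loop_lift (int_pow_path (gen_loop g) n) (deck_gen g n)"
proof -
  have g: "loop_lift (gen_loop g) (deck_gen g 1)" using loop_lift_A1 loop_lift_A2 by (cases g) auto
  have "loop_lift (reversepath (gen_loop g)) (deck_gen g (-1))"
    by (rule loop_lift_reverse[OF g deck_gen_in]) (simp add: deck_gen_add i_uhp deck_gen_0)
  from loop_lift_nat_pow[OF this, of "nat (- n)"] loop_lift_nat_pow[OF g, of "nat n"]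
  show ?thesis by (auto simp: int_pow_path_def)
qed

fun deck_word :: "(gen \<times> int) list \<Rightarrow> complex \<Rightarrow> complex" where
  "deck_word [] t = t"
| "deck_word ((g, n) # ws) t = deck_gen g n (deck_word ws t)"

lemma deck_word_in: "deck_word w \<in> deck_maps"
proof (induction w)
  case Nil
  have "deck_word [] = (\<lambda>t. t)" by auto
  then show ?case using deck_maps_id by simp
next
  case (Cons x w)
  have "deck_word (x # w) = (\<lambda>t. deck_gen (fst x) (snd x) (deck_word w t))" by (cases x) auto
  then show ?case using deck_maps_compose[OF deck_gen_in Cons] by simp
qed

lemma loop_lift_word: "loop_lift (word_loop w) (deck_word w)"
proof (induction w)
  case Nil
  then show ?case using loop_lift_eq[OF loop_lift_const] by simp
next
  case (Cons x w)
  then show ?case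
    using loop_lift_eq[OF loop_lift_join[OF loop_lift_int_pow Cons deck_gen_in]] by (cases x) simp
qed

definition inv_word :: "(gen \<times> int) list \<Rightarrow> (gen \<times> int) list" where
  "inv_word w = rev (map (\<lambda>(g, n). (g, - n)) w)"

lemma deck_word_append: "deck_word (u @ v) t = deck_word u (deck_word v t)"
  by (induction u) auto

lemma deck_word_inv: "t \<in> uhp \<Longrightarrow> deck_word (inv_word w) (deck_word w t) = t"
proof (induction w)
  case (Cons x w)
  then show ?case
    using deck_mapsD(2)[OF deck_word_in, of t w]
    by (cases x) (simp add: inv_word_def deck_word_append deck_gen_add deck_gen_0)
qed (simp add: inv_word_def)

lemma inv_word_inv: "inv_word (inv_word w) = w"
  by (simp add: inv_word_def rev_map[symmetric] o_def case_prod_unfold)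

section \<open>Two geodesics in the upper half plane\<close>

lemma linepath_integral_Re_bounds:
  assumes "(f has_contour_integral I) (linepath p q)"
    and "\<And>z. z \<in> closed_segment p q \<Longrightarrow> lo \<le> Re (f z * (q - p)) \<and> Re (f z * (q - p)) \<le> hi"
  shows "lo \<le> Re I" "Re I \<le> hi"
proof -
  have "((\<lambda>x. f (linepath p q x) * (q - p)) has_integral I) {0..1}"
    using assms(1) by (simp add: has_contour_integral_linepath)
  from has_integral_linear[OF this bounded_linear_Re]
  have hi: "((\<lambda>x. Re (f (linepath p q x) * (q - p))) has_integral Re I) {0..1}" by (simp add: o_def)
  have b: "lo \<le> Re (f (linepath p q x) * (q - p)) \<and> Re (f (linepath p q x) * (q - p)) \<le> hi" if "x \<in> {0..1}" for x
    using that assms(2) linepath_in_path by blast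
  have c: "((\<lambda>x::real. k) has_integral k) {0..1}" for k :: real
    using has_integral_const_real[of k 0 1] by simp
  show "lo \<le> Re I" using has_integral_le[OF c hi] b by blast
  show "Re I \<le> hi" using has_integral_le[OF hi c] b by blast
qed

text \<open>Cauchy's theorem does the work of a length-area estimate. In the real part of the
  integral of \<open>u\<close> the horizontal sides contribute \<open>k0\<close> and
  \<open>- k1\<close> times the width, and the vertical sides contribute integrals of
  \<open>Im u\<close>, each between 0 and \<open>pi\<close> times the height in absolute value.
  These two have opposite signs, so together they stay within \<open>pi\<close> times the
  height.\<close>

lemma rectangle_modulus_bound:
  fixes u :: "complex \<Rightarrow> complex"
  assumes ab: "Re a < Re b" "Im a < Im b"
    and u: "continuous_on (cbox a b) u" "u holomorphic_on box a b"
    and strip: "\<And>z. z \<in> cbox a b \<Longrightarrow> 0 \<le> Im (u z) \<and> Im (u z) \<le> pi"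
    and bottom: "\<And>z. z \<in> cbox a b \<Longrightarrow> Im z = Im a \<Longrightarrow> Re (u z) = k0"
    and top: "\<And>z. z \<in> cbox a b \<Longrightarrow> Im z = Im b \<Longrightarrow> Re (u z) = k1"
  shows "\<bar>k1 - k0\<bar> * (Re b - Re a) \<le> pi * (Im b - Im a)"
proof -
  define c d where "c = Complex (Re b) (Im a)" and "d = Complex (Re a) (Im b)"
  let ?L = "Re b - Re a" and ?H = "Im b - Im a"
  have mem: "a \<in> cbox a b" "b \<in> cbox a b" "c \<in> cbox a b" "d \<in> cbox a b"
    using ab by (auto simp: in_cbox_complex_iff c_def d_def)
  have seg: "closed_segment p q \<subseteq> cbox a b" if "p \<in> cbox a b" "q \<in> cbox a b" for p q
    using that by (simp add: closed_segment_subset)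
  let ?g = "linepath a c +++ linepath c b +++ linepath b d +++ linepath d a"
  have "(u has_contour_integral 0) ?g"
  proof (rule Cauchy_theorem_convex[OF u(1) convex_box(1) finite.emptyI])
    show "u field_differentiable at x" if "x \<in> interior (cbox a b) - {}" for x
      using that holomorphic_on_imp_differentiable_at[OF u(2) open_box] by (simp add: interior_cbox)
    show "path_image ?g \<subseteq> cbox a b"
      using seg mem by (intro subset_path_image_join) auto
  qed auto
  moreover have int: "u contour_integrable_on linepath p q" if "p \<in> cbox a b" "q \<in> cbox a b" for p q
    by (rule contour_integrable_continuous_linepath) (rule continuous_on_subset[OF u(1) seg[OF that]])
  then obtain I1 I2 I3 I4 where I: "(u has_contour_integral I1) (linepath a c)" "(u has_contour_integral I2) (linepath c b)"
    "(u has_contour_integral I3) (linepath b d)" "(u has_contour_integral I4) (linepath d a)"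
    using mem unfolding contour_integrable_on_def by meson
  then have "(u has_contour_integral (I1 + (I2 + (I3 + I4)))) ?g"
    by (intro has_contour_integral_join) (auto intro: valid_path_join)
  ultimately have sum: "I1 + (I2 + (I3 + I4)) = 0" using has_contour_integral_unique by blast
  have imseg: "Im z = y" if z: "z \<in> closed_segment p q" "Im p = y" "Im q = y" for z p q y
  proof -
    obtain u where "z = (1 - u) *\<^sub>R p + u *\<^sub>R q" using z(1) by (auto simp: closed_segment_def)
    then have "Im z = (1 - u) * y + u * y" using z by simp
    then show ?thesis by (simp add: algebra_simps)
  qed
  have 1: "Re I1 = k0 * ?L"
  proof (rule antisym)
    have *: "Re (u z * (c - a)) = k0 * ?L" if z: "z \<in> closed_segment a c" for z
    proof -
      have "Re (u z) = k0" using bottom[of z] seg[OF mem(1,3)] z imseg[OF z] by (auto simp: c_def)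
      moreover have "c - a = of_real ?L" by (simp add: c_def complex_eq_iff)
      ultimately show ?thesis by simp
    qed
    show "Re I1 \<le> k0 * ?L" "k0 * ?L \<le> Re I1"
      using linepath_integral_Re_bounds[OF I(1), of "k0 * ?L" "k0 * ?L"] * by auto
  qed
  have 3: "Re I3 = - (k1 * ?L)"
  proof (rule antisym)
    have *: "Re (u z * (d - b)) = - (k1 * ?L)" if z: "z \<in> closed_segment b d" for z
    proof -
      have "Re (u z) = k1" using top[of z] seg[OF mem(2,4)] z imseg[OF z] by (auto simp: d_def)
      moreover have "d - b = of_real (- ?L)" by (simp add: d_def complex_eq_iff)
      ultimately have "Re (u z * (d - b)) = k1 * (- ?L)" by (simp only: Re_complex_of_real Im_complex_of_real times_complex.sel)
      also have "k1 * (- ?L) = - (k1 * ?L)" by (rule mult_minus_right)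
      finally show ?thesis .
    qed
    show "Re I3 \<le> - (k1 * ?L)" "- (k1 * ?L) \<le> Re I3"
      using linepath_integral_Re_bounds[OF I(3), of "- (k1 * ?L)" "- (k1 * ?L)"] * by auto
  qed
  have 2: "- (pi * ?H) \<le> Re I2" "Re I2 \<le> 0"
  proof -
    have *: "- (pi * ?H) \<le> Re (u z * (b - c)) \<and> Re (u z * (b - c)) \<le> 0" if z: "z \<in> closed_segment c b" for z
    proof -
      have s: "0 \<le> Im (u z) \<and> Im (u z) \<le> pi" using strip seg[OF mem(3,2)] z by blast
      have "b - c = \<i> * of_real ?H" by (simp add: c_def complex_eq_iff)
      then have "Re (u z * (b - c)) = - (Im (u z) * ?H)" by simp
      moreover have "0 \<le> Im (u z) * ?H" "Im (u z) * ?H \<le> pi * ?H"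
        using s ab by (auto intro: mult_right_mono)
      ultimately show ?thesis by simp
    qed
    show "- (pi * ?H) \<le> Re I2" "Re I2 \<le> 0" using linepath_integral_Re_bounds[OF I(2) *] by auto
  qed
  have 4: "0 \<le> Re I4" "Re I4 \<le> pi * ?H"
  proof -
    have *: "0 \<le> Re (u z * (a - d)) \<and> Re (u z * (a - d)) \<le> pi * ?H" if z: "z \<in> closed_segment d a" for z
    proof -
      have s: "0 \<le> Im (u z) \<and> Im (u z) \<le> pi" using strip seg[OF mem(4,1)] z by blast
      have "a - d = - (\<i> * of_real ?H)" by (simp add: d_def complex_eq_iff)
      then have "Re (u z * (a - d)) = Im (u z) * ?H" by simp
      moreover have "0 \<le> Im (u z) * ?H" "Im (u z) * ?H \<le> pi * ?H"
        using s ab by (auto intro: mult_right_mono)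
      ultimately show ?thesis by simp
    qed
    show "0 \<le> Re I4" "Re I4 \<le> pi * ?H" using linepath_integral_Re_bounds[OF I(4) *] by auto
  qed
  have "Re (I1 + (I2 + (I3 + I4))) = 0" using sum by simp
  then have "(k1 - k0) * ?L = Re I2 + Re I4" using 1 3 by (simp add: algebra_simps)
  then have "\<bar>(k1 - k0) * ?L\<bar> \<le> pi * ?H" using 2 4 by linarith
  then show ?thesis using ab by (simp add: abs_mult)
qed

definition on_geod :: "real \<Rightarrow> real \<Rightarrow> real \<Rightarrow> complex \<Rightarrow> bool" where
  "on_geod E C D t \<longleftrightarrow> E * (norm t)\<^sup>2 - 2 * C * Re t + D = 0"

text \<open>For \<open>C\<^sup>2 - E D = 1 < C\<^sup>2\<close> the geodesics \<^term>\<open>Re t = 0\<close> and \<^term>\<open>on_geod E C D t\<close> are disjoint,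
  and \<open>strip_coord\<close> straightens both: it maps the upper half plane conformally onto the strip
  \<open>0 < Im u < pi\<close> and turns the two geodesics into the vertical segments \<open>Re u = 0\<close> and
  \<open>Re u = height\<close>.\<close>
locale geod_pair =
  fixes E C D :: real
  assumes pos: "0 < E" "0 < D" and disc: "C\<^sup>2 - E * D = 1"
begin

text \<open>The points \<open>foot\<close> and \<open>- foot\<close> are the ends of the common
  perpendicular of the two geodesics. \<open>mob\<close> sends them to infinity and 0, so the
  geodesics become half circles around 0, of radii 1 and
  \<open>\<bar>C + root\<bar>\<close>.\<close>

definition foot :: real where "foot = sqrt (D / E)"
definition root :: real where "root = sqrt (C\<^sup>2 - 1)"
definition height :: real where "height = ln \<bar>C + root\<bar>"
definition mob :: "complex \<Rightarrow> complex" where "mob t = (of_real foot + t) / (of_real foot - t)"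
definition strip_coord :: "complex \<Rightarrow> complex" where "strip_coord t = Ln (mob t)"
definition strip_inv :: "complex \<Rightarrow> complex" where
  "strip_inv u = of_real foot * (exp u - 1) / (exp u + 1)"

lemma foot_pos: "0 < foot" and root_eq: "root = E * foot" and root_pos: "0 < root"
  and root_sq: "root\<^sup>2 = C\<^sup>2 - 1" and foot_sq: "E * foot\<^sup>2 = D"
proof -
  show f: "0 < foot" using pos by (simp add: foot_def)
  show fs: "E * foot\<^sup>2 = D" using pos by (simp add: foot_def)
  have C: "C\<^sup>2 - 1 = E * D" using disc by simp
  have "(E * foot)\<^sup>2 = E * (E * foot\<^sup>2)" by (simp add: power2_eq_square)
  then have "(E * foot)\<^sup>2 = C\<^sup>2 - 1" using fs C by simp
  then show r: "root = E * foot" using f pos unfolding root_def by (metis real_sqrt_unique less_imp_le mult_pos_pos)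
  show "0 < root" using r f pos by simp
  show "root\<^sup>2 = C\<^sup>2 - 1" using C pos unfolding root_def by simp
qed

lemma C_root: "(C + root) * (C - root) = 1" "C + root \<noteq> 0" "C - root \<noteq> 0"
proof -
  show *: "(C + root) * (C - root) = 1"
    using root_sq by (simp add: power2_eq_square algebra_simps)
  show "C + root \<noteq> 0" "C - root \<noteq> 0" using * by auto
qed

text \<open>\<open>C + root\<close> and \<open>C - root\<close> are inverse to each other, so the
  sign of \<open>C\<close> affects only the sign of \<open>height\<close>. Its absolute value is
  arcosh of \<open>\<bar>C\<bar>\<close>, the hyperbolic distance of the geodesics.\<close>

lemma abs_height: "\<bar>height\<bar> = ln (\<bar>C\<bar> + root)"
proof -
  have r: "root < \<bar>C\<bar>" by (rule power2_less_imp_less) (use root_sq in simp_all)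
  have C1: "1 < \<bar>C\<bar> + root"
  proof -
    have "1 < C\<^sup>2" using disc mult_pos_pos[OF pos] by linarith
    then have "1 < \<bar>C\<bar>" using power2_less_imp_less[of 1 "\<bar>C\<bar>"] by simp
    then show ?thesis using root_pos by simp
  qed
  show ?thesis
  proof (cases "0 \<le> C")
    case True
    then show ?thesis using C1 root_pos by (simp add: height_def)
  next
    case False
    then have "\<bar>C + root\<bar> = \<bar>C\<bar> - root" using r by simp
    moreover have "(\<bar>C\<bar> - root) * (\<bar>C\<bar> + root) = 1" using root_sq by (simp add: power2_eq_square algebra_simps)
    then have "\<bar>C\<bar> - root = inverse (\<bar>C\<bar> + root)" using C1 by (simp add: field_simps)
    ultimately show ?thesis using C1 by (simp add: height_def ln_inverse)
  qed
qed

lemma height_bounds: "ln \<bar>C\<bar> \<le> \<bar>height\<bar>" "\<bar>height\<bar> \<le> ln (2 * \<bar>C\<bar>)" "0 < \<bar>height\<bar>"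
proof -
  have "1 < C\<^sup>2" using disc mult_pos_pos[OF pos] by linarith
  then have C: "1 < \<bar>C\<bar>" using power2_less_imp_less[of 1 "\<bar>C\<bar>"] by simp
  have r: "root < \<bar>C\<bar>" by (rule power2_less_imp_less) (use root_sq in simp_all)
  show "ln \<bar>C\<bar> \<le> \<bar>height\<bar>" "\<bar>height\<bar> \<le> ln (2 * \<bar>C\<bar>)" "0 < \<bar>height\<bar>"
    unfolding abs_height using C r root_pos by auto
qed

lemma foot_minus_nonzero: "t \<in> uhp \<Longrightarrow> of_real foot - t \<noteq> 0"
  by (auto simp: uhp_def)

lemma mob_in_uhp:
  assumes "t \<in> uhp"
  shows "mob t \<in> uhp"
proof -
  have "Im (mob t) = 2 * foot * Im t / (norm (of_real foot - t))\<^sup>2"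
    unfolding mob_def complex_div_cnj[of "of_real foot + t"] by (simp add: algebra_simps)
  moreover have "0 < norm (of_real foot - t)" using foot_minus_nonzero[OF assms] by simp
  ultimately show ?thesis using assms foot_pos by (simp add: uhp_def)
qed

lemma strip_coord_strip:
  assumes "t \<in> uhp"
  shows "0 < Im (strip_coord t)" "Im (strip_coord t) < pi"
proof -
  have "0 < Im (mob t)" using mob_in_uhp[OF assms] by (simp add: uhp_def)
  moreover from this have "mob t \<noteq> 0" by auto
  ultimately show "0 < Im (strip_coord t)" "Im (strip_coord t) < pi"
    unfolding strip_coord_def using Im_Ln_pos_lt_imp[of "mob t"] Im_Ln_pos_lt[of "mob t"] by auto
qed

lemma holomorphic_strip_coord: "strip_coord holomorphic_on uhp"
proof -
  have "mob holomorphic_on uhp"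
    unfolding mob_def[abs_def] by (intro holomorphic_intros foot_minus_nonzero)
  moreover have "mob t \<notin> \<real>\<^sub>\<le>\<^sub>0" if "t \<in> uhp" for t
    using mob_in_uhp[OF that] by (auto simp: uhp_def complex_nonpos_Reals_iff)
  ultimately show ?thesis unfolding strip_coord_def[abs_def] by (intro holomorphic_intros)
qed

lemma exp_strip: "0 < Im u \<Longrightarrow> Im u < pi \<Longrightarrow> exp u \<in> uhp"
  by (simp add: uhp_def Im_exp sin_gt_zero)

lemma exp_plus_1_nonzero: "0 < Im u \<Longrightarrow> Im u < pi \<Longrightarrow> exp u + 1 \<noteq> 0"
  using exp_strip[of u] by (auto simp: uhp_def complex_eq_iff)

lemma strip_inv_in_uhp:
  assumes "0 < Im u" "Im u < pi"
  shows "strip_inv u \<in> uhp"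
proof -
  have "Im (strip_inv u) = 2 * foot * Im (exp u) / (norm (exp u + 1))\<^sup>2"
    unfolding strip_inv_def complex_div_cnj[of "of_real foot * _"] by (simp add: algebra_simps)
  moreover have "0 < norm (exp u + 1)" using exp_plus_1_nonzero[OF assms] by simp
  ultimately show ?thesis using exp_strip[OF assms] foot_pos by (simp add: uhp_def)
qed

lemma holomorphic_strip_inv: "strip_inv holomorphic_on {u. 0 < Im u \<and> Im u < pi}"
  unfolding strip_inv_def[abs_def] using exp_plus_1_nonzero by (intro holomorphic_intros) auto

lemma strip_inv_coord:
  assumes "t \<in> uhp"
  shows "strip_inv (strip_coord t) = t"
proof -
  have n: "mob t \<noteq> 0" "of_real foot - t \<noteq> 0"
    using mob_in_uhp[OF assms] foot_minus_nonzero[OF assms] by (auto simp: uhp_def)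
  have f: "of_real foot \<noteq> (0::complex)" using foot_pos by simp
  have "mob t - 1 = 2 * t / (of_real foot - t)" "mob t + 1 = 2 * of_real foot / (of_real foot - t)"
    using n(2) by (simp_all add: mob_def field_simps)
  then show ?thesis using n f by (simp add: strip_inv_def strip_coord_def)
qed

lemma mob_strip_inv:
  assumes "0 < Im u" "Im u < pi"
  shows "mob (strip_inv u) = exp u"
proof -
  have f: "of_real foot \<noteq> (0::complex)" using foot_pos by simp
  note n = exp_plus_1_nonzero[OF assms]
  have "of_real foot + strip_inv u = 2 * of_real foot * exp u / (exp u + 1)"
    "of_real foot - strip_inv u = 2 * of_real foot / (exp u + 1)"
    using n by (simp_all add: strip_inv_def field_simps)
  then show ?thesis using n f by (simp add: mob_def)
qed

lemma norm_mob_sq: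
  assumes "t \<in> uhp"
  shows "(norm (mob t))\<^sup>2 * ((norm t)\<^sup>2 + foot\<^sup>2 - 2 * foot * Re t) = (norm t)\<^sup>2 + foot\<^sup>2 + 2 * foot * Re t"
    "0 < (norm t)\<^sup>2 + foot\<^sup>2 - 2 * foot * Re t"
proof -
  have a: "(norm (of_real foot - t))\<^sup>2 = (norm t)\<^sup>2 + foot\<^sup>2 - 2 * foot * Re t"
    "(norm (of_real foot + t))\<^sup>2 = (norm t)\<^sup>2 + foot\<^sup>2 + 2 * foot * Re t"
    unfolding cmod_power2 by (simp_all add: power2_eq_square algebra_simps)
  have "0 < norm (of_real foot - t)" using foot_minus_nonzero[OF assms] by simp
  then show "(norm (mob t))\<^sup>2 * ((norm t)\<^sup>2 + foot\<^sup>2 - 2 * foot * Re t) = (norm t)\<^sup>2 + foot\<^sup>2 + 2 * foot * Re t"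
    "0 < (norm t)\<^sup>2 + foot\<^sup>2 - 2 * foot * Re t"
    unfolding a[symmetric] by (simp_all add: mob_def norm_divide power_divide)
qed

lemma norm_mob_axis_iff:
  assumes "t \<in> uhp"
  shows "norm (mob t) = 1 \<longleftrightarrow> Re t = 0"
proof -
  define X where "X = (norm t)\<^sup>2 + foot\<^sup>2"
  note n = norm_mob_sq[OF assms, folded X_def]
  have "norm (mob t) = 1 \<longleftrightarrow> (norm (mob t))\<^sup>2 = 1\<^sup>2"
    by (metis norm_ge_zero power2_eq_iff_nonneg zero_le_one)
  also have "\<dots> \<longleftrightarrow> (norm (mob t))\<^sup>2 * (X - 2 * foot * Re t) = 1\<^sup>2 * (X - 2 * foot * Re t)"
    using n(2) by simp
  also have "\<dots> \<longleftrightarrow> 4 * foot * Re t = 0" unfolding n(1) by simp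
  also have "\<dots> \<longleftrightarrow> Re t = 0" using foot_pos by simp
  finally show ?thesis .
qed

lemma norm_mob_geod_iff:
  assumes "t \<in> uhp"
  shows "norm (mob t) = \<bar>C + root\<bar> \<longleftrightarrow> on_geod E C D t"
proof -
  define X where "X = (norm t)\<^sup>2 + foot\<^sup>2"
  note n = norm_mob_sq[OF assms, folded X_def]
  have "norm (mob t) = \<bar>C + root\<bar> \<longleftrightarrow> (norm (mob t))\<^sup>2 = (C + root)\<^sup>2"
    by (metis abs_of_nonneg norm_ge_zero power2_eq_iff_nonneg power2_abs abs_ge_zero)
  also have "\<dots> \<longleftrightarrow> (norm (mob t))\<^sup>2 * (X - 2 * foot * Re t) = (C + root)\<^sup>2 * (X - 2 * foot * Re t)"
    using n(2) by simp
  \<comment> \<open>Multiplying by \<open>C - root\<close>, the inverse of \<open>C + root\<close>,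
    reduces the square to a first power.\<close>
  also have "\<dots> \<longleftrightarrow> (C - root) * (X + 2 * foot * Re t) = (C - root) * ((C + root)\<^sup>2 * (X - 2 * foot * Re t))"
    unfolding n(1) using C_root(3) by simp
  also have "(C - root) * ((C + root)\<^sup>2 * (X - 2 * foot * Re t)) = ((C + root) * (C - root)) * (C + root) * (X - 2 * foot * Re t)"
    by (simp add: power2_eq_square algebra_simps)
  also have "\<dots> = (C + root) * (X - 2 * foot * Re t)" by (simp add: C_root(1))
  also have "(C - root) * (X + 2 * foot * Re t) = (C + root) * (X - 2 * foot * Re t) \<longleftrightarrow> 2 * (2 * C * foot * Re t - root * X) = 0"
    by (simp add: algebra_simps)
  also have "2 * (2 * C * foot * Re t - root * X) = - 2 * foot * (E * X - 2 * C * Re t)"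
    unfolding root_eq by (simp add: algebra_simps)
  also have "\<dots> = 0 \<longleftrightarrow> E * X - 2 * C * Re t = 0" using foot_pos by simp
  also have "\<dots> \<longleftrightarrow> on_geod E C D t"
    unfolding on_geod_def X_def using foot_sq by (simp add: algebra_simps)
  finally show ?thesis .
qed

lemma Re_strip_coord: "t \<in> uhp \<Longrightarrow> Re (strip_coord t) = ln (norm (mob t))"
  using mob_in_uhp[of t] unfolding strip_coord_def by (intro Re_Ln) (auto simp: uhp_def)

lemma strip_coord_axis: "t \<in> uhp \<Longrightarrow> Re t = 0 \<Longrightarrow> Re (strip_coord t) = 0"
  using norm_mob_axis_iff[of t] Re_strip_coord[of t] by simp

lemma strip_coord_geod: "t \<in> uhp \<Longrightarrow> on_geod E C D t \<Longrightarrow> Re (strip_coord t) = height"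
  using norm_mob_geod_iff[of t] Re_strip_coord[of t] by (simp add: height_def)

lemma strip_inv_axis:
  assumes "0 < Im u" "Im u < pi" "Re u = 0"
  shows "Re (strip_inv u) = 0"
  using norm_mob_axis_iff[OF strip_inv_in_uhp[OF assms(1,2)]] assms by (simp add: mob_strip_inv)

lemma strip_inv_geod:
  assumes "0 < Im u" "Im u < pi" "Re u = height"
  shows "on_geod E C D (strip_inv u)"
  using norm_mob_geod_iff[OF strip_inv_in_uhp[OF assms(1,2)]] assms C_root(2) by (simp add: mob_strip_inv height_def)

end

section \<open>Lifting rectangles\<close>

lemma curve_class_iff:
  "\<delta> \<in> curve_class X E1 E2 \<gamma> \<longleftrightarrow>
    (\<exists>h :: real \<times> real \<Rightarrow> complex. continuous_on ({0..1} \<times> {0..1}) h \<and> h ` ({0..1} \<times> {0..1}) \<subseteq> X \<and>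
      (\<forall>t\<in>{0..1}. h (0, t) = \<gamma> t) \<and> (\<forall>t\<in>{0..1}. h (1, t) = \<delta> t) \<and>
      (\<forall>s\<in>{0..1}. h (s, 0) \<in> E1 \<and> h (s, 1) \<in> E2))"
  unfolding curve_class_def mem_Collect_eq
  by (subst homotopic_with) (simp_all add: image_subset_iff_funcset)

lemma curve_classE:
  assumes "\<delta> \<in> curve_class X E1 E2 \<gamma>"
  obtains h :: "real \<times> real \<Rightarrow> complex" where "continuous_on ({0..1} \<times> {0..1}) h" "h ` ({0..1} \<times> {0..1}) \<subseteq> X"
    "\<forall>t\<in>{0..1}. h (0, t) = \<gamma> t" "\<forall>t\<in>{0..1}. h (1, t) = \<delta> t"
    "\<forall>s\<in>{0..1}. h (s, 0) \<in> E1 \<and> h (s, 1) \<in> E2"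
  using assms unfolding curve_class_iff by (elim exE conjE) (rule that)

lemma curve_classI:
  fixes h :: "real \<times> real \<Rightarrow> complex"
  assumes "continuous_on ({0..1} \<times> {0..1}) h" "h ` ({0..1} \<times> {0..1}) \<subseteq> X"
    "\<And>t. t \<in> {0..1} \<Longrightarrow> h (0, t) = \<gamma> t" "\<And>t. t \<in> {0..1} \<Longrightarrow> h (1, t) = \<delta> t"
    "\<And>s. s \<in> {0..1} \<Longrightarrow> h (s, 0) \<in> E1 \<and> h (s, 1) \<in> E2"
  shows "\<delta> \<in> curve_class X E1 E2 \<gamma>"
  unfolding curve_class_iff by (intro exI[of _ h] conjI ballI assms)

text \<open>\<open>K\<close> is the part of the preimage of \<open>E\<close> that lies in the base
  sheet. The two instances are the imaginary axis over the interval (-1, 1) and the unit circle over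
  the imaginary axis.\<close>

definition lift_pair :: "complex set \<Rightarrow> complex set \<Rightarrow> bool" where
  "lift_pair K E \<longleftrightarrow> K \<subseteq> Wset \<and> cover ` K \<subseteq> E \<and> (\<forall>z\<in>E. (1 + z) / 2 \<in> slit \<and> tau ((1 + z) / 2) \<in> K)"

lemma lift_pair_axis: "lift_pair {t \<in> uhp. Re t = 0} E_tr"
proof -
  have K: "t \<in> Wset" if "t \<in> uhp" "Re t = 0" for t
  proof -
    have "t = \<i> * of_real (Im t)" using that by (simp add: complex_eq_iff)
    then show ?thesis using imag_axis_Wset[of "Im t"] that by (simp add: uhp_def)
  qed
  have "cover t \<in> E_tr" if t: "t \<in> uhp" "Re t = 0" for t
  proof -
    have "- cnj t = t" using t by (simp add: complex_eq_iff)
    then have "cnj (lam t) = lam t" using lam_cnj[of t] by simp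
    then have im: "Im (lam t) = 0" by (simp add: complex_eq_iff)
    then have "0 < Re (lam t)" "Re (lam t) < 1"
      using Wset_subset(2)[OF K[OF t]] by (auto simp: slit_def)
    then show ?thesis using im unfolding E_tr_def cover_def
      by (intro CollectI exI[of _ "2 * Re (lam t) - 1"]) (simp add: complex_eq_iff)
  qed
  moreover have "(1 + z) / 2 \<in> slit \<and> tau ((1 + z) / 2) \<in> {t \<in> uhp. Re t = 0}" if zE: "z \<in> E_tr" for z
  proof -
    obtain x where x: "z = of_real x" "-1 < x" "x < 1" using zE by (auto simp: E_tr_def)
    have c: "Im ((1 + z) / 2) = 0" "0 < Re ((1 + z) / 2)" "Re ((1 + z) / 2) < 1" using x by auto
    then have "(1 + z) / 2 \<in> slit" by (simp add: slit_def)
    then show ?thesis using tau_in_uhp Re_tau_real[OF c] by blast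
  qed
  ultimately show ?thesis using K unfolding lift_pair_def by blast
qed

lemma lift_pair_circle: "lift_pair {t \<in> uhp. norm t = 1} E_pb"
proof -
  have "cover t \<in> E_pb" if "t \<in> uhp" "norm t = 1" for t
    using Re_lam_unit_circle[OF that] by (simp add: E_pb_def cover_def)
  moreover have "(1 + z) / 2 \<in> slit \<and> tau ((1 + z) / 2) \<in> {t \<in> uhp. norm t = 1}" if "z \<in> E_pb" for z
  proof -
    have c: "Re ((1 + z) / 2) = 1/2" using that by (simp add: E_pb_def)
    then have "(1 + z) / 2 \<in> slit" by (simp add: slit_def)
    then show ?thesis using tau_in_uhp norm_tau_half[OF c] by blast
  qed
  ultimately show ?thesis using unit_circle_Wset unfolding lift_pair_def by blast
qed

lemma lift_pair_Xpunct: "lift_pair K E \<Longrightarrow> z \<in> E \<Longrightarrow> z \<in> Xpunct"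
  unfolding lift_pair_def using cover_in_Xpunct[OF tau_in_uhp] cover_eqI[OF lam_tau] by metis

text \<open>Uniqueness of lifts identifies \<open>F\<close> with the explicit lift through
  \<open>tau\<close>. It means that an endpoint free to move in \<open>E\<close> can be followed
  upstairs along a single translate of \<open>K\<close>.\<close>

lemma lift_stays:
  assumes K: "lift_pair K E" and M: "M \<in> deck_maps"
    and T: "connected T" "continuous_on T F" "F ` T \<subseteq> cover_dom" "\<And>x. x \<in> T \<Longrightarrow> cover (F x) \<in> E"
    and a: "a \<in> T" "F a \<in> M ` K" and x: "x \<in> T"
  shows "F x \<in> M ` K"
proof -
  let ?y = "\<lambda>x. (1 + cover (F x)) / 2"
  have y: "?y x \<in> slit" "tau (?y x) \<in> K" if "x \<in> T" for x
    using K T(4)[OF that] by (auto simp: lift_pair_def)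
  obtain t where t: "t \<in> K" "F a = M t" using a by blast
  have tW: "t \<in> Wset" "t \<in> uhp" using t K Wset_subset(1) by (auto simp: lift_pair_def)
  have cF: "continuous_on T (\<lambda>x. cover (F x))"
    by (rule continuous_on_compose2[OF covering_space_imp_continuous[OF covering_space_cover] T(2)]) (use T in auto)
  have "F x = M (tau (?y x))"
  proof (rule covering_space_lift_unique[OF covering_space_cover, where a = a and T = T and f = "\<lambda>x. cover (F x)" and ?g1.0 = F and ?g2.0 = "\<lambda>x. M (tau (?y x))"])
    have "?y a = lam t" using t cover_deck[OF M tW(2)] by (simp add: cover_def)
    then show "F a = M (tau (?y a))" using t tau_lam[OF tW(1)] by simp
    show "(\<lambda>x. cover (F x)) \<in> T \<rightarrow> Xpunct" using K T(4) lift_pair_Xpunct by blast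
    have "continuous_on T ?y" by (intro continuous_intros cF) auto
    then show "continuous_on T (\<lambda>x. M (tau (?y x)))"
      by (rule continuous_on_compose2[OF holomorphic_on_imp_continuous_on[OF deck_section(1)[OF M sections_mem(1)]]])
        (use y in auto)
    show "(\<lambda>x. M (tau (?y x))) \<in> T \<rightarrow> cover_dom"
      using section_lift[OF sections_mem(1) _ M] y by blast
    show "cover (F x) = cover (M (tau (?y x)))" if "x \<in> T" for x
      using section_lift[OF sections_mem(1) y(1)[OF that] M] by simp
  qed (use T cF a x in auto)
  then show ?thesis using y(2)[OF x] by blast
qed

text \<open>The rectangle is narrowed to \<open>x1 \<le> Re z \<le> x2\<close> because
  \<open>f\<close> is controlled only on the open horizontal sides and may hit a puncture on the
  vertical ones; a limit restores the width later. The homotopy between the word loop and one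
  vertical segment tells which translates the two horizontal sides lie on.\<close>

lemma rectangle_lift:
  assumes K1: "lift_pair K1 E1" "\<i> \<in> K1" and K2: "lift_pair K2 E2" "\<i> \<in> K2"
    and f: "f holomorphic_on box a b" "f ` box a b \<subseteq> Xpunct"
      "represents E1 E2 (curve_class Xpunct E1 E2 (word_loop w)) a b f"
    and x: "Re a < x1" "x1 < x2" "x2 < Re b" and ab: "Im a < Im b"
  obtains F where "continuous_on (cbox (Complex x1 (Im a)) (Complex x2 (Im b))) F"
    "F holomorphic_on box (Complex x1 (Im a)) (Complex x2 (Im b))"
    "F ` cbox (Complex x1 (Im a)) (Complex x2 (Im b)) \<subseteq> uhp"
    "\<And>z. z \<in> cbox (Complex x1 (Im a)) (Complex x2 (Im b)) \<Longrightarrow> Im z = Im a \<Longrightarrow> F z \<in> K1"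
    "\<And>z. z \<in> cbox (Complex x1 (Im a)) (Complex x2 (Im b)) \<Longrightarrow> Im z = Im b \<Longrightarrow> F z \<in> deck_word w ` K2"
proof -
  define Q where "Q = cbox (Complex x1 (Im a)) (Complex x2 (Im b))"
  note cs = covering_space_cover
  let ?I = "{0..1::real} \<times> {0..1::real}"
  let ?v = "\<lambda>t. Complex x1 (Im a + t * (Im b - Im a))"
  have rep: "continuous_on (cbox a b) f"
    "\<And>x. Re a < x \<Longrightarrow> x < Re b \<Longrightarrow> f (Complex x (Im a)) \<in> E1 \<and> f (Complex x (Im b)) \<in> E2"
    "(\<lambda>t. f (?v t)) \<in> curve_class Xpunct E1 E2 (word_loop w)"
    using f(3) x unfolding represents_def by auto
  obtain h where h: "continuous_on ?I h" "h ` ?I \<subseteq> Xpunct" "\<forall>t\<in>{0..1}. h (0, t) = word_loop w t"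
    "\<forall>t\<in>{0..1}. h (1, t) = f (?v t)" "\<forall>s\<in>{0..1}. h (s, 0) \<in> E1 \<and> h (s, 1) \<in> E2"
    using rep(3) by (rule curve_classE)
  obtain p where p: "path p" "path_image p \<subseteq> cover_dom" "pathstart p = \<i>" "pathfinish p = deck_word w \<i>"
     "\<forall>t\<in>{0..1}. cover (p t) = word_loop w t" using loop_lift_word unfolding loop_lift_def by blast
  have h00: "h (0, 0) = cover \<i>" using bspec[OF h(3), of 0] bspec[OF p(5), of 0] p(3) by (simp add: pathstart_def)
  have cI: "convex ?I" by (intro convex_Times) auto
  obtain G where G: "continuous_on ?I G" "G \<in> ?I \<rightarrow> cover_dom" "G (0, 0) = \<i>" "\<And>y. y \<in> ?I \<Longrightarrow> cover (G y) = h y"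
    by (rule covering_space_lift_strong[OF cs i_cover_dom, where U = ?I and f = h and z = "(0, 0)"])
      (use h h00 cI in \<open>auto intro: convex_imp_simply_connected convex_imp_locally_path_connected\<close>)
  have G_sub: "G ` S \<subseteq> cover_dom" "continuous_on S G" if "S \<subseteq> ?I" for S
    using G(1,2) that by (auto intro: continuous_on_subset)
  have slice: "continuous_on {0..1} (\<lambda>t. G (s, t))" if "s \<in> {0..1}" for s
    by (rule continuous_on_compose2[OF G(1)]) (use that in \<open>auto intro!: continuous_intros\<close>)
  have hslice: "continuous_on {0..1} (\<lambda>t. h (s, t))" if "s \<in> {0..1}" for s
    by (rule continuous_on_compose2[OF h(1)]) (use that in \<open>auto intro!: continuous_intros\<close>)
  \<comment> \<open>One edge of the lifted homotopy is the known lift of the word. Its two endpoints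
    then move along \<open>K1\<close> and along the image of \<open>K2\<close> under
    \<open>deck_word w\<close>.\<close>
  have "G (0, 1) = p 1"
  proof (rule covering_space_lift_unique[OF cs, where a = 0 and T = "{0..1}" and f = "\<lambda>t. h (0, t)" and ?g1.0 = "\<lambda>t. G (0, t)" and ?g2.0 = p])
    show "(\<lambda>t. h (0, t)) \<in> {0..1} \<rightarrow> Xpunct" "(\<lambda>t. G (0, t)) \<in> {0..1} \<rightarrow> cover_dom"
      using h(2) G(2) by auto
    show "p \<in> {0..1} \<rightarrow> cover_dom" using p(2) by (auto simp: path_image_def)
    show "continuous_on {0..1} p" using p(1) by (simp add: path_def)
    show "G (0, 0) = p 0" using G(3) p(3) by (simp add: pathstart_def)
    show "h (0, t) = cover (p t)" if "t \<in> {0..1}" for t using p(5) h(3) that by simp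
    show "h (0, t) = cover (G (0, t))" if "t \<in> {0..1}" for t using G(4) that by simp
  qed (use slice hslice in auto)
  then have G01: "G (0, 1) = deck_word w \<i>" using p(4) by (simp add: pathfinish_def)
  have c1: "connected ({0..1::real} \<times> {0::real})" "connected ({0..1::real} \<times> {1::real})"
    by (intro convex_connected convex_Times; simp)+
  have sub: "{0..1::real} \<times> {0::real} \<subseteq> ?I" "{0..1::real} \<times> {1::real} \<subseteq> ?I" by auto
  have G10: "G (1, 0) \<in> (\<lambda>t. t) ` K1"
    by (rule lift_stays[OF K1(1) deck_maps_id c1(1), where F = G and a = "(0, 0)" and x = "(1, 0)"])
      (use G_sub[OF sub(1)] G(3,4) h(5) K1(2) in auto)
  have G11: "G (1, 1) \<in> deck_word w ` K2"
    by (rule lift_stays[OF K2(1) deck_word_in c1(2), where F = G and a = "(0, 1)" and x = "(1, 1)"])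
      (use G_sub[OF sub(2)] G01 G(4) h(5) K2(2) in auto)
  have Q_iff: "z \<in> Q \<longleftrightarrow> x1 \<le> Re z \<and> Re z \<le> x2 \<and> Im a \<le> Im z \<and> Im z \<le> Im b" for z
    by (auto simp: Q_def in_cbox_complex_iff)
  have Qsub: "Q \<subseteq> cbox a b" using x by (auto simp: Q_iff in_cbox_complex_iff)
  have fQ: "continuous_on Q f" by (rule continuous_on_subset[OF rep(1) Qsub])
  have fX: "f z \<in> Xpunct" if z: "z \<in> Q" for z
  proof -
    have zC: "z = Complex (Re z) (Im z)" by simp
    consider "Im z = Im a" | "Im z = Im b" | "Im a < Im z" "Im z < Im b" using z unfolding Q_iff by linarith
    then show ?thesis
    proof cases
      case 1
      then have "f z \<in> E1" using rep(2)[of "Re z"] z x zC by (auto simp: Q_iff)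
      then show ?thesis by (rule lift_pair_Xpunct[OF K1(1)])
    next
      case 2
      then have "f z \<in> E2" using rep(2)[of "Re z"] z x zC by (auto simp: Q_iff)
      then show ?thesis by (rule lift_pair_Xpunct[OF K2(1)])
    next
      case 3
      then have "z \<in> box a b" using z x by (auto simp: Q_iff in_box_complex_iff)
      then show ?thesis using f(2) by blast
    qed
  qed
  have cQ: "convex Q" unfolding Q_def by (rule convex_box)
  have v0: "?v 0 \<in> Q" using x ab by (simp add: Q_iff)
  have vQ: "?v t \<in> Q" if t: "t \<in> {0..1}" for t
  proof -
    have "0 \<le> t * (Im b - Im a)" "t * (Im b - Im a) \<le> 1 * (Im b - Im a)"
      using t ab by (auto intro!: mult_right_mono)
    then show ?thesis using x by (simp add: Q_iff)
  qed
  obtain F where F: "continuous_on Q F" "F \<in> Q \<rightarrow> cover_dom" "F (?v 0) = G (1, 0)" "\<And>y. y \<in> Q \<Longrightarrow> cover (F y) = f y"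
  proof (rule covering_space_lift_strong[OF cs, where U = Q and f = f and z = "?v 0" and a = "G (1, 0)"])
    show "G (1, 0) \<in> cover_dom" using G(2) by auto
    show "f (?v 0) = cover (G (1, 0))" using G(4)[of "(1, 0)"] h(4) by simp
  qed (use v0 fQ fX cQ in \<open>auto intro: convex_imp_simply_connected convex_imp_locally_path_connected\<close>)
  have cv: "continuous_on {0..1} ?v" by (intro continuous_on_Complex continuous_intros)
  have "F (?v 1) = G (1, 1)"
  proof (rule covering_space_lift_unique[OF cs, where a = 0 and T = "{0..1}" and f = "\<lambda>t. h (1, t)" and ?g1.0 = "\<lambda>t. F (?v t)" and ?g2.0 = "\<lambda>t. G (1, t)"])
    show "(\<lambda>t. h (1, t)) \<in> {0..1} \<rightarrow> Xpunct" "(\<lambda>t. G (1, t)) \<in> {0..1} \<rightarrow> cover_dom"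
      using h(2) G(2) by auto
    show "(\<lambda>t. F (?v t)) \<in> {0..1} \<rightarrow> cover_dom" using F(2) vQ by auto
    show "continuous_on {0..1} (\<lambda>t. F (?v t))"
      by (rule continuous_on_compose2[OF F(1) cv]) (use vQ in auto)
    show "F (?v 0) = G (1, 0)" by (rule F(3))
    show "h (1, t) = cover (F (?v t))" if "t \<in> {0..1}" for t using F(4)[OF vQ[OF that]] h(4) that by simp
    show "h (1, t) = cover (G (1, t))" if "t \<in> {0..1}" for t using G(4) that by simp
  qed (use slice hslice in auto)
  then have F1: "F (?v 1) \<in> deck_word w ` K2" using G11 by simp
  have side: "F z \<in> M ` K" if z: "z \<in> Q" "Im z = y" and K: "lift_pair K E" "M \<in> deck_maps"
      "\<And>z. z \<in> Q \<Longrightarrow> Im z = y \<Longrightarrow> f z \<in> E" "F (Complex x1 y) \<in> M ` K" for z y K E M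
  proof (rule lift_stays[OF K(1,2), where F = F and a = "Complex x1 y" and T = "Q \<inter> {z. Im z = y}"])
    have "convex {z. Im z = y}"
      by (rule convexI) (simp add: distrib_right[symmetric])
    then show "connected (Q \<inter> {z. Im z = y})" by (intro convex_connected convex_Int cQ)
  qed (use F z K x in \<open>auto simp: Q_iff intro: continuous_on_subset\<close>)
  show ?thesis
  proof (rule that[of F])
    show "continuous_on (cbox (Complex x1 (Im a)) (Complex x2 (Im b))) F" using F(1) by (simp add: Q_def)
    show "F ` cbox (Complex x1 (Im a)) (Complex x2 (Im b)) \<subseteq> uhp" using F(2) cover_dom_uhp by (auto simp: Q_def)
    have bQ: "box (Complex x1 (Im a)) (Complex x2 (Im b)) \<subseteq> Q" unfolding Q_def by (rule box_subset_cbox)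
    show "F holomorphic_on box (Complex x1 (Im a)) (Complex x2 (Im b))"
    proof (rule holomorphic_lift)
      show "f holomorphic_on box (Complex x1 (Im a)) (Complex x2 (Im b))"
        by (rule holomorphic_on_subset[OF f(1)]) (use x in \<open>auto simp: in_box_complex_iff\<close>)
    qed (use F bQ in \<open>auto intro: continuous_on_subset\<close>)
    fix z assume z: "z \<in> cbox (Complex x1 (Im a)) (Complex x2 (Im b))"
    show "F z \<in> K1" if "Im z = Im a"
    proof -
      have "F z \<in> (\<lambda>t. t) ` K1"
      proof (rule side[OF _ that K1(1) deck_maps_id])
        show "f z \<in> E1" if "z \<in> Q" "Im z = Im a" for z
          using rep(2)[of "Re z"] that x by (simp add: Q_iff complex_eq_iff) (metis complex.collapse order_less_le_trans order_le_less_trans)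
        show "F (Complex x1 (Im a)) \<in> (\<lambda>t. t) ` K1" using F(3) G10 by simp
      qed (use z Q_def in auto)
      then show ?thesis by simp
    qed
    show "F z \<in> deck_word w ` K2" if "Im z = Im b"
    proof (rule side[OF _ that K2(1) deck_word_in])
      show "f z \<in> E2" if "z \<in> Q" "Im z = Im b" for z
        using rep(2)[of "Re z"] that x by (simp add: Q_iff complex_eq_iff) (metis complex.collapse order_less_le_trans order_le_less_trans)
      show "F (Complex x1 (Im b)) \<in> deck_word w ` K2" using F1 by simp
    qed (use z Q_def in auto)
  qed
qed

section \<open>Rectangles between two disjoint geodesics\<close>

context geod_pair
begin

lemma geod_modulus_bound:
  assumes ab: "Re a < Re b" "Im a < Im b"
    and F: "continuous_on (cbox a b) F" "F holomorphic_on box a b" "F ` cbox a b \<subseteq> uhp"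
    and sides: "(\<forall>z\<in>cbox a b. Im z = Im a \<longrightarrow> Re (F z) = 0) \<and> (\<forall>z\<in>cbox a b. Im z = Im b \<longrightarrow> on_geod E C D (F z))
       \<or> (\<forall>z\<in>cbox a b. Im z = Im a \<longrightarrow> on_geod E C D (F z)) \<and> (\<forall>z\<in>cbox a b. Im z = Im b \<longrightarrow> Re (F z) = 0)"
  shows "ln \<bar>C\<bar> * (Re b - Re a) \<le> pi * (Im b - Im a)"
proof -
  define u where "u = (\<lambda>z. strip_coord (F z))"
  have c: "continuous_on (cbox a b) u" unfolding u_def
    by (rule continuous_on_compose2[OF holomorphic_on_imp_continuous_on[OF holomorphic_strip_coord] F(1)]) (use F in auto)
  have h: "u holomorphic_on box a b" unfolding u_def
    using holomorphic_on_compose_gen[OF F(2) holomorphic_strip_coord] F(3) box_subset_cbox[of a b] by (auto simp: o_def)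
  have s: "0 \<le> Im (u z) \<and> Im (u z) \<le> pi" if "z \<in> cbox a b" for z
    using strip_coord_strip[of "F z"] F(3) that by (auto simp: u_def less_imp_le)
  have uh: "F z \<in> uhp" if "z \<in> cbox a b" for z using F(3) that by auto
  from sides have "\<bar>height\<bar> * (Re b - Re a) \<le> pi * (Im b - Im a)"
  proof
    assume "(\<forall>z\<in>cbox a b. Im z = Im a \<longrightarrow> Re (F z) = 0) \<and> (\<forall>z\<in>cbox a b. Im z = Im b \<longrightarrow> on_geod E C D (F z))"
    then have "\<bar>height - 0\<bar> * (Re b - Re a) \<le> pi * (Im b - Im a)"
      by (intro rectangle_modulus_bound[OF ab c h s]) (auto simp: u_def uh strip_coord_axis strip_coord_geod)
    then show ?thesis by simp
  next
    assume "(\<forall>z\<in>cbox a b. Im z = Im a \<longrightarrow> on_geod E C D (F z)) \<and> (\<forall>z\<in>cbox a b. Im z = Im b \<longrightarrow> Re (F z) = 0)"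
    then have "\<bar>0 - height\<bar> * (Re b - Re a) \<le> pi * (Im b - Im a)"
      by (intro rectangle_modulus_bound[OF ab c h s]) (auto simp: u_def uh strip_coord_axis strip_coord_geod)
    then show ?thesis by simp
  qed
  moreover have "ln \<bar>C\<bar> * (Re b - Re a) \<le> \<bar>height\<bar> * (Re b - Re a)"
    using height_bounds(1) ab by (intro mult_right_mono) auto
  ultimately show ?thesis by linarith
qed

text \<open>A rectangle of width 1 fits into the middle of the strip, whose width is
  \<open>pi\<close>, once it is turned by a right angle. The strip is convex, so the straight
  homotopy between the lifted curve and a vertical segment, projected by \<open>cover\<close>, shows
  that the class is represented; its ends stay on the lines \<open>Re u = k0\<close> and
  \<open>Re u = k1\<close>.\<close>

lemma Lambda_le_strip:
  assumes p: "path p" "path_image p \<subseteq> uhp" "\<And>t. t \<in> {0..1} \<Longrightarrow> cover (p t) = \<gamma> t"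
    and k: "Re (strip_coord (p 0)) = k0" "Re (strip_coord (p 1)) = k1" "k0 \<noteq> k1"
    and E: "\<And>u. 0 < Im u \<Longrightarrow> Im u < pi \<Longrightarrow> Re u = k0 \<Longrightarrow> cover (strip_inv u) \<in> E1"
      "\<And>u. 0 < Im u \<Longrightarrow> Im u < pi \<Longrightarrow> Re u = k1 \<Longrightarrow> cover (strip_inv u) \<in> E2"
  shows "Lambda E1 E2 (curve_class Xpunct E1 E2 \<gamma>) \<le> ereal \<bar>k1 - k0\<bar>"
proof -
  define \<delta> where "\<delta> = \<bar>k1 - k0\<bar>"
  define sg where "sg = sgn (k1 - k0)"
  have sg: "sg * \<delta> = k1 - k0" "\<bar>sg\<bar> = 1" "0 < \<delta>" using k(3) by (auto simp: sg_def \<delta>_def sgn_if)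
  define S where "S = {u. 0 < Im u \<and> Im u < pi}"
  have S_conv: "convex S"
  proof -
    have "S = {u. 0 < Im u} \<inter> {u. Im u < pi}" by (auto simp: S_def)
    then show ?thesis by (simp add: convex_Int convex_halfspace_Im_gt convex_halfspace_Im_lt)
  qed
  define a b where "a = Complex (-1/2) 0" and "b = Complex (1/2) \<delta>"
  \<comment> \<open>The sign \<open>sg\<close> chooses the direction of the turn, so that the lower
    side goes to \<open>Re = k0\<close> and the upper side to \<open>Re = k1\<close>; the last
    summand centres the image in the strip.\<close>
  define u where "u = (\<lambda>z. of_real k0 - of_real sg * \<i> * z + \<i> * of_real (pi / 2))"
  have u_ReIm: "Re (u z) = k0 + sg * Im z" "Im (u z) = pi / 2 - sg * Re z" for z
    by (auto simp: u_def)
  have uS: "u z \<in> S" if "z \<in> cbox a b" for z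
  proof -
    have "\<bar>Re z\<bar> \<le> 1/2" using that by (auto simp: a_def b_def in_cbox_complex_iff)
    then have "\<bar>sg * Re z\<bar> \<le> 1/2" using sg(2) by (simp add: abs_mult)
    then show ?thesis using pi_gt3 unfolding S_def mem_Collect_eq u_ReIm by linarith
  qed
  define g where "g = (\<lambda>u. cover (strip_inv u))"
  have g_hol: "g holomorphic_on S" unfolding g_def S_def
    using holomorphic_on_compose_gen[OF holomorphic_strip_inv holomorphic_cover] strip_inv_in_uhp by (auto simp: o_def)
  have g_X: "g u \<in> Xpunct" if "u \<in> S" for u
    using cover_in_Xpunct[OF strip_inv_in_uhp[of u]] that by (simp add: g_def S_def)
  have gE: "g u \<in> E1" if "u \<in> S" "Re u = k0" for u using E(1) that by (simp add: g_def S_def)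
  have gE2: "g u \<in> E2" if "u \<in> S" "Re u = k1" for u using E(2) that by (simp add: g_def S_def)
  have g_cont: "continuous_on S g" by (rule holomorphic_on_imp_continuous_on[OF g_hol])
  define f where "f = (\<lambda>z. g (u z))"
  have u_cont: "continuous_on A u" for A unfolding u_def by (intro continuous_intros)
  define q where "q = (\<lambda>t. strip_coord (p t))"
  have pu: "p t \<in> uhp" if "t \<in> {0..1}" for t using p(2) that by (auto simp: path_image_def)
  have qS: "q t \<in> S" if "t \<in> {0..1}" for t
    using strip_coord_strip[OF pu[OF that]] by (simp add: q_def S_def)
  have gq: "g (q t) = \<gamma> t" if "t \<in> {0..1}" for t
    using strip_inv_coord[OF pu[OF that]] p(3)[OF that] by (simp add: g_def q_def)
  have q_cont: "continuous_on {0..1} q" unfolding q_def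
    by (rule continuous_on_compose2[OF holomorphic_on_imp_continuous_on[OF holomorphic_strip_coord]])
      (use p(1) pu in \<open>auto simp: path_def\<close>)
  have "(\<lambda>t. f (Complex x (Im a + t * (Im b - Im a)))) \<in> curve_class Xpunct E1 E2 \<gamma>"
    if x: "Re a < x" "x < Re b" for x
  proof -
    define v where "v = (\<lambda>t. Complex x (Im a + t * (Im b - Im a)))"
    have v_cont: "continuous_on A v" for A :: "real set" unfolding v_def by (intro continuous_on_Complex continuous_intros)
    have vm: "v t \<in> cbox a b" if "t \<in> {0..1}" for t
      using that x sg(3) by (auto simp: v_def a_def b_def in_cbox_complex_iff mult_left_le_one_le)
    define h where "h = (\<lambda>(s, t). g ((1 - s) *\<^sub>R q t + s *\<^sub>R u (v t)))"
    have inS: "(1 - s) *\<^sub>R q t + s *\<^sub>R u (v t) \<in> S" if "s \<in> {0..1}" "t \<in> {0..1}" for s t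
      using that qS uS vm by (intro convexD[OF S_conv]) auto
    have Re0: "Re (q 0) = k0" "Re (u (v 0)) = k0" "Re (q 1) = k1" "Re (u (v 1)) = k1"
      using k sg by (auto simp: q_def u_ReIm v_def a_def b_def)
    have "continuous_on ({0..1} \<times> {0..1}) (\<lambda>p. (1 - fst p) *\<^sub>R q (snd p) + fst p *\<^sub>R u (v (snd p)))"
      by (intro continuous_intros continuous_on_compose2[OF q_cont] continuous_on_compose2[OF u_cont[of UNIV]]
        continuous_on_compose2[OF v_cont[of UNIV]]) auto
    then have "continuous_on ({0..1} \<times> {0..1}) h"
      unfolding h_def case_prod_unfold by (rule continuous_on_compose2[OF g_cont]) (use inS in auto)
    moreover have "h ` ({0..1} \<times> {0..1}) \<subseteq> Xpunct" using g_X inS by (auto simp: h_def)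
    moreover have "h (0, t) = \<gamma> t" "h (1, t) = f (v t)" if "t \<in> {0..1}" for t
      using gq that by (auto simp: h_def f_def)
    moreover have "h (s, 0) \<in> E1 \<and> h (s, 1) \<in> E2" if s: "s \<in> {0..1}" for s
    proof -
      have "Re ((1 - s) *\<^sub>R q 0 + s *\<^sub>R u (v 0)) = k0" "Re ((1 - s) *\<^sub>R q 1 + s *\<^sub>R u (v 1)) = k1"
        using Re0 by (auto simp: algebra_simps)
      then show ?thesis using gE[OF inS[OF s, of 0]] gE2[OF inS[OF s, of 1]] by (simp add: h_def)
    qed
    ultimately have "(\<lambda>t. f (v t)) \<in> curve_class Xpunct E1 E2 \<gamma>" by (rule curve_classI)
    then show ?thesis by (simp only: v_def)
  qed
  moreover have "f (Complex x (Im a)) \<in> E1" "f (Complex x (Im b)) \<in> E2" if "Re a < x" "x < Re b" for x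
  proof -
    have "Complex x (Im a) \<in> cbox a b" "Complex x (Im b) \<in> cbox a b"
      using that sg(3) by (auto simp: a_def b_def in_cbox_complex_iff)
    moreover have "Re (u (Complex x (Im a))) = k0" "Re (u (Complex x (Im b))) = k1"
      using sg by (auto simp: u_ReIm a_def b_def)
    ultimately show "f (Complex x (Im a)) \<in> E1" "f (Complex x (Im b)) \<in> E2"
      using gE gE2 uS by (auto simp: f_def)
  qed
  moreover have "continuous_on (cbox a b) f" unfolding f_def
    by (rule continuous_on_compose2[OF g_cont u_cont]) (use uS in auto)
  ultimately have rep: "represents E1 E2 (curve_class Xpunct E1 E2 \<gamma>) a b f"
    unfolding represents_def by simp
  have "u holomorphic_on box a b" unfolding u_def by (intro holomorphic_intros)
  from holomorphic_on_compose_gen[OF this g_hol] uS box_subset_cbox[of a b]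
  have hol: "f holomorphic_on box a b" by (auto simp: f_def o_def)
  have img: "f ` box a b \<subseteq> Xpunct" using g_X uS box_subset_cbox[of a b] by (auto simp: f_def)
  have "ereal ((Im b - Im a) / (Re b - Re a)) = ereal \<delta>" by (simp add: a_def b_def)
  moreover have "Re a < Re b" "Im a < Im b" using sg(3) by (auto simp: a_def b_def)
  ultimately show ?thesis unfolding Lambda_def \<delta>_def[symmetric]
    using hol img rep by (intro Inf_lower CollectI) metis
qed

end

section \<open>Reduced words and their geodesics\<close>

lemma reduced_word_iff:
  "reduced_word w \<longleftrightarrow> (\<forall>x\<in>set w. snd x \<noteq> 0) \<and> successively (\<lambda>x y. fst x \<noteq> fst y) w"
  unfolding reduced_word_def successively_conv_nth by (auto simp: all_set_conv_all_nth)

lemma reduced_word_inv: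
  assumes "reduced_word w"
  shows "reduced_word (inv_word w)"
proof -
  have "successively (\<lambda>x y. fst y \<noteq> fst x) w"
    using assms unfolding reduced_word_iff by (auto elim: successively_mono)
  then show ?thesis using assms
    by (auto simp: reduced_word_iff inv_word_def successively_map case_prod_unfold)
qed

lemma syl_prod_inv_word: "syl_prod (map snd (inv_word w)) = syl_prod (map snd w)"
proof -
  have "map snd (inv_word w) = rev (map uminus (map snd w))"
    by (simp add: inv_word_def rev_map case_prod_unfold o_def)
  then show ?thesis by (simp only: syl_prod_rev syl_prod_uminus)
qed

lemma inv_word_Nil_iff: "inv_word w = [] \<longleftrightarrow> w = []"
  by (simp add: inv_word_def)

lemma syl_prod_ge_3:
  assumes "ns \<noteq> []" "\<forall>n\<in>set ns. n \<noteq> 0"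
  shows "3 \<le> syl_prod ns"
proof -
  obtain n ns' where ns: "ns = n # ns'" using assms(1) by (cases ns) auto
  have *: "3 \<le> k * P" if "3 \<le> k" "1 \<le> P" for k P :: int
    using mult_mono[of 3 k 1 P] that by simp
  show ?thesis
  proof (cases "2 \<le> \<bar>n\<bar>")
    case True
    then show ?thesis unfolding ns syl_prod_Cons_big[OF True] using syl_prod_pos[of ns'] by (intro *) auto
  next
    case False
    then obtain d rest where "syl_degs (n # ns') = Suc d # syl_degs rest"
      using syl_degs_run_split[of n ns'] by auto
    then have "syl_prod ns = (4 * int (Suc d) - 1) * syl_prod rest" by (simp add: ns syl_prod_def)
    then show ?thesis using syl_prod_pos[of rest] by (simp only:) (intro *, auto)
  qed
qed

lemma on_geod_slide:
  assumes t: "t \<in> uhp" and g: "slide n (E, C, D) = (E', C', D')"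
  shows "on_geod E' C' D' (- 1 / deckA n t) \<longleftrightarrow> on_geod E C D t"
proof -
  define u where "u = deckA n t"
  have "u \<in> uhp" unfolding u_def by (rule deck_mapsD(2)[OF deckA_in t])
  then have u: "u \<noteq> 0" by (auto simp: uhp_def)
  have tu: "t = u - 2 * of_int n" by (simp add: u_def deckA_def)
  have eq: "E' = D + 4 * n * C + 4 * n\<^sup>2 * E" "C' = - (C + 2 * n * E)" "D' = E" using g by auto
  have nu: "0 < (norm u)\<^sup>2" using u by simp
  have re: "Re (- 1 / u) = - Re u / (norm u)\<^sup>2"
    unfolding complex_div_cnj[of "-1"] by simp
  have "on_geod E' C' D' (- 1 / u) \<longleftrightarrow> (E' / (norm u)\<^sup>2 + 2 * C' * (Re u / (norm u)\<^sup>2) + D') * (norm u)\<^sup>2 = 0"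
    using nu unfolding on_geod_def re by (simp add: norm_divide power_divide)
  also have "(E' / (norm u)\<^sup>2 + 2 * C' * (Re u / (norm u)\<^sup>2) + D') * (norm u)\<^sup>2 = E' + 2 * C' * Re u + D' * (norm u)\<^sup>2"
    using nu by (simp add: distrib_right)
  also have "\<dots> = real_of_int E * (norm t)\<^sup>2 - 2 * real_of_int C * Re t + real_of_int D"
    unfolding tu eq cmod_power2 by (simp add: power2_eq_square algebra_simps)
  finally show ?thesis unfolding on_geod_def u_def .
qed

text \<open>The two claims are proved together since the induction alternates between them:
  \<open>slide\<close> ends with an inversion, which remains visible after a term in
  \<open>A1\<close> and is absorbed by the conjugation in \<open>deckB\<close> after a term in
  \<open>A2\<close>.\<close>

lemma deck_word_geod:
  assumes "reduced_word w" "t \<in> uhp" "word_geod (map snd w) = (E, C, D)"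
  shows "w = [] \<or> fst (hd w) = A1 \<Longrightarrow> norm t = 1 \<longleftrightarrow> on_geod E C D (- 1 / deck_word w t)"
    and "w = [] \<or> fst (hd w) = A2 \<Longrightarrow> norm t = 1 \<longleftrightarrow> on_geod E C D (deck_word w t)"
proof -
  have unit: "norm z = 1 \<longleftrightarrow> on_geod 1 0 (-1) z" for z
    by (auto simp: on_geod_def power2_eq_1_iff) (metis norm_ge_zero not_one_le_zero neg_0_le_iff_le)
  have "(w = [] \<or> fst (hd w) = A1 \<longrightarrow> (norm t = 1 \<longleftrightarrow> on_geod E C D (- 1 / deck_word w t))) \<and>
    (w = [] \<or> fst (hd w) = A2 \<longrightarrow> (norm t = 1 \<longleftrightarrow> on_geod E C D (deck_word w t)))"
    using assms
  proof (induction w arbitrary: E C D)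
    case Nil
    have "norm (- 1 / t) = 1 \<longleftrightarrow> norm t = 1" by (auto simp: norm_divide)
    moreover have "E = 1" "C = 0" "D = -1" using Nil(3) by simp_all
    ultimately show ?case using unit[of t] unit[of "- 1 / t"] by simp
  next
    case (Cons x w)
    obtain g n where x: "x = (g, n)" by (cases x)
    have red: "reduced_word w" "w \<noteq> [] \<Longrightarrow> fst (hd w) \<noteq> g"
      using Cons.prems(1) by (auto simp: reduced_word_iff successively_Cons x)
    obtain E' C' D' where g': "word_geod (map snd w) = (E', C', D')" by (metis prod_cases3)
    have sl: "slide n (E', C', D') = (E, C, D)"
      using Cons.prems(3) unfolding x list.map snd_conv word_geod_simps g' .
    note IH = Cons.IH[OF red(1) Cons.prems(2) g']
    have u: "deck_word w t \<in> uhp" by (rule deck_mapsD(2)[OF deck_word_in Cons.prems(2)])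
    show ?case
    proof (cases g)
      case A1
      then have "norm t = 1 \<longleftrightarrow> on_geod E' C' D' (deck_word w t)"
        using IH red(2) by (metis gen.exhaust)
      then show ?thesis using on_geod_slide[OF u sl] A1 x by simp
    next
      case A2
      then have "norm t = 1 \<longleftrightarrow> on_geod E' C' D' (- 1 / deck_word w t)"
        using IH red(2) by (metis gen.exhaust)
      then show ?thesis using on_geod_slide[OF uhp_neg_inverse[OF u] sl] deckB_conj[OF u] A2 x by simp
    qed
  qed
  then show "w = [] \<or> fst (hd w) = A1 \<Longrightarrow> norm t = 1 \<longleftrightarrow> on_geod E C D (- 1 / deck_word w t)"
    and "w = [] \<or> fst (hd w) = A2 \<Longrightarrow> norm t = 1 \<longleftrightarrow> on_geod E C D (deck_word w t)" by blast+
qed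

lemma on_geod_neg_inverse:
  assumes "t \<in> uhp"
  shows "on_geod E C D (- 1 / t) \<longleftrightarrow> on_geod D (- C) E t"
proof -
  have nu: "0 < (norm t)\<^sup>2" using assms by (auto simp: uhp_def)
  have re: "Re (- 1 / t) = - Re t / (norm t)\<^sup>2"
    unfolding complex_div_cnj[of "-1"] by simp
  have "on_geod E C D (- 1 / t) \<longleftrightarrow> (E / (norm t)\<^sup>2 + 2 * C * (Re t / (norm t)\<^sup>2) + D) * (norm t)\<^sup>2 = 0"
    using nu unfolding on_geod_def re by (simp add: norm_divide power_divide)
  also have "(E / (norm t)\<^sup>2 + 2 * C * (Re t / (norm t)\<^sup>2) + D) * (norm t)\<^sup>2 = E + 2 * C * Re t + D * (norm t)\<^sup>2"
    using nu by (simp add: distrib_right)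
  finally show ?thesis unfolding on_geod_def by (simp add: algebra_simps)
qed

text \<open>For words starting with \<open>A1\<close> the remaining inversion is undone by
  exchanging \<open>E\<close> and \<open>D\<close> and negating \<open>C\<close>, which leaves
  \<open>C\<^sup>2\<close> alone. Positivity of \<open>D\<close>, which keeps the geodesic off the
  imaginary axis, comes from \<open>C\<^sup>2 \<ge> 3\<close>.\<close>

lemma deck_word_geodesic:
  assumes "reduced_word w" "w \<noteq> []"
  obtains E C D where "geod_pair E C D" "exp (Lw w) \<le> C\<^sup>2" "\<bar>C\<bar> \<le> (exp (Lw w))\<^sup>2"
    "\<And>t. t \<in> uhp \<Longrightarrow> norm t = 1 \<longleftrightarrow> on_geod E C D (deck_word w t)"
proof -
  let ?ns = "map snd w"
  obtain E C D where g: "word_geod ?ns = (E, C, D)" by (metis prod_cases3)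
  have nz: "\<forall>n\<in>set ?ns. n \<noteq> 0" using assms(1) by (auto simp: reduced_word_iff)
  have ne: "?ns \<noteq> []" using assms(2) by simp
  have P: "exp (Lw w) = of_int (syl_prod ?ns)" using syl_prod_pos by (simp add: Lw_eq_ln)
  have low: "syl_prod ?ns \<le> C\<^sup>2" by (rule syl_prod_le_C_sq[OF nz ne g])
  have up: "\<bar>C\<bar> \<le> (syl_prod ?ns)\<^sup>2" by (rule C_le_syl_prod[OF nz g])
  have disc: "C\<^sup>2 - E * D = 1" by (rule word_geod_disc[OF g])
  have E: "0 < E" using word_geod_invariant(1)[OF nz g] by linarith
  have "0 < E * D" using low disc syl_prod_ge_3[OF ne nz] by linarith
  then have D: "0 < D" using E by (simp add: zero_less_mult_iff)
  have disc': "(real_of_int C)\<^sup>2 - real_of_int E * real_of_int D = 1"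
    using disc by (metis of_int_1 of_int_diff of_int_mult of_int_power)
  have b: "exp (Lw w) \<le> (real_of_int C)\<^sup>2" "\<bar>real_of_int C\<bar> \<le> (exp (Lw w))\<^sup>2"
    unfolding P of_int_power[symmetric] of_int_abs[symmetric] of_int_le_iff using low up by auto
  show ?thesis
  proof (cases "fst (hd w)")
    case A1
    show ?thesis
    proof (rule that[of D "- C" E])
      show "geod_pair D (- C) E" by unfold_locales (use E D disc' in \<open>auto simp: mult.commute\<close>)
      show "norm t = 1 \<longleftrightarrow> on_geod D (- C) E (deck_word w t)" if t: "t \<in> uhp" for t
        using deck_word_geod(1)[OF assms(1) t g] A1 on_geod_neg_inverse[OF deck_mapsD(2)[OF deck_word_in t], of E C D w]
        by simp
    qed (use b in auto)
  next
    case A2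
    show ?thesis
    proof (rule that[of E C D])
      show "geod_pair E C D" by unfold_locales (use E D disc' in auto)
      show "norm t = 1 \<longleftrightarrow> on_geod E C D (deck_word w t)" if t: "t \<in> uhp" for t
        using deck_word_geod(2)[OF assms(1) t g] A2 by simp
    qed (use b in auto)
  qed
qed

lemma Lw_inv_word: "Lw (inv_word w) = Lw w"
  by (simp add: Lw_eq_ln syl_prod_inv_word)

lemma Lw_ge_1:
  assumes "reduced_word w" "w \<noteq> []"
  shows "1 \<le> Lw w"
proof -
  have "3 \<le> syl_prod (map snd w)"
    using assms by (intro syl_prod_ge_3) (auto simp: reduced_word_iff)
  then have "exp 1 \<le> real_of_int (syl_prod (map snd w))" using exp_le by linarith
  then show ?thesis unfolding Lw_eq_ln by (subst ln_ge_iff) (use syl_prod_pos in auto)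
qed

section \<open>Lower bounds\<close>

lemma Lambda_lower:
  assumes "\<And>a b f. Re a < Re b \<Longrightarrow> Im a < Im b \<Longrightarrow> f holomorphic_on box a b \<Longrightarrow> f ` box a b \<subseteq> Xpunct \<Longrightarrow>
      represents E1 E2 H a b f \<Longrightarrow> L * (Re b - Re a) \<le> Im b - Im a"
  shows "ereal L \<le> Lambda E1 E2 H"
  unfolding Lambda_def
proof (rule Inf_greatest)
  fix r assume "r \<in> {ereal ((Im b - Im a) / (Re b - Re a)) | a b. Re a < Re b \<and> Im a < Im b \<and>
            (\<exists>f. f holomorphic_on box a b \<and> f ` box a b \<subseteq> Xpunct \<and> represents E1 E2 H a b f)}"
  then obtain a b f where r: "r = ereal ((Im b - Im a) / (Re b - Re a))" "Re a < Re b" "Im a < Im b"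
    "f holomorphic_on box a b" "f ` box a b \<subseteq> Xpunct" "represents E1 E2 H a b f" by blast
  from assms[OF r(2-6)] r(2) show "ereal L \<le> r" unfolding r(1) by (simp add: field_simps)
qed

lemma shrink_width:
  fixes c W H :: real
  assumes "0 < W" "0 \<le> H" "\<And>\<epsilon>. 0 < \<epsilon> \<Longrightarrow> \<epsilon> < W / 2 \<Longrightarrow> c * (W - 2 * \<epsilon>) \<le> H"
  shows "c * W \<le> H"
proof -
  have "((\<lambda>\<epsilon>. c * (W - 2 * \<epsilon>)) \<longlongrightarrow> c * (W - 2 * 0)) (at_right 0)" by (intro tendsto_intros)
  moreover have "\<forall>\<^sub>F \<epsilon> in at_right 0. c * (W - 2 * \<epsilon>) \<le> H"
    unfolding eventually_at_right_field using assms by (intro exI[of _ "W / 2"]) auto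
  ultimately have "c * (W - 2 * 0) \<le> H" by (rule tendsto_upperbound) simp
  then show ?thesis by simp
qed

lemma half_Lw_le_ln:
  assumes "exp (Lw w) \<le> C\<^sup>2"
  shows "Lw w / 2 \<le> ln \<bar>C\<bar>"
proof -
  have "0 < C\<^sup>2" using assms exp_gt_zero[of "Lw w"] by linarith
  then have C: "0 < \<bar>C\<bar>" by simp
  have "Lw w = ln (exp (Lw w))" by simp
  also have "\<dots> \<le> ln (\<bar>C\<bar>\<^sup>2)" using assms \<open>0 < C\<^sup>2\<close> by (subst ln_le_cancel_iff) auto
  also have "\<dots> = 2 * ln \<bar>C\<bar>" using C by (subst ln_realpow) auto
  finally show ?thesis by simp
qed

lemma Lw_lower_from_modulus:
  assumes "exp (Lw w) \<le> C\<^sup>2" "0 < W" "ln \<bar>C\<bar> * W \<le> pi * H"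
  shows "Lw w / (2 * pi) * W \<le> H"
proof -
  have "Lw w / 2 * W \<le> ln \<bar>C\<bar> * W" using half_Lw_le_ln[OF assms(1)] assms(2) by (intro mult_right_mono) auto
  then have "Lw w / 2 * W \<le> pi * H" using assms(3) by linarith
  then show ?thesis using pi_gt_zero by (simp add: field_simps)
qed

lemma Lambda_tr_pb_lower:
  assumes w: "reduced_word w" "w \<noteq> []"
  shows "ereal (Lw w / (2 * pi)) \<le> Lambda E_tr E_pb (tr_pb w)"
proof (rule Lambda_lower)
  fix a b f
  assume ab: "Re a < Re b" "Im a < Im b"
    and f: "f holomorphic_on box a b" "f ` box a b \<subseteq> Xpunct" "represents E_tr E_pb (tr_pb w) a b f"
  obtain E C D where g: "geod_pair E C D" "exp (Lw w) \<le> C\<^sup>2" "\<bar>C\<bar> \<le> (exp (Lw w))\<^sup>2"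
    "\<And>t. t \<in> uhp \<Longrightarrow> norm t = 1 \<longleftrightarrow> on_geod E C D (deck_word w t)"
    using deck_word_geodesic[OF w] by blast
  interpret geod_pair E C D by (rule g(1))
  have "ln \<bar>C\<bar> * (Re b - Re a) \<le> pi * (Im b - Im a)"
  proof (rule shrink_width)
    fix \<epsilon> :: real assume e: "0 < \<epsilon>" "\<epsilon> < (Re b - Re a) / 2"
    define x1 x2 where "x1 = Re a + \<epsilon>" and "x2 = Re b - \<epsilon>"
    have x: "Re a < x1" "x1 < x2" "x2 < Re b" using e by (auto simp: x1_def x2_def)
    obtain F where F: "continuous_on (cbox (Complex x1 (Im a)) (Complex x2 (Im b))) F"
      "F holomorphic_on box (Complex x1 (Im a)) (Complex x2 (Im b))"
      "F ` cbox (Complex x1 (Im a)) (Complex x2 (Im b)) \<subseteq> uhp"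
      "\<And>z. z \<in> cbox (Complex x1 (Im a)) (Complex x2 (Im b)) \<Longrightarrow> Im z = Im a \<Longrightarrow> F z \<in> {t \<in> uhp. Re t = 0}"
      "\<And>z. z \<in> cbox (Complex x1 (Im a)) (Complex x2 (Im b)) \<Longrightarrow> Im z = Im b \<Longrightarrow> F z \<in> deck_word w ` {t \<in> uhp. norm t = 1}"
      by (rule rectangle_lift[OF lift_pair_axis _ lift_pair_circle _ f[unfolded tr_pb_def] x ab(2)]) (simp_all add: i_uhp)
    have "on_geod E C D (F z)" if "z \<in> cbox (Complex x1 (Im a)) (Complex x2 (Im b))" "Im z = Im b" for z
      using F(5)[OF that] g(4) by auto
    then have "ln \<bar>C\<bar> * (Re (Complex x2 (Im b)) - Re (Complex x1 (Im a))) \<le> pi * (Im (Complex x2 (Im b)) - Im (Complex x1 (Im a)))"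
      using F(4) x ab by (intro geod_modulus_bound[OF _ _ F(1-3)]) auto
    then show "ln \<bar>C\<bar> * (Re b - Re a - 2 * \<epsilon>) \<le> pi * (Im b - Im a)" by (simp add: x1_def x2_def algebra_simps)
  qed (use ab in auto)
  then show "Lw w / (2 * pi) * (Re b - Re a) \<le> Im b - Im a"
    using ab by (intro Lw_lower_from_modulus[OF g(2)]) auto
qed

text \<open>The lift now ends on a translate of the imaginary axis. Applying
  \<open>deck_word\<close> of the inverse word brings that side back to the axis and turns the other
  one into the geodesic of the inverse word, which has the same \<open>Lw\<close>.\<close>

lemma Lambda_pb_tr_lower:
  assumes w: "reduced_word w" "w \<noteq> []"
  shows "ereal (Lw w / (2 * pi)) \<le> Lambda E_pb E_tr (pb_tr w)"
proof (rule Lambda_lower)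
  fix a b f
  assume ab: "Re a < Re b" "Im a < Im b"
    and f: "f holomorphic_on box a b" "f ` box a b \<subseteq> Xpunct" "represents E_pb E_tr (pb_tr w) a b f"
  let ?v = "inv_word w"
  have v: "reduced_word ?v" "?v \<noteq> []" using w by (auto simp: reduced_word_inv inv_word_Nil_iff)
  obtain E C D where g: "geod_pair E C D" "exp (Lw ?v) \<le> C\<^sup>2" "\<bar>C\<bar> \<le> (exp (Lw ?v))\<^sup>2"
    "\<And>t. t \<in> uhp \<Longrightarrow> norm t = 1 \<longleftrightarrow> on_geod E C D (deck_word ?v t)"
    using deck_word_geodesic[OF v] by blast
  interpret geod_pair E C D by (rule g(1))
  have "ln \<bar>C\<bar> * (Re b - Re a) \<le> pi * (Im b - Im a)"
  proof (rule shrink_width)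
    fix \<epsilon> :: real assume e: "0 < \<epsilon>" "\<epsilon> < (Re b - Re a) / 2"
    define x1 x2 where "x1 = Re a + \<epsilon>" and "x2 = Re b - \<epsilon>"
    have x: "Re a < x1" "x1 < x2" "x2 < Re b" using e by (auto simp: x1_def x2_def)
    define Q where "Q = cbox (Complex x1 (Im a)) (Complex x2 (Im b))"
    obtain F where F: "continuous_on Q F" "F holomorphic_on box (Complex x1 (Im a)) (Complex x2 (Im b))" "F ` Q \<subseteq> uhp"
      "\<And>z. z \<in> Q \<Longrightarrow> Im z = Im a \<Longrightarrow> F z \<in> {t \<in> uhp. norm t = 1}"
      "\<And>z. z \<in> Q \<Longrightarrow> Im z = Im b \<Longrightarrow> F z \<in> deck_word w ` {t \<in> uhp. Re t = 0}"
      unfolding Q_def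
      by (rule rectangle_lift[OF lift_pair_circle _ lift_pair_axis _ f[unfolded pb_tr_def] x ab(2)]) (simp_all add: i_uhp)
    let ?G = "\<lambda>z. deck_word ?v (F z)"
    note dv = deck_mapsD[OF deck_word_in[of ?v]]
    have G: "continuous_on Q ?G"
      by (rule continuous_on_compose2[OF holomorphic_on_imp_continuous_on[OF dv(1)] F(1,3)])
    have "box (Complex x1 (Im a)) (Complex x2 (Im b)) \<subseteq> Q" unfolding Q_def by (rule box_subset_cbox)
    then have Gh: "?G holomorphic_on box (Complex x1 (Im a)) (Complex x2 (Im b))"
      using holomorphic_on_compose_gen[OF F(2) dv(1)] F(3) by (auto simp: o_def)
    have Gi: "?G ` Q \<subseteq> uhp" using F(3) dv(2) by blast
    have "on_geod E C D (?G z)" if "z \<in> Q" "Im z = Im a" for z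
      using F(4)[OF that] g(4) by auto
    moreover have "Re (?G z) = 0" if "z \<in> Q" "Im z = Im b" for z
      using F(5)[OF that] deck_word_inv[of _ w] by auto
    ultimately have "ln \<bar>C\<bar> * (Re (Complex x2 (Im b)) - Re (Complex x1 (Im a))) \<le> pi * (Im (Complex x2 (Im b)) - Im (Complex x1 (Im a)))"
      using x ab by (intro geod_modulus_bound[OF _ _ G[unfolded Q_def] Gh Gi[unfolded Q_def]]) (auto simp: Q_def)
    then show "ln \<bar>C\<bar> * (Re b - Re a - 2 * \<epsilon>) \<le> pi * (Im b - Im a)" by (simp add: x1_def x2_def algebra_simps)
  qed (use ab in auto)
  then have "Lw ?v / (2 * pi) * (Re b - Re a) \<le> Im b - Im a"
    using ab by (intro Lw_lower_from_modulus[OF g(2)]) auto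
  then show "Lw w / (2 * pi) * (Re b - Re a) \<le> Im b - Im a" by (simp only: Lw_inv_word)
qed

section \<open>Upper bounds\<close>

lemma height_le_Lw:
  assumes "geod_pair E C D" "\<bar>C\<bar> \<le> (exp (Lw w))\<^sup>2" "1 \<le> Lw w"
  shows "\<bar>geod_pair.height C\<bar> \<le> 300 * Lw w"
proof -
  interpret geod_pair E C D by (rule assms(1))
  have "1 < C\<^sup>2" using disc mult_pos_pos[OF pos] by linarith
  then have C: "0 < \<bar>C\<bar>" by (metis power2_eq_square mult_zero_left not_one_less_zero zero_less_abs_iff)
  have "\<bar>height\<bar> \<le> ln (2 * \<bar>C\<bar>)" by (rule height_bounds(2))
  also have "\<dots> = ln 2 + ln \<bar>C\<bar>" using C by (subst ln_mult) auto
  also have "ln \<bar>C\<bar> \<le> ln ((exp (Lw w))\<^sup>2)" using C assms(2) by (subst ln_le_cancel_iff) auto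
  also have "ln ((exp (Lw w))\<^sup>2) = 2 * Lw w" by (subst ln_realpow) auto
  finally have "\<bar>height\<bar> \<le> ln 2 + 2 * Lw w" by simp
  moreover have "ln 2 \<le> (1::real)" using ln_le_minus_one[of 2] by simp
  ultimately show ?thesis using assms(3) by linarith
qed

lemma loop_lift_deck:
  assumes "M \<in> deck_maps"
  obtains p where "path p" "path_image p \<subseteq> uhp" "p 0 = M \<i>" "p 1 = M (deck_word w \<i>)"
    "\<And>t. t \<in> {0..1} \<Longrightarrow> cover (p t) = word_loop w t"
proof -
  obtain q where q: "path q" "path_image q \<subseteq> cover_dom" "pathstart q = \<i>" "pathfinish q = deck_word w \<i>"
     "\<forall>t\<in>{0..1}. cover (q t) = word_loop w t" using loop_lift_word unfolding loop_lift_def by blast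
  have qu: "q t \<in> uhp" if "t \<in> {0..1}" for t using q(2) cover_dom_uhp that unfolding path_image_def by blast
  show ?thesis
  proof (rule that[of "M \<circ> q"])
    show "path (M \<circ> q)" by (rule path_deck(1)[OF assms q(1,2)])
    show "path_image (M \<circ> q) \<subseteq> uhp" using path_deck(2)[OF assms q(1,2)] cover_dom_uhp by blast
    show "(M \<circ> q) 0 = M \<i>" "(M \<circ> q) 1 = M (deck_word w \<i>)"
      using q(3,4) by (auto simp: pathstart_def pathfinish_def)
    show "cover ((M \<circ> q) t) = word_loop w t" if "t \<in> {0..1}" for t
      using cover_deck[OF assms qu[OF that]] q(5) that by simp
  qed
qed

lemma cover_circle_of_geod:
  assumes "\<And>t. t \<in> uhp \<Longrightarrow> norm t = 1 \<longleftrightarrow> on_geod E C D (deck_word w t)" "t \<in> uhp" "on_geod E C D t"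
  shows "cover t \<in> E_pb"
proof -
  let ?s = "deck_word (inv_word w) t"
  have s: "?s \<in> uhp" by (rule deck_mapsD(2)[OF deck_word_in assms(2)])
  have "deck_word w ?s = t" using deck_word_inv[OF assms(2), of "inv_word w"] by (simp add: inv_word_inv)
  then have "norm ?s = 1" using assms(1)[OF s] assms(3) by simp
  then have "cover ?s \<in> E_pb" using lift_pair_circle s unfolding lift_pair_def by blast
  then show ?thesis using cover_deck[OF deck_word_in assms(2)] by simp
qed

lemma cover_axis: "t \<in> uhp \<Longrightarrow> Re t = 0 \<Longrightarrow> cover t \<in> E_tr"
  using lift_pair_axis unfolding lift_pair_def by blast

lemma Lambda_tr_pb_upper:
  assumes w: "reduced_word w" "w \<noteq> []"
  shows "Lambda E_tr E_pb (tr_pb w) \<le> ereal (300 * Lw w)"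
proof -
  obtain E C D where g: "geod_pair E C D" "exp (Lw w) \<le> C\<^sup>2" "\<bar>C\<bar> \<le> (exp (Lw w))\<^sup>2"
    "\<And>t. t \<in> uhp \<Longrightarrow> norm t = 1 \<longleftrightarrow> on_geod E C D (deck_word w t)"
    using deck_word_geodesic[OF w] by blast
  interpret geod_pair E C D by (rule g(1))
  obtain p where p: "path p" "path_image p \<subseteq> uhp" "p 0 = \<i>" "p 1 = deck_word w \<i>"
    "\<And>t. t \<in> {0..1} \<Longrightarrow> cover (p t) = word_loop w t"
    using loop_lift_deck[OF deck_maps_id, of w] by blast
  have "Lambda E_tr E_pb (curve_class Xpunct E_tr E_pb (word_loop w)) \<le> ereal \<bar>height - 0\<bar>"
  proof (rule Lambda_le_strip[OF p(1,2,5)])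
    show "Re (strip_coord (p 0)) = 0" by (simp add: p strip_coord_axis i_uhp)
    show "Re (strip_coord (p 1)) = height" unfolding p(4)
      by (rule strip_coord_geod) (use g(4)[OF i_uhp] deck_mapsD(2)[OF deck_word_in i_uhp] in auto)
    show "0 \<noteq> height" using height_bounds(3) by auto
    show "cover (strip_inv u) \<in> E_tr" if "0 < Im u" "Im u < pi" "Re u = 0" for u
      by (rule cover_axis[OF strip_inv_in_uhp[OF that(1,2)] strip_inv_axis[OF that]])
    show "cover (strip_inv u) \<in> E_pb" if "0 < Im u" "Im u < pi" "Re u = height" for u
      by (rule cover_circle_of_geod[OF g(4) strip_inv_in_uhp[OF that(1,2)] strip_inv_geod[OF that]])
  qed
  also have "\<dots> \<le> ereal (300 * Lw w)" using height_le_Lw[OF g(1,3) Lw_ge_1[OF w]] by simp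
  finally show ?thesis by (simp add: tr_pb_def)
qed

lemma Lambda_pb_tr_upper:
  assumes w: "reduced_word w" "w \<noteq> []"
  shows "Lambda E_pb E_tr (pb_tr w) \<le> ereal (300 * Lw w)"
proof -
  let ?v = "inv_word w"
  have v: "reduced_word ?v" "?v \<noteq> []" using w by (auto simp: reduced_word_inv inv_word_Nil_iff)
  obtain E C D where g: "geod_pair E C D" "exp (Lw ?v) \<le> C\<^sup>2" "\<bar>C\<bar> \<le> (exp (Lw ?v))\<^sup>2"
    "\<And>t. t \<in> uhp \<Longrightarrow> norm t = 1 \<longleftrightarrow> on_geod E C D (deck_word ?v t)"
    using deck_word_geodesic[OF v] by blast
  interpret geod_pair E C D by (rule g(1))
  obtain p where p: "path p" "path_image p \<subseteq> uhp" "p 0 = deck_word ?v \<i>" "p 1 = deck_word ?v (deck_word w \<i>)"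
    "\<And>t. t \<in> {0..1} \<Longrightarrow> cover (p t) = word_loop w t"
    using loop_lift_deck[OF deck_word_in, of ?v w] by blast
  have p1: "p 1 = \<i>" using p(4) deck_word_inv[OF i_uhp] by simp
  have "Lambda E_pb E_tr (curve_class Xpunct E_pb E_tr (word_loop w)) \<le> ereal \<bar>0 - height\<bar>"
  proof (rule Lambda_le_strip[OF p(1,2,5)])
    show "Re (strip_coord (p 1)) = 0" by (simp add: p1 strip_coord_axis i_uhp)
    show "Re (strip_coord (p 0)) = height" unfolding p(3)
      by (rule strip_coord_geod) (use g(4)[OF i_uhp] deck_mapsD(2)[OF deck_word_in i_uhp] in auto)
    show "height \<noteq> 0" using height_bounds(3) by auto
    show "cover (strip_inv u) \<in> E_tr" if "0 < Im u" "Im u < pi" "Re u = 0" for u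
      by (rule cover_axis[OF strip_inv_in_uhp[OF that(1,2)] strip_inv_axis[OF that]])
    show "cover (strip_inv u) \<in> E_pb" if "0 < Im u" "Im u < pi" "Re u = height" for u
      by (rule cover_circle_of_geod[OF g(4) strip_inv_in_uhp[OF that(1,2)] strip_inv_geod[OF that]])
  qed
  also have "\<dots> \<le> ereal (300 * Lw w)" using height_le_Lw[OF g(1,3) Lw_ge_1[OF v]] by (simp add: Lw_inv_word)
  finally show ?thesis by (simp add: pb_tr_def)
qed

text \<open>For the empty word the two lifted curves meet at \<open>\<i>\<close>, at distance 0: the
  constant map represents the class on rectangles of arbitrarily small height.\<close>

lemma Lambda_const_le_0:
  assumes "0 \<in> E1" "0 \<in> E2"
  shows "Lambda E1 E2 (curve_class Xpunct E1 E2 (\<lambda>t. 0)) \<le> 0"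
proof (rule dense_ge)
  fix r :: ereal assume r: "0 < r"
  obtain e where e: "0 < e" "ereal e < r" using ereal_dense2[OF r] by (metis ereal_less(2) zero_ereal_def)
  have "(\<lambda>t. 0) \<in> curve_class Xpunct E1 E2 (\<lambda>t. 0)"
    by (rule curve_classI[of "\<lambda>_. 0"]) (use assms in \<open>auto simp: Xpunct_def\<close>)
  then have rep: "represents E1 E2 (curve_class Xpunct E1 E2 (\<lambda>t. 0)) 0 (Complex 1 e) (\<lambda>_. 0)"
    using assms by (simp add: represents_def)
  have "(Im (Complex 1 e) - Im 0) / (Re (Complex 1 e) - Re 0) = e" by simp
  then have "Lambda E1 E2 (curve_class Xpunct E1 E2 (\<lambda>t. 0)) \<le> ereal e"
    unfolding Lambda_def using rep e
    by (intro Inf_lower CollectI exI[of _ 0] exI[of _ "Complex 1 e"] conjI exI[of _ "\<lambda>_. 0"]) (auto simp: Xpunct_def)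
  then show "Lambda E1 E2 (curve_class Xpunct E1 E2 (\<lambda>t. 0)) \<le> r" using e(2) by simp
qed

theorem theorem1:
  fixes w :: "(gen \<times> int) list"
  assumes "reduced_word w"
  shows "ereal (Lw w / (2 * pi)) \<le> Lambda E_tr E_pb (tr_pb w) \<and>
         Lambda E_tr E_pb (tr_pb w) \<le> ereal (300 * Lw w) \<and>
         ereal (Lw w / (2 * pi)) \<le> Lambda E_pb E_tr (pb_tr w) \<and>
         Lambda E_pb E_tr (pb_tr w) \<le> ereal (300 * Lw w)"
proof (cases "w = []")
  case True
  have L: "Lw [] = 0" by (simp add: Lw_def)
  have E: "0 \<in> E_tr" "0 \<in> E_pb"
    by (auto simp: E_tr_def E_pb_def intro!: exI[of _ 0])
  have "ereal 0 \<le> Lambda E1 E2 H" for E1 E2 H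
    by (rule Lambda_lower) simp
  then show ?thesis
    using Lambda_const_le_0[OF E] Lambda_const_le_0[OF E(2,1)]
    by (simp add: True L tr_pb_def pb_tr_def zero_ereal_def)
next
  case False
  then show ?thesis
    using Lambda_tr_pb_lower Lambda_tr_pb_upper Lambda_pb_tr_lower Lambda_pb_tr_upper assms by blast
qed

end
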